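(* Let $(A,\Delta)$ be an algebraic quantum group and $(X,\alpha)$ a right $A$-Galois object, with associated $\varphi_X$, $\delta_X$, $\sigma_X$ and $\theta_X$. Then: (vi) $\alpha\circ\sigma_X=(\theta_X\otimes\sigma)\circ\alpha$; (vii) $\alpha\circ\theta_X=(\theta_X\otimes S^2)\circ\alpha$; (viii) $\alpha\circ\theta_X=(\sigma_X\otimes\sigma'^{-1})\circ\alpha$; (ix) $\sigma_X\circ\theta_X=\theta_X\circ\sigma_X$; (x) $\theta_X(\delta_X)=\delta_X$; (xi) $\varphi_X\circ\theta_X=\varphi_X(\delta_X^{-1}\,\cdot\,\delta_X)=\tau\varphi_X$.
   Context: Conventions: $k$ is a field; all algebras are $k$-algebras, non-zero, possibly without unit, and non-degenerate ($ab=0$ for all $b$ implies $a=0$, and $ab=0$ for all $a$ implies $b=0$). $M(X)$ is the multiplier algebra of $X$, with $X\subseteq M(X)$ and $k=k\cdot 1\subseteq M(X)$; $\otimes$ is over $k$; $\iota$ is the identity map. Non-degenerate homomorphisms (in particular automorphisms) are extended to multiplier algebras without change of notation. A regular multiplier Hopf algebra is a pair $(A,\Delta)$ with $A$ an algebra and $\Delta:A\to M(A\otimes A)$ a coassociative homomorphism which is non-degenerate ($\Delta(A)(A\otimes A)=A\otimes A=(A\otimes A)\Delta(A)$) and such that the maps sending $a\otimes b$ to $\Delta(a)(1\otimes b)$, $(a\otimes 1)\Delta(b)$, $\Delta(a)(b\otimes 1)$, $(1\otimes a)\Delta(b)$ are all bijections of $A\otimes A$ onto $A\otimes A$; it has a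 unique counit $\varepsilon$ and antipode $S$. An algebraic quantum group is a regular multiplier Hopf algebra with a non-zero functional $\varphi$ (left invariant functional, faithful and unique up to scalar; a choice is fixed) such that $(\iota\otimes\varphi)(\Delta(a)(b\otimes 1))=\varphi(a)b$. Put $\psi=\varphi\circ S$. The modular automorphisms $\sigma,\sigma'$ of $A$ satisfy $\varphi(ab)=\varphi(b\sigma(a))$, $\psi(ab)=\psi(b\sigma'(a))$. The scaling constant $\tau\in k$ is defined by $\varphi\circ S^2=\tau\varphi$. A right coaction of $A$ on an algebra $X$ is an injective homomorphism $\alpha:X\to M(X\otimes A)$ with $\alpha(X)(1\otimes A)\subseteq X\otimes A$, $(1\otimes A)\alpha(X)\subseteq X\otimes A$ and $(\alpha\otimes\iota)\alpha=(\iota\otimes\Delta)\alpha$; it extends canonically to $M(X)\to M(X\otimes A)$. It is reduced if also $(X\otimes 1)\alpha(X)\subseteq X\otimes A$ (then also $\alpha(X)(X\otimes 1)\subseteq X\otimes A$). $(X,\alpha)$ is a right $A$-Galois object if $\alpha$ is a reduced right coaction, the only $f\in M(X)$ with $\alpha(f)=f\otimes 1$ are the scalars, and $V:X\otimes X\to X\otimes A$, $x\otimes y\mapsto (x\otimes 1)\alpha(y)$, is bijective. Associated objects: $\varphi_X$ is the (faithful) functional on $X$ with $(\iota\otimes\varphi)(\alpha(x))=\varphi_X(x)1$; $\psi_X$ is a fixed non-zero invariant functional on $X$, i.e. $(\psi_X\otimes\iota)\alpha(x)=\psi_X(x)1$; $\delta_X\in M(X)$ is the unique invertible element with $\varphi_X(x\delta_X)=\psi_X(x)$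 for all $x\in X$; $\sigma_X$ is the automorphism of $X$ with $\varphi_X(y\sigma_X(x))=\varphi_X(xy)$. Finally $\theta_X:X\to X$ is the automorphism $\theta_X(x)=\sigma_X(\hat\delta\cdot x)$, where $\hat\delta$ is the modular element of the dual $\hat A$ of $A$, acting on $X$ through $\omega_1\cdot x=(\iota\otimes\omega_1)\alpha(x)$; as a functional on $A$, $\hat\delta=\varepsilon\circ\sigma^{-1}=\varepsilon\circ\sigma'^{-1}$, so $\theta_X(x)=\sigma_X\big((\iota\otimes\varepsilon\sigma^{-1})\alpha(x)\big)$. *)

theory Defs
  imports Complex_Main
begin

section \<open>Algebras over a field\<close>

text \<open>An algebra over the field \<open>'k\<close> is a type of class \<^class>\<open>ring\<close> (no unit required) with a
  compatible scalar multiplication.\<close>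

locale k_algebra = vector_space scale
  for scale :: "'k::field \<Rightarrow> 'a::ring \<Rightarrow> 'a" +
  assumes scale_mult_left: "scale c a * b = scale c (a * b)"
    and scale_mult_right: "a * scale c b = scale c (a * b)"

locale nondegenerate_algebra = k_algebra scale
  for scale :: "'k::field \<Rightarrow> 'a::ring \<Rightarrow> 'a" +
  assumes nonzero: "\<exists>a :: 'a. a \<noteq> 0"
    and nondegenerate_left: "(\<forall>b :: 'a. a * b = 0) \<Longrightarrow> a = 0"
    and nondegenerate_right: "(\<forall>a :: 'a. a * b = 0) \<Longrightarrow> b = 0"

definition functional :: "('k::field \<Rightarrow> 'v::ab_group_add \<Rightarrow> 'v) \<Rightarrow> ('v \<Rightarrow> 'k) \<Rightarrow> bool" where
  "functional s f \<longleftrightarrow> Vector_Spaces.linear s (*) f"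

definition faithful :: "('a::ring \<Rightarrow> 'k::field) \<Rightarrow> bool" where
  "faithful f \<longleftrightarrow> (\<forall>a. (\<forall>b. f (a * b) = 0) \<longrightarrow> a = 0) \<and> (\<forall>a. (\<forall>b. f (b * a) = 0) \<longrightarrow> a = 0)"

definition automorphism :: "('k::field \<Rightarrow> 'a::ring \<Rightarrow> 'a) \<Rightarrow> ('a \<Rightarrow> 'a) \<Rightarrow> bool" where
  "automorphism s f \<longleftrightarrow>
     Vector_Spaces.linear s s f \<and> bij f \<and> (\<forall>a b. f (a * b) = f a * f b)"


section \<open>Multipliers\<close>

text \<open>A multiplier \<open>m\<close> is a pair of maps \<open>a \<mapsto> m a\<close> and \<open>a \<mapsto> a m\<close>. For a non-degenerate algebra all
  requirements except the last one, as well as linearity over the ground field, are automatic.\<close>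

typedef (overloaded) 'a multiplier =
  "{(l :: 'a::ring \<Rightarrow> 'a, r :: 'a \<Rightarrow> 'a).
      (\<forall>a b. l (a + b) = l a + l b) \<and> (\<forall>a b. r (a + b) = r a + r b) \<and>
      (\<forall>a b. l (a * b) = l a * b) \<and> (\<forall>a b. r (a * b) = a * r b) \<and>
      (\<forall>a b. a * l b = r a * b)}"
  by (rule exI[of _ "(\<lambda>a. a, \<lambda>a. a)"]) auto

setup_lifting type_definition_multiplier

lift_definition lmult :: "'a::ring multiplier \<Rightarrow> 'a \<Rightarrow> 'a" (infixr "\<rhd>" 72) is fst .

lift_definition rmult :: "'a::ring \<Rightarrow> 'a multiplier \<Rightarrow> 'a" (infixl "\<lhd>" 72) is "\<lambda>a m. snd m a" .

lemma multiplier_eqI: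
  "(\<And>a. m \<rhd> a = n \<rhd> a) \<Longrightarrow> (\<And>a. a \<lhd> m = a \<lhd> n) \<Longrightarrow> m = n"
  by transfer (auto simp: prod_eq_iff)

instantiation multiplier :: (ring) "{ring, monoid_mult}"
begin

lift_definition zero_multiplier :: "'a multiplier" is "(\<lambda>a. 0, \<lambda>a. 0)" by auto
lift_definition one_multiplier :: "'a multiplier" is "(\<lambda>a. a, \<lambda>a. a)" by auto
lift_definition plus_multiplier :: "'a multiplier \<Rightarrow> 'a multiplier \<Rightarrow> 'a multiplier"
  is "\<lambda>(l, r) (l', r'). (\<lambda>a. l a + l' a, \<lambda>a. r a + r' a)"
  by (auto simp: algebra_simps)
lift_definition uminus_multiplier :: "'a multiplier \<Rightarrow> 'a multiplier"
  is "\<lambda>(l, r). (\<lambda>a. - l a, \<lambda>a. - r a)"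
  by (auto simp: algebra_simps)
lift_definition minus_multiplier :: "'a multiplier \<Rightarrow> 'a multiplier \<Rightarrow> 'a multiplier"
  is "\<lambda>(l, r) (l', r'). (\<lambda>a. l a - l' a, \<lambda>a. r a - r' a)"
  by (auto simp: algebra_simps)
lift_definition times_multiplier :: "'a multiplier \<Rightarrow> 'a multiplier \<Rightarrow> 'a multiplier"
  is "\<lambda>(l, r) (l', r'). (\<lambda>a. l (l' a), \<lambda>a. r' (r a))"
  by auto

lemma act_simps:
  fixes m n :: "'a multiplier"
  shows "0 \<rhd> a = 0" "1 \<rhd> a = a" "(m + n) \<rhd> a = m \<rhd> a + n \<rhd> a"
    "(m - n) \<rhd> a = m \<rhd> a - n \<rhd> a" "(- m) \<rhd> a = - (m \<rhd> a)" "(m * n) \<rhd> a = m \<rhd> n \<rhd> a"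
    "a \<lhd> 0 = 0" "a \<lhd> 1 = a" "a \<lhd> (m + n) = a \<lhd> m + a \<lhd> n"
    "a \<lhd> (m - n) = a \<lhd> m - a \<lhd> n" "a \<lhd> (- m) = - (a \<lhd> m)" "a \<lhd> (m * n) = a \<lhd> m \<lhd> n"
  by (transfer; simp add: case_prod_beta)+

lemma act_add:
  fixes m :: "'a multiplier"
  shows "m \<rhd> (a + b) = m \<rhd> a + m \<rhd> b" "(a + b) \<lhd> m = a \<lhd> m + b \<lhd> m"
  by (transfer, clarsimp)+

instance
  by standard (rule multiplier_eqI; simp add: act_simps act_add)+

end

lift_definition embed :: "'a::ring \<Rightarrow> 'a multiplier" is "\<lambda>a. (\<lambda>b. a * b, \<lambda>b. b * a)"
  by (auto simp: algebra_simps)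

text \<open>The element of the algebra corresponding to a multiplier in the range of \<^const>\<open>embed\<close>.\<close>

definition unembed :: "'a::ring multiplier \<Rightarrow> 'a" where
  "unembed m = (THE a. embed a = m)"

definition invertible_multiplier :: "'a::ring multiplier \<Rightarrow> bool" where
  "invertible_multiplier m \<longleftrightarrow> (\<exists>n. m * n = 1 \<and> n * m = 1)"

definition minverse :: "'a::ring multiplier \<Rightarrow> 'a multiplier" where
  "minverse m = (THE n. m * n = 1 \<and> n * m = 1)"

definition mscalar :: "('k::field \<Rightarrow> 'a::ring \<Rightarrow> 'a) \<Rightarrow> 'k \<Rightarrow> 'a multiplier" where
  "mscalar s c = Abs_multiplier (s c, s c)"

definition mscale :: "('k::field \<Rightarrow> 'a::ring \<Rightarrow> 'a) \<Rightarrow> 'k \<Rightarrow> 'a multiplier \<Rightarrow> 'a multiplier" where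
  "mscale s c m = mscalar s c * m"

lemma (in k_algebra) mscalar_act:
  "mscalar scale c \<rhd> a = scale c a" "a \<lhd> mscalar scale c = scale c a"
  by (auto simp: mscalar_def lmult.rep_eq rmult.rep_eq Abs_multiplier_inverse
      scale_right_distrib scale_mult_left scale_mult_right)

lemma (in k_algebra) vector_space_mscale: "vector_space (mscale scale)"
  by unfold_locales
    (auto intro!: multiplier_eqI
      simp: mscale_def mscalar_act act_simps act_add scale_right_distrib scale_left_distrib ac_simps)

text \<open>A homomorphism \<open>h\<close> from \<open>X\<close> to \<open>M(Y)\<close>.\<close>

definition multiplier_hom ::
  "('k::field \<Rightarrow> 'x::ring \<Rightarrow> 'x) \<Rightarrow> ('k \<Rightarrow> 'y::ring \<Rightarrow> 'y) \<Rightarrow> ('x \<Rightarrow> 'y multiplier) \<Rightarrow> bool" where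
  "multiplier_hom sX sY h \<longleftrightarrow>
     Vector_Spaces.linear sX (mscale sY) h \<and> (\<forall>x y. h (x * y) = h x * h y)"

text \<open>The extension to \<open>M(X)\<close> of a homomorphism \<open>h\<close> from \<open>X\<close> to \<open>M(Y)\<close>: the value at \<open>m\<close> is the
  unique \<open>n\<close> with \<open>n h(x) = h(m x)\<close> and \<open>h(x) n = h(x m)\<close>. Existence and uniqueness hold for
  non-degenerate \<open>h\<close>, for coactions (where \<open>\<alpha>(X)(1 \<otimes> A) = X \<otimes> A = (1 \<otimes> A)\<alpha>(X)\<close>), and for
  automorphisms followed by \<^const>\<open>embed\<close>.\<close>

definition mext :: "('x::ring \<Rightarrow> 'y::ring multiplier) \<Rightarrow> 'x multiplier \<Rightarrow> 'y multiplier" where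
  "mext h m = (THE n. \<forall>x. n * h x = h (m \<rhd> x) \<and> h x * n = h (x \<lhd> m))"

definition mext_endo :: "('x::ring \<Rightarrow> 'x) \<Rightarrow> 'x multiplier \<Rightarrow> 'x multiplier" where
  "mext_endo f = mext (\<lambda>x. embed (f x))"


section \<open>Tensor products\<close>

definition bilinear_map ::
  "('k::field \<Rightarrow> 'u::ab_group_add \<Rightarrow> 'u) \<Rightarrow> ('k \<Rightarrow> 'v::ab_group_add \<Rightarrow> 'v) \<Rightarrow>
   ('k \<Rightarrow> 'w::ab_group_add \<Rightarrow> 'w) \<Rightarrow> ('u \<Rightarrow> 'v \<Rightarrow> 'w) \<Rightarrow> bool" where
  "bilinear_map sU sV sW \<beta> \<longleftrightarrow>
     (\<forall>u. Vector_Spaces.linear sV sW (\<beta> u)) \<and> (\<forall>v. Vector_Spaces.linear sU sW (\<lambda>u. \<beta> u v))"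

text \<open>The space underlying \<open>U \<otimes> V\<close> cannot be a type constructed from the types of \<open>U\<close> and \<open>V\<close>, as it
  depends on the scalar multiplications. Hence a tensor product is any type \<open>'t\<close> together with a
  scalar multiplication and a map \<open>(u, v) \<mapsto> u \<otimes> v\<close> having the universal property.\<close>

record ('k, 'u, 'v, 't) tensor =
  tscale :: "'k \<Rightarrow> 't \<Rightarrow> 't"
  pure :: "'u \<Rightarrow> 'v \<Rightarrow> 't"

text \<open>It suffices to demand the universal property for bilinear forms, as shown in
  \<open>universal\<close> below: it then holds for bilinear maps into arbitrary vector spaces.\<close>

locale tensor_product = U: vector_space sU + V: vector_space sV + T: vector_space "tscale T"
  for sU :: "'k::field \<Rightarrow> 'u::ab_group_add \<Rightarrow> 'u"
    and sV :: "'k \<Rightarrow> 'v::ab_group_add \<Rightarrow> 'v"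
    and T :: "('k, 'u, 'v, 't::ab_group_add) tensor" +
  assumes bilinear_pure: "bilinear_map sU sV (tscale T) (pure T)"
    and universal_form: "bilinear_map sU sV (*) \<beta> \<Longrightarrow>
          \<exists>!f. functional (tscale T) f \<and> (\<forall>u v. f (pure T u v) = \<beta> u v)"

lemma vector_space_self: "vector_space ((*) :: 'k::field \<Rightarrow> 'k \<Rightarrow> 'k)"
  by unfold_locales (auto simp: algebra_simps)

lemma (in vector_space) form_separating:
  assumes "x \<notin> span P"
  obtains f where "functional scale f" "\<And>p. p \<in> P \<Longrightarrow> f p = 0" "f x = 1"
proof -
  interpret K: vector_space "(*) :: 'a \<Rightarrow> 'a \<Rightarrow> 'a"
    by (rule vector_space_self)
  interpret VK: vector_space_pair scale "(*) :: 'a \<Rightarrow> 'a \<Rightarrow> 'a" ..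
  obtain B where B: "B \<subseteq> P" "independent B" "P \<subseteq> span B"
    using maximal_independent_subset by metis
  then have "x \<notin> span B"
    using assms span_mono by blast
  then have "independent (insert x B)"
    using B(2) by (simp add: independent_insertI)
  from VK.linear_independent_extend[OF this, of "\<lambda>b. if b = x then 1 else 0"]
  obtain f where f: "Vector_Spaces.linear scale (*) f"
    "\<forall>b\<in>insert x B. f b = (if b = x then 1 else 0)"
    by blast
  have "f b = 0" if "b \<in> B" for b
    using f(2) that \<open>x \<notin> span B\<close> by (metis insert_iff span_base)
  then have "f p = 0" if "p \<in> P" for p
    using VK.linear_eq_0_on_span[OF f(1)] B(3) that by blast
  with f show thesis
    by (intro that[of f]) (auto simp: functional_def)
qed

lemma (in tensor_product) span_pure: "T.span {pure T u v | u v. True} = UNIV"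
proof (rule ccontr)
  assume "\<not> ?thesis"
  then obtain x where "x \<notin> T.span {pure T u v | u v. True}"
    by blast
  then obtain f where f: "functional (tscale T) f" "\<And>u v. f (pure T u v) = 0" "f x = 1"
    by (rule T.form_separating) blast
  have K: "vector_space ((*) :: 'k \<Rightarrow> 'k \<Rightarrow> 'k)"
    by (rule vector_space_self)
  have "bilinear_map sU sV (*) (\<lambda>u v. 0)"
    unfolding bilinear_map_def using U.vector_space_axioms V.vector_space_axioms K
    by (simp add: Vector_Spaces.linear_iff)
  note unique = ex1E[OF universal_form[OF this]]
  have "functional (tscale T) (\<lambda>t. 0)"
    using T.vector_space_axioms K by (simp add: functional_def Vector_Spaces.linear_iff)
  with f(1,2) have "f = (\<lambda>t. 0)"
    by (rule_tac unique) (metis (no_types, lifting))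
  with f(3) show False
    by simp
qed

lemma (in tensor_product) universal:
  fixes sW :: "'k \<Rightarrow> 'w::ab_group_add \<Rightarrow> 'w"
  assumes W: "vector_space sW" and \<beta>: "bilinear_map sU sV sW \<beta>"
  shows "\<exists>!f. Vector_Spaces.linear (tscale T) sW f \<and> (\<forall>u v. f (pure T u v) = \<beta> u v)"
proof -
  let ?P = "{pure T u v | u v. True}"
  interpret W: vector_space sW by fact
  interpret TW: vector_space_pair "tscale T" sW ..
  interpret K: vector_space "(*) :: 'k \<Rightarrow> 'k \<Rightarrow> 'k"
    by (rule vector_space_self)
  interpret TK: vector_space_pair "tscale T" "(*) :: 'k \<Rightarrow> 'k \<Rightarrow> 'k" ..
  obtain B where B: "B \<subseteq> ?P" "T.independent B" "?P \<subseteq> T.span B"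
    by (rule T.maximal_independent_subset)
  have span_B: "T.span B = UNIV"
    using T.span_minimal[OF B(3) T.subspace_span] span_pure by blast
  have "\<forall>b\<in>B. \<exists>w. \<exists>u v. b = pure T u v \<and> w = \<beta> u v"
    using B(1) by blast
  from bchoice[OF this] obtain g where g: "\<forall>b\<in>B. \<exists>u v. b = pure T u v \<and> g b = \<beta> u v" ..
  obtain f where f: "Vector_Spaces.linear (tscale T) sW f" "\<forall>b\<in>B. f b = g b"
    using TW.linear_independent_extend[OF B(2)] by blast
  have lift: "f (pure T u v) = \<beta> u v" for u v
  proof (rule ccontr)
    assume "f (pure T u v) \<noteq> \<beta> u v"
    then have "f (pure T u v) - \<beta> u v \<notin> W.span {}"
      by simp
    then obtain h where h: "functional sW h" "h (f (pure T u v) - \<beta> u v) = 1"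
      by (rule W.form_separating) blast
    from h(1) have hl: "Vector_Spaces.linear sW (*) h"
      by (simp add: functional_def)
    have "bilinear_map sU sV (*) (\<lambda>u v. h (\<beta> u v))"
      unfolding bilinear_map_def
    proof (intro conjI allI)
      show "Vector_Spaces.linear sV (*) (\<lambda>v. h (\<beta> u v))" for u
        using Vector_Spaces.linear_compose[OF _ hl, of sV "\<beta> u"] \<beta>
        by (simp add: bilinear_map_def comp_def)
      show "Vector_Spaces.linear sU (*) (\<lambda>u. h (\<beta> u v))" for v
        using Vector_Spaces.linear_compose[OF _ hl, of sU "\<lambda>u. \<beta> u v"] \<beta>
        by (simp add: bilinear_map_def comp_def)
    qed
    from ex1_implies_ex[OF universal_form[OF this]] obtain k where k:
      "Vector_Spaces.linear (tscale T) (*) k" "\<And>u v. k (pure T u v) = h (\<beta> u v)"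
      unfolding functional_def by blast
    have "Vector_Spaces.linear (tscale T) (*) (\<lambda>t. h (f t))"
      using Vector_Spaces.linear_compose[OF f(1) hl] by (simp add: comp_def)
    moreover have "k b = h (f b)" if "b \<in> B" for b
      proof -
      from g that obtain u v where "b = pure T u v" "g b = \<beta> u v" by blast
      with f(2) k(2) that show ?thesis by simp
    qed
    ultimately have "k t = h (f t)" for t
      using TK.linear_eq_on[OF k(1), of "\<lambda>t. h (f t)" t B] span_B by simp
    from this[of "pure T u v"] k(2) have "h (f (pure T u v)) = h (\<beta> u v)"
      by simp
    moreover have "h (f (pure T u v) - \<beta> u v) = h (f (pure T u v)) - h (\<beta> u v)"
      by (rule module_hom.diff[OF module_hom_linearI[OF hl]])
    ultimately show False
      using h(2) by simp
  qed
  have unique: "f1 = f2"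
    if "Vector_Spaces.linear (tscale T) sW f1" "Vector_Spaces.linear (tscale T) sW f2"
      "\<forall>u v. f1 (pure T u v) = \<beta> u v" "\<forall>u v. f2 (pure T u v) = \<beta> u v" for f1 f2
  proof
    fix t
    show "f1 t = f2 t"
      using span_pure that(3,4) by (intro TW.linear_eq_on[OF that(1,2), of t ?P]) auto
  qed
  show ?thesis
  proof (rule ex1I[of _ f])
    show "Vector_Spaces.linear (tscale T) sW f \<and> (\<forall>u v. f (pure T u v) = \<beta> u v)"
      using f(1) lift by blast
  qed (use f(1) lift unique in blast)
qed

text \<open>The linear map on \<open>U \<otimes> V\<close> induced by a bilinear map \<open>\<beta>\<close>.\<close>

definition tensor_lift ::
  "('k::field, 'u, 'v, 't::ab_group_add) tensor \<Rightarrow> ('k \<Rightarrow> 'w::ab_group_add \<Rightarrow> 'w) \<Rightarrow>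
   ('u \<Rightarrow> 'v \<Rightarrow> 'w) \<Rightarrow> 't \<Rightarrow> 'w" where
  "tensor_lift T sW \<beta> =
     (THE f. Vector_Spaces.linear (tscale T) sW f \<and> (\<forall>u v. f (pure T u v) = \<beta> u v))"

locale tensor_algebra = A: k_algebra sA + B: k_algebra sB + T: k_algebra "tscale T" +
    tensor_product sA sB T
  for sA :: "'k::field \<Rightarrow> 'a::ring \<Rightarrow> 'a"
    and sB :: "'k \<Rightarrow> 'b::ring \<Rightarrow> 'b"
    and T :: "('k, 'a, 'b, 't::ring) tensor" +
  assumes mult_pure: "pure T a b * pure T a' b' = pure T (a * a') (b * b')"

text \<open>\<open>m \<otimes> n\<close> in \<open>M(A \<otimes> B)\<close> for multipliers \<open>m\<close> of \<open>A\<close> and \<open>n\<close> of \<open>B\<close>.\<close>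

definition mtensor ::
  "('k, 'a::ring, 'b::ring, 't::ring) tensor \<Rightarrow> 'a multiplier \<Rightarrow> 'b multiplier \<Rightarrow> 't multiplier" where
  "mtensor T m n = (THE p. \<forall>a b.
     p \<rhd> pure T a b = pure T (m \<rhd> a) (n \<rhd> b) \<and> pure T a b \<lhd> p = pure T (a \<lhd> m) (b \<lhd> n))"

abbreviation leg1 :: "('k, 'a::ring, 'b::ring, 't::ring) tensor \<Rightarrow> 'a \<Rightarrow> 't multiplier" where
  "leg1 T a \<equiv> mtensor T (embed a) 1"

abbreviation leg2 :: "('k, 'a::ring, 'b::ring, 't::ring) tensor \<Rightarrow> 'b \<Rightarrow> 't multiplier" where
  "leg2 T b \<equiv> mtensor T 1 (embed b)"

definition tensor_endo ::
  "('k::field, 'a, 'b, 't::ring) tensor \<Rightarrow> ('a \<Rightarrow> 'a) \<Rightarrow> ('b \<Rightarrow> 'b) \<Rightarrow> 't \<Rightarrow> 't" where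
  "tensor_endo T f g = tensor_lift T (tscale T) (\<lambda>a b. pure T (f a) (g b))"

text \<open>\<open>g \<otimes> h\<close> on \<open>A \<otimes> B\<close>, where \<open>g\<close> maps \<open>A\<close> to \<open>M(C)\<close>, \<open>h\<close> maps \<open>B\<close> to \<open>M(D)\<close> and \<open>T'\<close> is
  \<open>C \<otimes> D\<close>.\<close>

definition tensor_hom ::
  "('k::field, 'a, 'b, 't::ring) tensor \<Rightarrow> ('k, 'c::ring, 'd::ring, 'u::ring) tensor \<Rightarrow>
   ('a \<Rightarrow> 'c multiplier) \<Rightarrow> ('b \<Rightarrow> 'd multiplier) \<Rightarrow> 't \<Rightarrow> 'u multiplier" where
  "tensor_hom T T' g h = tensor_lift T (mscale (tscale T')) (\<lambda>a b. mtensor T' (g a) (h b))"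

text \<open>The slice maps \<open>\<iota> \<otimes> \<omega>\<close> and \<open>\<omega> \<otimes> \<iota>\<close> on \<open>A \<otimes> B\<close>, and their versions for those multipliers of
  \<open>A \<otimes> B\<close> whose products with \<open>A \<otimes> 1\<close>, respectively \<open>1 \<otimes> B\<close>, lie in \<open>A \<otimes> B\<close>.\<close>

definition slice1 ::
  "('k::field \<Rightarrow> 'a \<Rightarrow> 'a) \<Rightarrow> ('k, 'a::ring, 'b, 't::ring) tensor \<Rightarrow> ('b \<Rightarrow> 'k) \<Rightarrow> 't \<Rightarrow> 'a" where
  "slice1 sA T \<omega> = tensor_lift T sA (\<lambda>a b. sA (\<omega> b) a)"

definition slice2 ::
  "('k::field \<Rightarrow> 'b \<Rightarrow> 'b) \<Rightarrow> ('k, 'a, 'b::ring, 't::ring) tensor \<Rightarrow> ('a \<Rightarrow> 'k) \<Rightarrow> 't \<Rightarrow> 'b" where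
  "slice2 sB T \<omega> = tensor_lift T sB (\<lambda>a b. sB (\<omega> a) b)"

definition mslice1 ::
  "('k::field \<Rightarrow> 'a \<Rightarrow> 'a) \<Rightarrow> ('k, 'a::ring, 'b::ring, 't::ring) tensor \<Rightarrow> ('b \<Rightarrow> 'k) \<Rightarrow>
   't multiplier \<Rightarrow> 'a multiplier" where
  "mslice1 sA T \<omega> m = (THE n. \<forall>a.
     n \<rhd> a = slice1 sA T \<omega> (unembed (m * leg1 T a)) \<and>
     a \<lhd> n = slice1 sA T \<omega> (unembed (leg1 T a * m)))"

definition mslice2 ::
  "('k::field \<Rightarrow> 'b \<Rightarrow> 'b) \<Rightarrow> ('k, 'a::ring, 'b::ring, 't::ring) tensor \<Rightarrow> ('a \<Rightarrow> 'k) \<Rightarrow>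
   't multiplier \<Rightarrow> 'b multiplier" where
  "mslice2 sB T \<omega> m = (THE n. \<forall>b.
     n \<rhd> b = slice2 sB T \<omega> (unembed (m * leg2 T b)) \<and>
     b \<lhd> n = slice2 sB T \<omega> (unembed (leg2 T b * m)))"

text \<open>The linear map \<open>u \<otimes> v \<mapsto> F u v\<close> is a bijection onto the algebra \<open>B \<subseteq> M(B)\<close>.\<close>

definition bijective_onto_algebra ::
  "('k::field, 'u, 'v, 't::ab_group_add) tensor \<Rightarrow> ('k \<Rightarrow> 'b::ring \<Rightarrow> 'b) \<Rightarrow>
   ('u \<Rightarrow> 'v \<Rightarrow> 'b multiplier) \<Rightarrow> bool" where
  "bijective_onto_algebra T sB F \<longleftrightarrow>
     (\<forall>u v. F u v \<in> range embed) \<and> bij (tensor_lift T sB (\<lambda>u v. unembed (F u v)))"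


section \<open>Algebraic quantum groups\<close>

text \<open>\<open>AA\<close> is \<open>A \<otimes> A\<close>, while \<open>AA_A\<close> and \<open>A_AA\<close> present the same algebra \<open>A \<otimes> A \<otimes> A\<close> as
  \<open>(A \<otimes> A) \<otimes> A\<close> and \<open>A \<otimes> (A \<otimes> A)\<close>.\<close>

locale regular_multiplier_hopf_algebra =
    A: nondegenerate_algebra sA +
    AA: tensor_algebra sA sA AA +
    AA_A: tensor_algebra "tscale AA" sA AA_A +
    A_AA: tensor_algebra sA "tscale AA" A_AA
  for sA :: "'k::field \<Rightarrow> 'a::ring \<Rightarrow> 'a"
    and AA :: "('k, 'a, 'a, 'aa::ring) tensor"
    and AA_A :: "('k, 'aa, 'a, 'aaa::ring) tensor"
    and A_AA :: "('k, 'a, 'aa, 'aaa) tensor"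
    and \<Delta> :: "'a \<Rightarrow> 'aa multiplier" +
  assumes tscale_assoc: "tscale AA_A = tscale A_AA"
    and pure_assoc: "pure AA_A (pure AA a b) c = pure A_AA a (pure AA b c)"
    and hom_\<Delta>: "multiplier_hom sA (tscale AA) \<Delta>"
    and nondegenerate_\<Delta>_left: "AA.T.span {\<Delta> a \<rhd> w | a w. True} = UNIV"
    and nondegenerate_\<Delta>_right: "AA.T.span {w \<lhd> \<Delta> a | a w. True} = UNIV"
    and coassoc: "mext (tensor_hom AA AA_A \<Delta> embed) (\<Delta> a) = mext (tensor_hom AA A_AA embed \<Delta>) (\<Delta> a)"
    and bij1: "bijective_onto_algebra AA (tscale AA) (\<lambda>a b. \<Delta> a * leg2 AA b)"
    and bij2: "bijective_onto_algebra AA (tscale AA) (\<lambda>a b. leg1 AA a * \<Delta> b)"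
    and bij3: "bijective_onto_algebra AA (tscale AA) (\<lambda>a b. \<Delta> a * leg1 AA b)"
    and bij4: "bijective_onto_algebra AA (tscale AA) (\<lambda>a b. leg2 AA a * \<Delta> b)"

definition is_counit ::
  "('k::field \<Rightarrow> 'a::ring \<Rightarrow> 'a) \<Rightarrow> ('k, 'a, 'a, 'aa::ring) tensor \<Rightarrow> ('a \<Rightarrow> 'aa multiplier) \<Rightarrow>
   ('a \<Rightarrow> 'k) \<Rightarrow> bool" where
  "is_counit sA AA \<Delta> \<epsilon> \<longleftrightarrow>
     functional sA \<epsilon> \<and> (\<forall>a b. \<epsilon> (a * b) = \<epsilon> a * \<epsilon> b) \<and>
     (\<forall>a b. slice2 sA AA \<epsilon> (unembed (\<Delta> a * leg2 AA b)) = a * b) \<and>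
     (\<forall>a b. slice1 sA AA \<epsilon> (unembed (leg1 AA a * \<Delta> b)) = a * b)"

text \<open>The last two conditions are \<open>m(S \<otimes> \<iota>)(\<Delta>(a)(1 \<otimes> b)) = \<epsilon>(a)b\<close> and
  \<open>m(\<iota> \<otimes> S)((a \<otimes> 1)\<Delta>(b)) = \<epsilon>(b)a\<close>, with \<open>m\<close> the multiplication of \<open>A\<close>.\<close>

definition is_antipode ::
  "('k::field \<Rightarrow> 'a::ring \<Rightarrow> 'a) \<Rightarrow> ('k, 'a, 'a, 'aa::ring) tensor \<Rightarrow> ('a \<Rightarrow> 'aa multiplier) \<Rightarrow>
   ('a \<Rightarrow> 'k) \<Rightarrow> ('a \<Rightarrow> 'a) \<Rightarrow> bool" where
  "is_antipode sA AA \<Delta> \<epsilon> S \<longleftrightarrow>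
     Vector_Spaces.linear sA sA S \<and> bij S \<and> (\<forall>a b. S (a * b) = S b * S a) \<and>
     (\<forall>a b. tensor_lift AA sA (\<lambda>p q. S p * q) (unembed (\<Delta> a * leg2 AA b)) = sA (\<epsilon> a) b) \<and>
     (\<forall>a b. tensor_lift AA sA (\<lambda>p q. p * S q) (unembed (leg1 AA a * \<Delta> b)) = sA (\<epsilon> b) a)"

locale algebraic_quantum_group = regular_multiplier_hopf_algebra sA AA AA_A A_AA \<Delta>
  for sA :: "'k::field \<Rightarrow> 'a::ring \<Rightarrow> 'a"
    and AA :: "('k, 'a, 'a, 'aa::ring) tensor"
    and AA_A :: "('k, 'aa, 'a, 'aaa::ring) tensor"
    and A_AA :: "('k, 'a, 'aa, 'aaa) tensor"
    and \<Delta> :: "'a \<Rightarrow> 'aa multiplier" +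
  fixes \<epsilon> :: "'a \<Rightarrow> 'k" and S :: "'a \<Rightarrow> 'a" and \<phi> :: "'a \<Rightarrow> 'k"
  assumes counit: "is_counit sA AA \<Delta> \<epsilon>"
    and antipode: "is_antipode sA AA \<Delta> \<epsilon> S"
    and functional_\<phi>: "functional sA \<phi>"
    and nonzero_\<phi>: "\<exists>a. \<phi> a \<noteq> 0"
    and left_invariant: "slice1 sA AA \<phi> (unembed (\<Delta> a * leg1 AA b)) = sA (\<phi> a) b"
    and faithful_\<phi>: "faithful \<phi>"

definition modular_automorphism ::
  "('k::field \<Rightarrow> 'a::ring \<Rightarrow> 'a) \<Rightarrow> ('a \<Rightarrow> 'k) \<Rightarrow> ('a \<Rightarrow> 'a) \<Rightarrow> bool" where
  "modular_automorphism s \<phi> \<sigma> \<longleftrightarrow> automorphism s \<sigma> \<and> (\<forall>a b. \<phi> (a * b) = \<phi> (b * \<sigma> a))"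


section \<open>Galois objects\<close>

text \<open>The last condition is \<open>(\<alpha> \<otimes> \<iota>)\<alpha> = (\<iota> \<otimes> \<Delta>)\<alpha>\<close>. Both sides are compared after right multiplication
  with \<open>1 \<otimes> 1 \<otimes> a\<close>, because it is only a consequence of coassociativity that \<open>\<alpha> \<otimes> \<iota>\<close> extends to
  \<open>M(X \<otimes> A)\<close>. \<open>XA_A\<close> and \<open>X_AA\<close> present \<open>X \<otimes> A \<otimes> A\<close> as \<open>(X \<otimes> A) \<otimes> A\<close> and \<open>X \<otimes> (A \<otimes> A)\<close>.\<close>

locale right_coaction =
    regular_multiplier_hopf_algebra sA AA AA_A A_AA \<Delta> +
    X: nondegenerate_algebra sX +
    XA: tensor_algebra sX sA XA +
    XA_A: tensor_algebra "tscale XA" sA XA_A +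
    X_AA: tensor_algebra sX "tscale AA" X_AA
  for sA :: "'k::field \<Rightarrow> 'a::ring \<Rightarrow> 'a"
    and AA :: "('k, 'a, 'a, 'aa::ring) tensor"
    and AA_A :: "('k, 'aa, 'a, 'aaa::ring) tensor"
    and A_AA :: "('k, 'a, 'aa, 'aaa) tensor"
    and \<Delta> :: "'a \<Rightarrow> 'aa multiplier"
    and sX :: "'k \<Rightarrow> 'x::ring \<Rightarrow> 'x"
    and XA :: "('k, 'x, 'a, 'xa::ring) tensor"
    and XA_A :: "('k, 'xa, 'a, 'xaa::ring) tensor"
    and X_AA :: "('k, 'x, 'aa, 'xaa) tensor"
    and \<alpha> :: "'x \<Rightarrow> 'xa multiplier" +
  assumes tscale_assoc_X: "tscale XA_A = tscale X_AA"
    and pure_assoc_X: "pure XA_A (pure XA x a) b = pure X_AA x (pure AA a b)"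
    and hom_\<alpha>: "multiplier_hom sX (tscale XA) \<alpha>"
    and inj_\<alpha>: "inj \<alpha>"
    and \<alpha>_leg2: "\<alpha> x * leg2 XA a \<in> range embed"
    and leg2_\<alpha>: "leg2 XA a * \<alpha> x \<in> range embed"
    and coassoc_\<alpha>:
      "tensor_hom XA XA_A \<alpha> embed (unembed (\<alpha> x * leg2 XA a)) =
       mext (tensor_hom XA X_AA embed \<Delta>) (\<alpha> x) * leg2 XA_A a"

locale reduced_right_coaction =
    right_coaction sA AA AA_A A_AA \<Delta> sX XA XA_A X_AA \<alpha>
  for sA :: "'k::field \<Rightarrow> 'a::ring \<Rightarrow> 'a"
    and AA :: "('k, 'a, 'a, 'aa::ring) tensor"
    and AA_A :: "('k, 'aa, 'a, 'aaa::ring) tensor"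
    and A_AA :: "('k, 'a, 'aa, 'aaa) tensor"
    and \<Delta> :: "'a \<Rightarrow> 'aa multiplier"
    and sX :: "'k \<Rightarrow> 'x::ring \<Rightarrow> 'x"
    and XA :: "('k, 'x, 'a, 'xa::ring) tensor"
    and XA_A :: "('k, 'xa, 'a, 'xaa::ring) tensor"
    and X_AA :: "('k, 'x, 'aa, 'xaa) tensor"
    and \<alpha> :: "'x \<Rightarrow> 'xa multiplier" +
  assumes leg1_\<alpha>: "leg1 XA y * \<alpha> x \<in> range embed"

locale galois_object =
    reduced_right_coaction sA AA AA_A A_AA \<Delta> sX XA XA_A X_AA \<alpha> +
    XX: tensor_product sX sX XX
  for sA :: "'k::field \<Rightarrow> 'a::ring \<Rightarrow> 'a"
    and AA :: "('k, 'a, 'a, 'aa::ring) tensor"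
    and AA_A :: "('k, 'aa, 'a, 'aaa::ring) tensor"
    and A_AA :: "('k, 'a, 'aa, 'aaa) tensor"
    and \<Delta> :: "'a \<Rightarrow> 'aa multiplier"
    and sX :: "'k \<Rightarrow> 'x::ring \<Rightarrow> 'x"
    and XA :: "('k, 'x, 'a, 'xa::ring) tensor"
    and XA_A :: "('k, 'xa, 'a, 'xaa::ring) tensor"
    and X_AA :: "('k, 'x, 'aa, 'xaa) tensor"
    and \<alpha> :: "'x \<Rightarrow> 'xa multiplier"
    and XX :: "('k, 'x, 'x, 'xx::ab_group_add) tensor" +
  assumes coinvariants: "mext \<alpha> f = mtensor XA f 1 \<Longrightarrow> \<exists>c. f = mscalar sX c"
    and galois: "bijective_onto_algebra XX (tscale XA) (\<lambda>x y. leg1 XA x * \<alpha> y)"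

text \<open>The modular element of the dual of \<open>A\<close> is a multiplier of the dual, and as such a functional on
  \<open>A\<close>, namely \<open>\<epsilon> \<circ> \<sigma>\<^sup>-\<^sup>1\<close> with \<open>\<sigma>\<close> the modular automorphism of the left invariant functional.\<close>

definition dual_modular_element :: "('a \<Rightarrow> 'k) \<Rightarrow> ('a \<Rightarrow> 'a) \<Rightarrow> 'a \<Rightarrow> 'k" where
  "dual_modular_element \<epsilon> \<sigma> = \<epsilon> \<circ> inv \<sigma>"

text \<open>\<open>\<omega> \<cdot> x = (\<iota> \<otimes> \<omega>)\<alpha>(x)\<close>, for those \<open>\<omega>\<close> for which this multiplier lies in \<open>X\<close>. The multiplicative
  functional \<^const>\<open>dual_modular_element\<close> is one of these.\<close>

definition functional_action ::
  "('k::field \<Rightarrow> 'x::ring \<Rightarrow> 'x) \<Rightarrow> ('k, 'x, 'a::ring, 'xa::ring) tensor \<Rightarrow>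
   ('x \<Rightarrow> 'xa multiplier) \<Rightarrow> ('a \<Rightarrow> 'k) \<Rightarrow> 'x \<Rightarrow> 'x" where
  "functional_action sX XA \<alpha> \<omega> x = unembed (mslice1 sX XA \<omega> (\<alpha> x))"

end

theory Submission
  imports Defs
begin

text \<open>
  Write \<open>\<alpha>(x) = x\<^sub>0 \<otimes> x\<^sub>1\<close> and \<open>\<omega> \<cdot> x = x\<^sub>0 \<omega>(x\<^sub>1)\<close>, and let \<open>\<chi> = \<epsilon> \<sigma>\<^sup>-\<^sup>1\<close>, so that \<open>\<theta>(x) = \<sigma>\<^sub>X(\<chi> \<cdot> x)\<close>. Since \<open>\<phi>\<close> is
  faithful, an equation \<open>\<alpha> F = (G \<otimes> h)\<alpha>\<close> is the same as \<open>\<omega> \<cdot> F(x) = G(\<omega>h \<cdot> x)\<close> for all functionals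
  \<open>\<omega> = \<phi>(c \<cdot>)\<close> (\<open>P_eq_if_act_eq\<close>). These functionals map \<open>X\<close> into itself, so most of the argument takes place
  inside \<open>X\<close> and \<open>A\<close>.

  The first formula rests on adjoints. Left invariance of \<open>\<phi>\<close> shows that \<open>\<phi>(c \<cdot>)\<close>, as an operator on \<open>A\<close>, has
  the adjoint \<open>\<phi>(\<cdot> S(c))\<close> with respect to the form \<open>\<phi>(ab)\<close> (\<open>act_adjoint\<close>). As \<open>\<phi>\<^sub>X(xy) 1 = x\<^sub>0 y\<^sub>0 \<phi>(x\<^sub>1 y\<^sub>1)\<close>,
  the same adjoint works on \<open>X\<close> with respect to \<open>\<phi>\<^sub>X(xy)\<close> (\<open>act_adjoint_X\<close>). Taking adjoints twice and using the modular
  property in between gives \<open>\<omega> \<cdot> \<sigma>\<^sub>X(x) = \<sigma>\<^sub>X(\<omega>'' \<cdot> x)\<close>, where the second adjoint \<open>\<omega>''\<close> is the same functional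
  for every \<open>X\<close>. It can therefore be computed in \<open>A\<close>, with the result \<open>\<omega>'' = \<chi> * \<omega>\<sigma>\<close> (\<open>double_adjoint\<close>), and this is
  \<open>\<alpha> \<sigma>\<^sub>X = (\<theta> \<otimes> \<sigma>)\<alpha>\<close>. The formulas for \<open>\<alpha> \<theta>\<close> follow by inserting \<open>\<chi> \<cdot> x\<close> for \<open>x\<close> and rewriting functionals on \<open>A\<close>,
  and evaluation on \<open>\<chi>\<close> shows that \<open>\<theta>\<close> and \<open>\<sigma>\<^sub>X\<close> commute.

  The facts on \<open>A\<close> that enter are \<open>\<Delta> \<sigma> = (S\<^sup>2 \<otimes> \<sigma>)\<Delta>\<close>, \<open>\<Delta> \<sigma>' = (\<sigma>' \<otimes> S\<^sup>-\<^sup>2)\<Delta>\<close> and \<open>\<epsilon> \<sigma>\<^sup>-\<^sup>1 = \<epsilon> \<sigma>'\<^sup>-\<^sup>1\<close>. For an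
  invariant functional \<open>\<psi>\<close> on any coaction, \<open>\<psi>((\<omega> \<cdot> x)y) = \<psi>(x(\<omega>S \<cdot> y))\<close> (\<open>invariant_shift\<close>), which by the
  same double commutation yields \<open>\<alpha> \<rho> = (\<rho> \<otimes> S\<^sup>-\<^sup>2)\<alpha>\<close> for the modular automorphism \<open>\<rho>\<close> of \<open>\<psi>\<close>
  (\<open>act_modular_of_invariant\<close>). On \<open>A\<close> this is the formula for \<open>\<sigma>'\<close>, and the one for \<open>\<sigma>\<close> is its conjugate under \<open>S\<close>,
  because \<open>S\<close> reverses \<open>\<Delta>\<close> (\<open>antipode_comult\<close>).

  On \<open>X\<close> the modular automorphism of \<open>\<psi>\<^sub>X\<close> is \<open>\<rho> = \<delta>\<^sub>X \<sigma>\<^sub>X(\<cdot>) \<delta>\<^sub>X\<^sup>-\<^sup>1\<close>. Applying \<open>\<iota> \<otimes> \<phi>\<close> to \<open>\<alpha> \<rho> = (\<rho> \<otimes> S\<^sup>-\<^sup>2)\<alpha>\<close> and to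
  \<open>\<alpha> \<theta> = (\<theta> \<otimes> S\<^sup>2)\<alpha>\<close> shows how \<open>\<rho>\<close> and \<open>\<theta>\<close> scale \<open>\<phi>\<^sub>X\<close>, which settles the formulas with \<open>\<tau>\<close>. Finally \<open>\<theta>\<close> scales
  \<open>\<psi>\<^sub>X\<close> by \<open>\<tau>\<close> too, and comparing the two functionals gives \<open>\<theta>(\<delta>\<^sub>X) = \<delta>\<^sub>X\<close>.

  Identities between multipliers of tensor products are handled by covering: after multiplication by elements of one
  leg they become identities between tensors, written as sums over presentations (\<open>tsum\<close>), and the
  factors are cancelled by non-degeneracy in the end.
\<close>

section \<open>Multipliers of non-degenerate algebras\<close>

lemma act_assoc:
  fixes m :: "'a::ring multiplier"
  shows "(m \<rhd> a) * b = m \<rhd> (a * b)" "a * (b \<lhd> m) = (a * b) \<lhd> m" "a * (m \<rhd> b) = (a \<lhd> m) * b"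
  by (transfer, auto)+

lemma embed_act: "embed a \<rhd> b = a * b" "b \<lhd> embed a = b * a"
  by (transfer, simp)+

lemma embed_mult_multiplier: "m * embed a = embed (m \<rhd> a)" "embed a * m = embed (a \<lhd> m)"
  by (rule multiplier_eqI; simp add: act_simps embed_act act_assoc)+

lemma embed_add: "embed (a + b) = embed a + embed b"
  by (rule multiplier_eqI; simp add: act_simps embed_act algebra_simps)

lemma embed_mult: "embed (a * b) = embed a * embed b"
  by (rule multiplier_eqI; simp add: act_simps embed_act algebra_simps)

lemma act_zero: "m \<rhd> 0 = 0" "0 \<lhd> m = 0" for m :: "'a::ring multiplier"
  using act_add(1)[of m 0 0] act_add(2)[of 0 0 m] by simp_all

lemma act_diff: "m \<rhd> (a - b) = m \<rhd> a - m \<rhd> b" "(a - b) \<lhd> m = a \<lhd> m - b \<lhd> m"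
  for m :: "'a::ring multiplier"
  using act_add(1)[of m "a - b" b] act_add(2)[of "a - b" b m] by simp_all

context nondegenerate_algebra
begin

lemma eq_if_left_mult_eq: "a = b" if "\<And>c. c * a = c * b" for a b :: 'a
  using nondegenerate_right[of "a - b"] that by (simp add: algebra_simps)

lemma eq_if_right_mult_eq: "a = b" if "\<And>c. a * c = b * c" for a b :: 'a
  using nondegenerate_left[of "a - b"] that by (simp add: algebra_simps)

lemma multiplier_eqI_left: "m = n" if "\<And>a. m \<rhd> a = n \<rhd> a" for m n :: "'a multiplier"
proof (rule multiplier_eqI[OF that])
  show "a \<lhd> m = a \<lhd> n" for a
    by (rule eq_if_right_mult_eq) (simp add: act_assoc(3)[symmetric] that)
qed

lemma multiplier_eqI_right: "m = n" if "\<And>a. a \<lhd> m = a \<lhd> n" for m n :: "'a multiplier"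
proof (rule multiplier_eqI[OF _ that])
  show "m \<rhd> a = n \<rhd> a" for a
    by (rule eq_if_left_mult_eq) (simp add: act_assoc(3) that)
qed

text \<open>Additivity and the module properties demanded of a multiplier follow from compatibility of its
  two halves by cancelling an arbitrary factor. Hence constructing a multiplier amounts to checking a
  single equation.\<close>

lemma multiplier_exists:
  assumes "\<And>a b. a * l b = r a * b"
  obtains m :: "'a multiplier" where "\<And>a. m \<rhd> a = l a" "\<And>a. a \<lhd> m = r a"
proof -
  have "l (a + b) = l a + l b" "l (a * b) = l a * b" for a b
    by (rule eq_if_left_mult_eq; simp add: assms distrib_left mult.assoc[symmetric])+
  moreover have "r (a + b) = r a + r b" "r (a * b) = a * r b" for a b
    by (rule eq_if_right_mult_eq; simp add: assms[symmetric] distrib_right mult.assoc)+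
  ultimately show thesis
    using assms
    by (intro that[of "Abs_multiplier (l, r)"])
      (simp_all add: lmult.rep_eq rmult.rep_eq Abs_multiplier_inverse)
qed

lemma act_scale: "m \<rhd> scale c a = scale c (m \<rhd> a)" "scale c a \<lhd> m = scale c (a \<lhd> m)"
  for m :: "'a multiplier"
proof -
  show "m \<rhd> scale c a = scale c (m \<rhd> a)"
    by (rule eq_if_left_mult_eq) (simp add: act_assoc(3) scale_mult_right)
  show "scale c a \<lhd> m = scale c (a \<lhd> m)"
    by (rule eq_if_right_mult_eq) (simp add: act_assoc(3)[symmetric] scale_mult_left)
qed

lemma lmult_rmult: "(m \<rhd> a) \<lhd> n = m \<rhd> (a \<lhd> n)" for m n :: "'a multiplier"
  by (rule eq_if_left_mult_eq) (simp add: act_assoc)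

lemma embed_eq_iff: "embed (a :: 'a) = embed b \<longleftrightarrow> a = b"
  using eq_if_right_mult_eq by (metis embed_act(1))

lemma unembed_embed: "unembed (embed a) = (a :: 'a)"
  by (simp add: unembed_def embed_eq_iff)

lemma embed_unembed: "m \<in> range embed \<Longrightarrow> embed (unembed m) = (m :: 'a multiplier)"
  using unembed_embed by auto

lemma mscale_act: "mscale scale c m \<rhd> a = scale c (m \<rhd> a)" "a \<lhd> mscale scale c m = scale c (a \<lhd> m)"
  by (simp_all add: mscale_def act_simps mscalar_act act_scale)

end

context nondegenerate_algebra
begin

text \<open>The right action determines the left one, because \<open>f b (n f a) = (f b n) f a\<close> and the values \<open>f b\<close>
  exhaust the algebra.\<close>

lemma mext_endo_eqI:
  assumes surj: "surj f" and mult: "\<And>a b :: 'a. f (a * b) = f a * f b"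
    and right: "\<And>a. f a \<lhd> n = f (a \<lhd> m)"
  shows "mext_endo f m = n"
proof -
  have left: "n \<rhd> f a = f (m \<rhd> a)" for a
  proof (rule eq_if_left_mult_eq)
    fix c
    obtain b where "c = f b"
      using surj by blast
    then show "c * (n \<rhd> f a) = c * f (m \<rhd> a)"
      by (simp add: act_assoc(3) right mult[symmetric])
  qed
  have "n' = n" if "\<forall>x. embed (f x) * n' = embed (f (x \<lhd> m))" for n'
  proof (rule multiplier_eqI_right)
    fix c
    obtain b where "c = f b"
      using surj by blast
    then show "c \<lhd> n' = c \<lhd> n"
      using that[rule_format, of b] by (simp add: embed_mult_multiplier embed_eq_iff right)
  qed
  then show ?thesis
    unfolding mext_endo_def mext_def
    by (intro the_equality) (auto simp: embed_mult_multiplier left right)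
qed

end

section \<open>Extension of non-degenerate homomorphisms\<close>

lemma (in vector_space) in_all_if_spanning:
  assumes "span B = UNIV" "\<And>x. x \<in> B \<Longrightarrow> P x" "P 0" "\<And>x y. P x \<Longrightarrow> P y \<Longrightarrow> P (x + y)"
    "\<And>c x. P x \<Longrightarrow> P (scale c x)"
  shows "P x"
proof -
  have "subspace {x. P x}"
    using assms by (auto simp: subspace_def)
  then show ?thesis
    using span_minimal[of B "{x. P x}"] assms(1,2) by auto
qed

locale nondegenerate_hom = nondegenerate_algebra scale
  for scale :: "'k::field \<Rightarrow> 'a::ring \<Rightarrow> 'a" +
  fixes h :: "'x::ring \<Rightarrow> 'a multiplier"
  assumes hom_mult: "h (x * y) = h x * h y"
    and span_left: "span {h x \<rhd> w | x w. True} = UNIV"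
    and span_right: "span {w \<lhd> h x | x w. True} = UNIV"
begin

lemma cancel_left: "v = w" if "\<And>x. h x \<rhd> v = h x \<rhd> w" 
proof (rule eq_if_left_mult_eq)
  show "c * v = c * w" for c
    by (rule in_all_if_spanning[OF span_right])
      (auto simp: distrib_right scale_mult_left act_assoc(3)[symmetric] that)
qed

lemma cancel_right: "v = w" if "\<And>x. v \<lhd> h x = w \<lhd> h x" 
proof (rule eq_if_right_mult_eq)
  show "v * c = w * c" for c
    by (rule in_all_if_spanning[OF span_left])
      (auto simp: distrib_left scale_mult_right act_assoc(3) that)
qed

lemma cancel_multiplier: "n = n'" if "\<And>x. h x * n = h x * n'"
  by (rule multiplier_eqI_left, rule cancel_left) (simp add: act_simps(6)[symmetric] that)

lemma cancel_multiplier_right: "n = n'" if "\<And>x. n * h x = n' * h x"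
  by (rule multiplier_eqI_right, rule cancel_right) (simp add: act_simps(12)[symmetric] that)

text \<open>A product \<open>n w\<close> is pinned down by the equations \<open>h x (n w) = h (x m) w\<close>. They are solvable for
  \<open>w = h y v\<close>, by \<open>h (m y) v\<close>, and therefore on the span of such elements, which is everything; the
  choice of a presentation of \<open>w\<close> never enters.\<close>

lemma mext_exists: "\<exists>n. \<forall>x. n * h x = h (m \<rhd> x) \<and> h x * n = h (x \<lhd> m)"
proof -
  have "\<exists>w'. \<forall>x. h x \<rhd> w' = h (x \<lhd> m) \<rhd> w" for w
  proof (rule in_all_if_spanning[OF span_left, of _ w])
    fix u assume "u \<in> {h x \<rhd> w | x w. True}"
    then obtain y v where "u = h y \<rhd> v" by blast
    then show "\<exists>w'. \<forall>x. h x \<rhd> w' = h (x \<lhd> m) \<rhd> u"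
      by (intro exI[of _ "h (m \<rhd> y) \<rhd> v"])
        (simp add: act_simps(6)[symmetric] hom_mult[symmetric] act_assoc)
  next
    show "\<exists>w'. \<forall>x. h x \<rhd> w' = h (x \<lhd> m) \<rhd> 0"
      by (rule exI[of _ 0]) (simp add: act_zero)
  next
    fix v w assume "\<exists>v'. \<forall>x. h x \<rhd> v' = h (x \<lhd> m) \<rhd> v" "\<exists>w'. \<forall>x. h x \<rhd> w' = h (x \<lhd> m) \<rhd> w"
    then obtain v' w' where "\<forall>x. h x \<rhd> v' = h (x \<lhd> m) \<rhd> v" "\<forall>x. h x \<rhd> w' = h (x \<lhd> m) \<rhd> w"
      by blast
    then show "\<exists>u. \<forall>x. h x \<rhd> u = h (x \<lhd> m) \<rhd> (v + w)"
      by (intro exI[of _ "v' + w'"]) (simp add: act_add)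
  next
    fix c w assume "\<exists>w'. \<forall>x. h x \<rhd> w' = h (x \<lhd> m) \<rhd> w"
    then obtain w' where "\<forall>x. h x \<rhd> w' = h (x \<lhd> m) \<rhd> w"
      by blast
    then show "\<exists>u. \<forall>x. h x \<rhd> u = h (x \<lhd> m) \<rhd> scale c w"
      by (intro exI[of _ "scale c w'"]) (simp add: act_scale)
  qed
  then have "\<forall>w. \<exists>w'. \<forall>x. h x \<rhd> w' = h (x \<lhd> m) \<rhd> w" ..
  from choice[OF this] obtain l where l: "h x \<rhd> l w = h (x \<lhd> m) \<rhd> w" for x w
    by blast
  have "\<exists>w'. \<forall>x. w' \<lhd> h x = w \<lhd> h (m \<rhd> x)" for w
  proof (rule in_all_if_spanning[OF span_right, of _ w])
    fix u assume "u \<in> {w \<lhd> h x | x w. True}"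
    then obtain y v where "u = v \<lhd> h y" by blast
    then show "\<exists>w'. \<forall>x. w' \<lhd> h x = u \<lhd> h (m \<rhd> x)"
      by (intro exI[of _ "v \<lhd> h (y \<lhd> m)"])
        (simp add: act_simps(12)[symmetric] hom_mult[symmetric] act_assoc)
  next
    show "\<exists>w'. \<forall>x. w' \<lhd> h x = 0 \<lhd> h (m \<rhd> x)"
      by (rule exI[of _ 0]) (simp add: act_zero)
  next
    fix v w assume "\<exists>v'. \<forall>x. v' \<lhd> h x = v \<lhd> h (m \<rhd> x)" "\<exists>w'. \<forall>x. w' \<lhd> h x = w \<lhd> h (m \<rhd> x)"
    then obtain v' w' where "\<forall>x. v' \<lhd> h x = v \<lhd> h (m \<rhd> x)" "\<forall>x. w' \<lhd> h x = w \<lhd> h (m \<rhd> x)"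
      by blast
    then show "\<exists>u. \<forall>x. u \<lhd> h x = (v + w) \<lhd> h (m \<rhd> x)"
      by (intro exI[of _ "v' + w'"]) (simp add: act_add)
  next
    fix c w assume "\<exists>w'. \<forall>x. w' \<lhd> h x = w \<lhd> h (m \<rhd> x)"
    then obtain w' where "\<forall>x. w' \<lhd> h x = w \<lhd> h (m \<rhd> x)"
      by blast
    then show "\<exists>u. \<forall>x. u \<lhd> h x = scale c w \<lhd> h (m \<rhd> x)"
      by (intro exI[of _ "scale c w'"]) (simp add: act_scale)
  qed
  then have "\<forall>w. \<exists>w'. \<forall>x. w' \<lhd> h x = w \<lhd> h (m \<rhd> x)" ..
  from choice[OF this] obtain r where r: "r w \<lhd> h x = w \<lhd> h (m \<rhd> x)" for x w
    by blast
  have "(a \<lhd> h x) * l b = r (a \<lhd> h x) * b" for a b x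
  proof -
    have "r (a \<lhd> h x) = a \<lhd> h (x \<lhd> m)"
      by (rule cancel_right)
        (simp add: r act_simps(12)[symmetric] hom_mult[symmetric] act_assoc)
    then show ?thesis
      by (simp add: act_assoc(3)[symmetric] l)
  qed
  moreover have "r 0 = 0" "r (a + b) = r a + r b" "r (scale c a) = scale c (r a)" for a b c
    by (rule cancel_right; simp add: r act_add act_scale act_zero)+
  ultimately have "a * l b = r a * b" for a b
    by - (rule in_all_if_spanning[OF span_right, of "\<lambda>a. a * l b = r a * b"],
      auto simp: distrib_right scale_mult_left)
  then obtain n where n: "\<And>w. n \<rhd> w = l w" "\<And>w. w \<lhd> n = r w"
    by (rule multiplier_exists) blast
  have "h x * n = h (x \<lhd> m)" "n * h x = h (m \<rhd> x)" for x
    by (rule multiplier_eqI_left; simp add: act_simps n l)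
      (rule multiplier_eqI_right; simp add: act_simps n r)
  then show ?thesis
    by blast
qed

lemma mext_eqI: "mext h m = n" if "\<And>x. n * h x = h (m \<rhd> x)" "\<And>x. h x * n = h (x \<lhd> m)"
  unfolding mext_def by (rule the_equality) (use that in \<open>auto intro: cancel_multiplier\<close>)

lemma mext_mult: "mext h m * h x = h (m \<rhd> x)" "h x * mext h m = h (x \<lhd> m)"
proof -
  obtain n where n: "\<forall>x. n * h x = h (m \<rhd> x) \<and> h x * n = h (x \<lhd> m)"
    using mext_exists by blast
  then have "mext h m = n"
    by (intro mext_eqI) auto
  with n show "mext h m * h x = h (m \<rhd> x)" "h x * mext h m = h (x \<lhd> m)"
    by auto
qed

end

section \<open>Sums over tensors\<close>

text \<open>In Sweedler notation, \<open>\<Sum> \<beta> t\<^sub>1 t\<^sub>2\<close>. The value is formed from one chosen presentation of \<open>t\<close> as a sum of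
  pure tensors, so sums over two tensors commute and additive maps can be moved inside for arbitrary \<open>\<beta>\<close>;
  bilinearity of \<open>\<beta>\<close> matters only for the dependence on \<open>t\<close>.\<close>

definition tsum ::
  "('k, 'u, 'v, 't::comm_monoid_add) tensor \<Rightarrow> 't \<Rightarrow> ('u \<Rightarrow> 'v \<Rightarrow> 'w::comm_monoid_add) \<Rightarrow> 'w" where
  "tsum T t \<beta> = (\<Sum>(u, v)\<leftarrow>(SOME l. (\<Sum>(u, v)\<leftarrow>l. pure T u v) = t). \<beta> u v)"

lemma sum_list_swap:
  "(\<Sum>x\<leftarrow>xs. \<Sum>y\<leftarrow>ys. f x y) = (\<Sum>y\<leftarrow>ys. \<Sum>x\<leftarrow>xs. f x y :: 'w::comm_monoid_add)"
  by (induction xs) (simp_all add: sum_list_addf)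

lemma tsum_swap:
  "tsum T t (\<lambda>u v. tsum T' t' (\<lambda>p q. \<gamma> u v p q)) = tsum T' t' (\<lambda>p q. tsum T t (\<lambda>u v. \<gamma> u v p q))"
  unfolding tsum_def case_prod_unfold by (rule sum_list_swap)

lemma tsum_add: "tsum T t (\<lambda>u v. \<beta> u v + \<gamma> u v) = tsum T t \<beta> + tsum T t \<gamma>"
  by (simp add: tsum_def case_prod_unfold sum_list_addf)

lemma tsum_zero: "tsum T t (\<lambda>u v. 0) = 0"
  by (simp add: tsum_def case_prod_unfold)

lemma tsum_additive:
  fixes f :: "'w::ab_group_add \<Rightarrow> 'w'::ab_group_add"
  assumes "\<And>x y. f (x + y) = f x + f y"
  shows "f (tsum T t \<beta>) = tsum T t (\<lambda>u v. f (\<beta> u v))"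
proof -
  have "f 0 = 0"
    using assms[of 0 0] by simp
  then have "f (\<Sum>(u, v)\<leftarrow>l. \<beta> u v) = (\<Sum>(u, v)\<leftarrow>l. f (\<beta> u v))" for l
    by (induction l) (auto simp: assms)
  then show ?thesis
    by (simp add: tsum_def)
qed

lemma tsum_mem:
  assumes "\<And>u v. \<beta> u v \<in> S" "0 \<in> S" "\<And>x y. x \<in> S \<Longrightarrow> y \<in> S \<Longrightarrow> x + y \<in> S"
  shows "tsum T t \<beta> \<in> S"
proof -
  have "(\<Sum>(u, v)\<leftarrow>l. \<beta> u v) \<in> S" for l
    by (induction l) (auto simp: assms)
  then show ?thesis
    by (simp add: tsum_def)
qed

lemma tsum_mult:
  "tsum T t \<beta> * c = tsum T t (\<lambda>u v. \<beta> u v * c)" "c * tsum T t \<beta> = tsum T t (\<lambda>u v. c * \<beta> u v)"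
  for c :: "'w::ring"
  by (rule tsum_additive[of "\<lambda>x. x * c"] tsum_additive[of "\<lambda>x. c * x"]; simp add: algebra_simps)+

lemma tsum_act:
  "m \<rhd> tsum T t \<beta> = tsum T t (\<lambda>u v. m \<rhd> \<beta> u v)" "tsum T t \<beta> \<lhd> m = tsum T t (\<lambda>u v. \<beta> u v \<lhd> m)"
  "tsum T t \<gamma> \<rhd> x = tsum T t (\<lambda>u v. \<gamma> u v \<rhd> x)" "x \<lhd> tsum T t \<gamma> = tsum T t (\<lambda>u v. x \<lhd> \<gamma> u v)"
  by (rule tsum_additive[of "\<lambda>x. m \<rhd> x"] tsum_additive[of "\<lambda>x. x \<lhd> m"]
      tsum_additive[of "\<lambda>m. m \<rhd> x"] tsum_additive[of "\<lambda>m. x \<lhd> m"]; simp add: act_add act_simps)+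

lemma linearI:
  assumes "vector_space s" "vector_space s'" "\<And>x y. f (x + y) = f x + f y" "\<And>c x. f (s c x) = s' c (f x)"
  shows "Vector_Spaces.linear s s' f"
  using assms by (simp add: Vector_Spaces.linear_iff)

lemma linearD:
  assumes "Vector_Spaces.linear s s' f"
  shows "f (x + y) = f x + f y" "f (s c x) = s' c (f x)" "f 0 = 0"
proof -
  show *: "f (x + y) = f x + f y" for x y
    using assms by (simp add: Vector_Spaces.linear_iff)
  show "f (s c x) = s' c (f x)"
    using assms by (simp add: Vector_Spaces.linear_iff)
  show "f 0 = 0"
    using *[of 0 0] by simp
qed

lemma bilinear_mapI:
  assumes "vector_space sU" "vector_space sV" "vector_space sW"
    "\<And>u u' v. \<beta> (u + u') v = \<beta> u v + \<beta> u' v" "\<And>u v v'. \<beta> u (v + v') = \<beta> u v + \<beta> u v'"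
    "\<And>c u v. \<beta> (sU c u) v = sW c (\<beta> u v)" "\<And>c u v. \<beta> u (sV c v) = sW c (\<beta> u v)"
  shows "bilinear_map sU sV sW \<beta>"
  using assms by (auto simp: bilinear_map_def intro!: linearI)

lemma functional_iff:
  assumes "vector_space s"
  shows "functional s f \<longleftrightarrow> (\<forall>x y. f (x + y) = f x + f y) \<and> (\<forall>c x. f (s c x) = c * f x)"
  using assms by (simp add: functional_def Vector_Spaces.linear_iff vector_space_self)

context tensor_product
begin

lemmas pure_linear =
  linearD(1,2)[OF bilinear_pure[unfolded bilinear_map_def, THEN conjunct1, rule_format]]
  linearD(1,2)[OF bilinear_pure[unfolded bilinear_map_def, THEN conjunct2, rule_format]]

lemma pure_zero: "pure T 0 v = 0" "pure T u 0 = 0"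
  using pure_linear(1)[of u 0 0] pure_linear(3)[of 0 0 v] by simp_all

lemma expansion_exists: "\<exists>l. (\<Sum>(u, v)\<leftarrow>l. pure T u v) = t"
proof (rule T.in_all_if_spanning[OF span_pure])
  fix x assume "x \<in> {pure T u v | u v. True}"
  then obtain u v where "x = pure T u v" by blast
  then have "(\<Sum>(u, v)\<leftarrow>[(u, v)]. pure T u v) = x"
    by simp
  then show "\<exists>l. (\<Sum>(u, v)\<leftarrow>l. pure T u v) = x" ..
next
  have "(\<Sum>(u, v)\<leftarrow>[]. pure T u v) = 0"
    by simp
  then show "\<exists>l. (\<Sum>(u, v)\<leftarrow>l. pure T u v) = 0" ..
next
  fix x y assume "\<exists>l. (\<Sum>(u, v)\<leftarrow>l. pure T u v) = x" "\<exists>l. (\<Sum>(u, v)\<leftarrow>l. pure T u v) = y"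
  then obtain k l where "(\<Sum>(u, v)\<leftarrow>k. pure T u v) = x" "(\<Sum>(u, v)\<leftarrow>l. pure T u v) = y"
    by blast
  then have "(\<Sum>(u, v)\<leftarrow>k @ l. pure T u v) = x + y"
    by simp
  then show "\<exists>l. (\<Sum>(u, v)\<leftarrow>l. pure T u v) = x + y" ..
next
  fix c x assume "\<exists>l. (\<Sum>(u, v)\<leftarrow>l. pure T u v) = x"
  then obtain l where l: "(\<Sum>(u, v)\<leftarrow>l. pure T u v) = x" ..
  have "(\<Sum>(u, v)\<leftarrow>map (\<lambda>(u, v). (sU c u, v)) l. pure T u v) = tscale T c (\<Sum>(u, v)\<leftarrow>l. pure T u v)"
    by (induction l) (auto simp: pure_linear T.scale_right_distrib)
  with l show "\<exists>l. (\<Sum>(u, v)\<leftarrow>l. pure T u v) = tscale T c x"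
    by blast
qed

lemma tsum_pure: "tsum T t (\<lambda>u v. pure T u v) = t"
  unfolding tsum_def by (rule someI_ex[OF expansion_exists])

lemma additive_expand:
  fixes f :: "'t \<Rightarrow> 'w::ab_group_add"
  assumes "\<And>x y. f (x + y) = f x + f y"
  shows "f t = tsum T t (\<lambda>u v. f (pure T u v))"
  using tsum_additive[of f, OF assms] tsum_pure by metis

lemma additive_ext:
  fixes f g :: "'t \<Rightarrow> 'w::ab_group_add"
  assumes "\<And>x y. f (x + y) = f x + f y" "\<And>x y. g (x + y) = g x + g y"
    "\<And>u v. f (pure T u v) = g (pure T u v)"
  shows "f t = g t"
proof -
  have "f t = tsum T t (\<lambda>u v. f (pure T u v))" "g t = tsum T t (\<lambda>u v. g (pure T u v))"
    using assms(1,2) by (blast intro: additive_expand)+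
  with assms(3) show ?thesis
    by simp
qed

lemma bilinearI:
  assumes "vector_space sW"
    "\<And>u u' v. \<beta> (u + u') v = \<beta> u v + \<beta> u' v" "\<And>u v v'. \<beta> u (v + v') = \<beta> u v + \<beta> u v'"
    "\<And>c u v. \<beta> (sU c u) v = sW c (\<beta> u v)" "\<And>c u v. \<beta> u (sV c v) = sW c (\<beta> u v)"
  shows "bilinear_map sU sV sW \<beta>"
  using bilinear_mapI[OF U.vector_space_axioms V.vector_space_axioms] assms by blast

context
  fixes sW :: "'k \<Rightarrow> 'w::ab_group_add \<Rightarrow> 'w" and \<beta>
  assumes W: "vector_space sW" and \<beta>: "bilinear_map sU sV sW \<beta>"
begin

lemma tensor_lift_linear: "Vector_Spaces.linear (tscale T) sW (tensor_lift T sW \<beta>)"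
  and tensor_lift_pure: "tensor_lift T sW \<beta> (pure T u v) = \<beta> u v"
  using theI'[OF universal[OF W \<beta>]] by (auto simp: tensor_lift_def)

lemma tensor_lift_tsum: "tensor_lift T sW \<beta> t = tsum T t \<beta>"
  by (subst additive_expand[of "tensor_lift T sW \<beta>" t])
    (simp_all add: tensor_lift_pure linearD(1)[OF tensor_lift_linear])

lemma tsum_linear:
  "tsum T (s + t) \<beta> = tsum T s \<beta> + tsum T t \<beta>" "tsum T (tscale T c t) \<beta> = sW c (tsum T t \<beta>)"
  "tsum T (pure T u v) \<beta> = \<beta> u v"
  using linearD[OF tensor_lift_linear] tensor_lift_pure by (simp_all add: tensor_lift_tsum)

end

end

lemma automorphismD:
  assumes "automorphism s f"
  shows "f (a + b) = f a + f b" "f (s c a) = s c (f a)" "f (a * b) = f a * f b"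
    "bij f" "f (inv f a) = a" "inv f (f a) = a"
  using assms by (auto simp: automorphism_def linearD bij_is_surj surj_f_inv_f bij_is_inj)

lemma automorphism_inv:
  assumes "automorphism s f"
  shows "automorphism s (inv f)"
proof -
  note f = automorphismD[OF assms]
  have *: "inv f a = b \<longleftrightarrow> a = f b" for a b
    using f(5,6) by metis
  show ?thesis
    using assms unfolding automorphism_def
    by (auto simp: Vector_Spaces.linear_iff * f bij_imp_bij_inv)
qed

lemma functional_comp: "functional s \<omega> \<Longrightarrow> Vector_Spaces.linear s s f \<Longrightarrow> functional s (\<lambda>a. \<omega> (f a))"
  using Vector_Spaces.linear_compose[of s s f "(*)" \<omega>] by (simp add: functional_def comp_def)

lemma modular_automorphismD:
  assumes "modular_automorphism s \<phi> \<sigma>"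
  shows "\<phi> (a * b) = \<phi> (b * \<sigma> a)" "automorphism s \<sigma>"
  using assms by (auto simp: modular_automorphism_def)

section \<open>Tensor products of non-degenerate algebras\<close>

lemma (in vector_space) eq_0_if_functionals_0:
  "x = 0" if "\<And>\<omega>. functional scale \<omega> \<Longrightarrow> \<omega> x = 0"
proof (rule ccontr)
  assume "x \<noteq> 0"
  then have "x \<notin> span {}"
    by simp
  then obtain \<omega> where "functional scale \<omega>" "\<omega> x = 1"
    by (rule form_separating) blast
  from that[OF this(1)] this(2) show False
    by simp
qed

lemma (in k_algebra) functional_times:
  "functional scale \<omega> \<Longrightarrow> functional scale (\<lambda>a. \<omega> (a * c))"
  "functional scale \<omega> \<Longrightarrow> functional scale (\<lambda>a. \<omega> (c * a))"
  by (simp_all add: functional_iff vector_space_axioms distrib_left distrib_right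
      scale_mult_left scale_mult_right)

context tensor_algebra
begin

lemma bilinear_slice1: "functional sB \<omega> \<Longrightarrow> bilinear_map sA sB sA (\<lambda>a b. sA (\<omega> b) a)"
  and bilinear_slice2: "functional sA \<omega>' \<Longrightarrow> bilinear_map sA sB sB (\<lambda>a b. sB (\<omega>' a) b)"
  by (rule bilinearI, rule A.vector_space_axioms B.vector_space_axioms;
      simp add: functional_iff B.vector_space_axioms A.vector_space_axioms A.scale_right_distrib
        A.scale_left_distrib B.scale_right_distrib B.scale_left_distrib mult.commute)+

context
  fixes \<omega> assumes \<omega>: "functional sB \<omega>"
begin

lemma slice1_tsum: "slice1 sA T \<omega> t = tsum T t (\<lambda>a b. sA (\<omega> b) a)"
  unfolding slice1_def
  by (rule tensor_lift_tsum[OF A.vector_space_axioms bilinear_slice1[OF \<omega>]])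

lemma slice1_linear:
  "slice1 sA T \<omega> (s + t) = slice1 sA T \<omega> s + slice1 sA T \<omega> t"
  "slice1 sA T \<omega> (tscale T c t) = sA c (slice1 sA T \<omega> t)"
  "slice1 sA T \<omega> (pure T a b) = sA (\<omega> b) a"
  unfolding slice1_tsum
  by (rule tsum_linear[OF A.vector_space_axioms bilinear_slice1[OF \<omega>]])+

end

context
  fixes \<omega> assumes \<omega>: "functional sA \<omega>"
begin

lemma slice2_tsum: "slice2 sB T \<omega> t = tsum T t (\<lambda>a b. sB (\<omega> a) b)"
  unfolding slice2_def
  by (rule tensor_lift_tsum[OF B.vector_space_axioms bilinear_slice2[OF \<omega>]])

lemma slice2_linear:
  "slice2 sB T \<omega> (s + t) = slice2 sB T \<omega> s + slice2 sB T \<omega> t"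
  "slice2 sB T \<omega> (tscale T c t) = sB c (slice2 sB T \<omega> t)"
  "slice2 sB T \<omega> (pure T a b) = sB (\<omega> a) b"
  unfolding slice2_tsum
  by (rule tsum_linear[OF B.vector_space_axioms bilinear_slice2[OF \<omega>]])+

end

lemma slice1_scale:
  assumes "functional sB \<omega>"
  shows "slice1 sA T (\<lambda>b. c * \<omega> b) t = sA c (slice1 sA T \<omega> t)"
proof -
  have "functional sB (\<lambda>b. c * \<omega> b)"
    using assms by (simp add: functional_iff B.vector_space_axioms algebra_simps)
  then show ?thesis
    using assms by (subst (1 2) slice1_tsum)
      (simp_all add: tsum_additive[of "sA c"] A.scale_right_distrib)
qed

text \<open>Write \<open>t\<close> with linearly independent second components. A functional that is 1 on one of them
  and 0 on the others extracts the matching first component.\<close>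

lemma eq_if_slice1_eq:
  assumes "\<And>\<omega>. functional sB \<omega> \<Longrightarrow> slice1 sA T \<omega> t = 0"
  shows "t = 0"
proof -
  obtain l where l: "(\<Sum>(a, b)\<leftarrow>l. pure T a b) = t"
    using expansion_exists by blast
  obtain F where F: "F \<subseteq> snd ` set l" "B.independent F" "snd ` set l \<subseteq> B.span F"
    by (rule B.maximal_independent_subset)
  have "finite F"
    using F(1) finite_subset by blast
  define r where "r = B.representation F"
  define g where "g e = (\<Sum>(a, b)\<leftarrow>l. sA (r b e) a)" for e
  have expand: "b = (\<Sum>e\<in>F. sB (r b e) e)" if "b \<in> snd ` set l" for b
    using B.sum_representation_eq[OF F(2) _ \<open>finite F\<close> subset_refl, of b] F(3) that
    by (auto simp: r_def)
  have pure_sum: "pure T a (\<Sum>e\<in>F. f e) = (\<Sum>e\<in>F. pure T a (f e))" for a f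
    using sum_comp_morphism[of "pure T a" f F]
    by (simp add: pure_linear pure_zero comp_def)
  have "(\<Sum>(a, b)\<leftarrow>k. pure T a b) = (\<Sum>e\<in>F. pure T (\<Sum>(a, b)\<leftarrow>k. sA (r b e) a) e)"
    if "set k \<subseteq> set l" for k
    using that
  proof (induction k)
    case Nil
    show ?case by (simp add: pure_zero)
  next
    case (Cons x k)
    obtain a b where x: "x = (a, b)" by force
    have "pure T a b = (\<Sum>e\<in>F. pure T (sA (r b e) a) e)"
      using expand[of b] Cons.prems x by (subst expand[of b]) (force simp: pure_sum pure_linear)+
    with Cons x show ?case
      by (simp add: pure_linear sum.distrib)
  qed
  from this[of l] l have t: "t = (\<Sum>e\<in>F. pure T (g e) e)"
    by (simp add: g_def)
  have "g e = 0" if "e \<in> F" for e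
  proof -
    interpret BK: vector_space_pair sB "(*) :: 'k \<Rightarrow> 'k \<Rightarrow> 'k"
      by (intro vector_space_pair.intro B.vector_space_axioms vector_space_self)
    obtain \<omega> where \<omega>: "Vector_Spaces.linear sB (*) \<omega>" "\<forall>b\<in>F. \<omega> b = (if b = e then 1 else 0)"
      using BK.linear_independent_extend[OF F(2), of "\<lambda>b. if b = e then 1 else 0"] by blast
    then have func: "functional sB \<omega>"
      by (simp add: functional_def)
    have "slice1 sA T \<omega> t = (\<Sum>b\<in>F. slice1 sA T \<omega> (pure T (g b) b))"
      using sum_comp_morphism[of "slice1 sA T \<omega>" "\<lambda>b. pure T (g b) b" F]
        slice1_linear(1)[OF func] slice1_linear(1)[OF func, of 0 0]
      by (simp add: t comp_def)
    also have "\<dots> = (\<Sum>b\<in>F. if b = e then g e else 0)"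
      using \<omega>(2) by (intro sum.cong) (auto simp: slice1_linear(3)[OF func])
    also have "\<dots> = g e"
      using that \<open>finite F\<close> by simp
    finally show ?thesis
      using assms[OF func] by simp
  qed
  then show ?thesis
    by (simp add: t pure_zero)
qed

end

locale nondegenerate_tensor_algebra = tensor_algebra sA sB T +
    A: nondegenerate_algebra sA + B: nondegenerate_algebra sB
  for sA :: "'k::field \<Rightarrow> 'a::ring \<Rightarrow> 'a"
    and sB :: "'k \<Rightarrow> 'b::ring \<Rightarrow> 'b"
    and T :: "('k, 'a, 'b, 't::ring) tensor"
begin

lemma functional_slice:
  assumes \<omega>: "functional sA \<omega>" and \<eta>: "functional sB \<eta>"
  shows "\<omega> (slice1 sA T \<eta> t) = \<eta> (slice2 sB T \<omega> t)"
proof (rule additive_ext[of _ _ t])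
qed (use \<omega> \<eta> in \<open>simp_all add: functional_iff A.vector_space_axioms B.vector_space_axioms
      slice1_linear[OF \<eta>] slice2_linear[OF \<omega>]\<close>)

lemma mult_pure_slice2:
  assumes \<omega>: "functional sA \<omega>"
  shows "slice2 sB T \<omega> (t * pure T a b) = slice2 sB T (\<lambda>x. \<omega> (x * a)) t * b"
    "slice2 sB T \<omega> (pure T a b * t) = b * slice2 sB T (\<lambda>x. \<omega> (a * x)) t"
  by (rule additive_ext[of _ _ t]; simp add: slice2_linear[OF \<omega>]
      slice2_linear[OF A.functional_times(1)[OF \<omega>]] slice2_linear[OF A.functional_times(2)[OF \<omega>]]
      mult_pure B.scale_mult_left B.scale_mult_right distrib_left distrib_right)+

text \<open>If \<open>t\<close> kills all pure tensors, then \<open>\<omega>(x a) = 0\<close> for every slice \<open>x\<close> of \<open>t\<close> and every functional \<open>\<omega>\<close>,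
  since the second factor can be cancelled in \<open>B\<close>. So \<open>x a = 0\<close> for all \<open>a\<close>, and \<open>x = 0\<close> by
  non-degeneracy of \<open>A\<close>.\<close>

lemma nondegenerate_tensor: "nondegenerate_algebra (tscale T)"
proof (unfold_locales, goal_cases)
  case 1
  obtain a :: 'a and b :: 'b where ab: "a \<noteq> 0" "b \<noteq> 0"
    using A.nonzero B.nonzero by blast
  then have "b \<notin> B.span {}"
    by simp
  then obtain \<eta> where \<eta>: "functional sB \<eta>" "\<eta> b = 1"
    by (rule B.form_separating) blast
  then have "slice1 sA T \<eta> (pure T a b) = a"
    by (simp add: slice1_linear)
  moreover have "slice1 sA T \<eta> 0 = 0"
    using slice1_linear(1)[OF \<eta>(1), of 0 0] by simp
  ultimately show ?case
    using ab(1) by (intro exI[of _ "pure T a b"]) auto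
next
  case *: (2 t)
  show ?case
  proof (rule eq_if_slice1_eq, rule A.nondegenerate_left, rule allI, rule A.eq_0_if_functionals_0)
    fix \<eta> \<omega> a assume \<eta>: "functional sB \<eta>" and \<omega>: "functional sA \<omega>"
    have "slice2 sB T \<omega> 0 = 0"
      using slice2_linear(1)[OF \<omega>, of 0 0] by simp
    then have "slice2 sB T (\<lambda>x. \<omega> (x * a)) t * b = 0" for b
      using mult_pure_slice2(1)[OF \<omega>, of t a b] * by simp
    then have "slice2 sB T (\<lambda>x. \<omega> (x * a)) t = 0"
      using B.nondegenerate_left by blast
    moreover have "\<eta> 0 = 0"
      using \<eta> linearD(3) by (auto simp: functional_def)
    ultimately show "\<omega> (slice1 sA T \<eta> t * a) = 0"
      using functional_slice[OF A.functional_times(1)[OF \<omega>, of a] \<eta>, of t] by simp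
  qed
next
  case *: (3 t)
  show ?case
  proof (rule eq_if_slice1_eq, rule A.nondegenerate_right, rule allI, rule A.eq_0_if_functionals_0)
    fix \<eta> \<omega> a assume \<eta>: "functional sB \<eta>" and \<omega>: "functional sA \<omega>"
    have "slice2 sB T \<omega> 0 = 0"
      using slice2_linear(1)[OF \<omega>, of 0 0] by simp
    then have "b * slice2 sB T (\<lambda>x. \<omega> (a * x)) t = 0" for b
      using mult_pure_slice2(2)[OF \<omega>, of a b t] * by simp
    then have "slice2 sB T (\<lambda>x. \<omega> (a * x)) t = 0"
      using B.nondegenerate_right by blast
    moreover have "\<eta> 0 = 0"
      using \<eta> linearD(3) by (auto simp: functional_def)
    ultimately show "\<omega> (a * slice1 sA T \<eta> t) = 0"
      using functional_slice[OF A.functional_times(2)[OF \<omega>, of a] \<eta>, of t] by simp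
  qed
qed

sublocale T: nondegenerate_algebra "tscale T"
  by (rule nondegenerate_tensor)

text \<open>Equations between tensors will be tested only on the functionals \<open>\<eta>(\<cdot> c)\<close> with \<open>\<eta>\<close> an invariant
  functional.\<close>

lemma eq_if_faithful_slice1_eq:
  assumes \<eta>: "functional sB \<eta>" "faithful \<eta>"
    and eq: "\<And>c. slice1 sA T (\<lambda>b. \<eta> (b * c)) s = slice1 sA T (\<lambda>b. \<eta> (b * c)) t"
  shows "s = t"
proof -
  note func = B.functional_times(1)[OF \<eta>(1)]
  define d where "d = s - t"
  have s: "s = d + t"
    by (simp add: d_def)
  have slice2_0: "slice2 sB T \<omega> d = 0" if \<omega>: "functional sA \<omega>" for \<omega>
  proof -
    have "slice1 sA T (\<lambda>b. \<eta> (b * c)) d = 0" for c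
      using eq[of c] slice1_linear(1)[OF func, of c d t] by (simp add: s)
    moreover have "\<omega> 0 = 0"
      using \<omega> linearD(3) by (auto simp: functional_def)
    ultimately have "\<eta> (slice2 sB T \<omega> d * c) = 0" for c
      using functional_slice[OF \<omega> func[of c], of d] by simp
    with \<eta>(2) show ?thesis
      by (auto simp: faithful_def)
  qed
  have "d = 0"
  proof (rule eq_if_slice1_eq, rule A.eq_0_if_functionals_0)
    fix \<zeta> \<omega> assume \<zeta>: "functional sB \<zeta>" and \<omega>: "functional sA \<omega>"
    have "\<zeta> 0 = 0"
      using \<zeta> linearD(3) by (auto simp: functional_def)
    with functional_slice[OF \<omega> \<zeta>, of d] slice2_0[OF \<omega>]
    show "\<omega> (slice1 sA T \<zeta> d) = 0"
      by simp
  qed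
  then show ?thesis
    by (simp add: s)
qed

lemma bilinear_mtensor:
  "bilinear_map sA sB (tscale T) (\<lambda>a b. pure T (m \<rhd> a) (n \<rhd> b))"
  "bilinear_map sA sB (tscale T) (\<lambda>a b. pure T (a \<lhd> m) (b \<lhd> n))"
  by (rule bilinearI, rule T.vector_space_axioms;
      simp add: act_add A.act_scale B.act_scale pure_linear)+

lemma mtensor_unique:
  "p = q" if "\<And>a b. p \<rhd> pure T a b = q \<rhd> pure T a b"
  by (rule T.multiplier_eqI_left, rule additive_ext[where f = "\<lambda>t. p \<rhd> t" and g = "\<lambda>t. q \<rhd> t"]) (simp_all add: act_add that)

lemma mtensor_unique_right:
  "p = q" if "\<And>a b. pure T a b \<lhd> p = pure T a b \<lhd> q"
  by (rule T.multiplier_eqI_right, rule additive_ext[where f = "\<lambda>t. t \<lhd> p" and g = "\<lambda>t. t \<lhd> q"]) (simp_all add: act_add that)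

lemma mtensor_pure:
  "mtensor T m n \<rhd> pure T a b = pure T (m \<rhd> a) (n \<rhd> b)"
  "pure T a b \<lhd> mtensor T m n = pure T (a \<lhd> m) (b \<lhd> n)"
proof -
  let ?l = "\<lambda>t. tsum T t (\<lambda>a b. pure T (m \<rhd> a) (n \<rhd> b))"
  let ?r = "\<lambda>t. tsum T t (\<lambda>a b. pure T (a \<lhd> m) (b \<lhd> n))"
  note lin = tsum_linear[OF T.vector_space_axioms bilinear_mtensor(1)]
    tsum_linear[OF T.vector_space_axioms bilinear_mtensor(2)]
  have *: "pure T a b * ?l t = ?r (pure T a b) * t" for a b t
    by (rule additive_ext[of _ _ t]) (simp_all add: lin distrib_left mult_pure act_assoc(3))
  have "s * ?l t = ?r s * t" for s t
    by (rule additive_ext[of _ _ s]) (simp_all only: * lin distrib_right)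
  then obtain p where p: "\<And>t. p \<rhd> t = ?l t" "\<And>t. t \<lhd> p = ?r t"
    by (rule T.multiplier_exists) blast
  have "mtensor T m n = p"
    unfolding mtensor_def
    by (rule the_equality) (simp_all add: p lin mtensor_unique)
  then show "mtensor T m n \<rhd> pure T a b = pure T (m \<rhd> a) (n \<rhd> b)"
    "pure T a b \<lhd> mtensor T m n = pure T (a \<lhd> m) (b \<lhd> n)"
    by (simp_all add: p lin)
qed

lemma mtensor_mult: "mtensor T m n * mtensor T m' n' = mtensor T (m * m') (n * n')"
  by (rule mtensor_unique) (simp add: act_simps mtensor_pure)

lemma mtensor_embed: "mtensor T (embed a) (embed b) = embed (pure T a b)"
  by (rule mtensor_unique) (simp add: act_simps mtensor_pure embed_act mult_pure)

lemma mtensor_linear: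
  "mtensor T (m + m') n = mtensor T m n + mtensor T m' n"
  "mtensor T m (n + n') = mtensor T m n + mtensor T m n'"
  "mtensor T (mscale sA c m) n = mscale (tscale T) c (mtensor T m n)"
  "mtensor T m (mscale sB c n) = mscale (tscale T) c (mtensor T m n)"
  by (rule mtensor_unique;
      simp add: act_simps mtensor_pure pure_linear A.mscale_act B.mscale_act T.mscale_act)+

end

lemma (in nondegenerate_algebra) multiplier_hom_embed: "multiplier_hom scale scale embed"
  unfolding multiplier_hom_def
proof (intro conjI allI linearI)
  show "embed (scale c x) = mscale scale c (embed x)" for c x
    by (rule multiplier_eqI_left) (simp add: mscale_act embed_act scale_mult_left)
qed (simp_all add: vector_space_axioms vector_space_mscale embed_add embed_mult)

lemma multiplier_homD:
  assumes "multiplier_hom sX sY h"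
  shows "h (x + y) = h x + h y" "h (sX c x) = mscale sY c (h x)" "h (x * y) = h x * h y"
    "Vector_Spaces.linear sX (mscale sY) h"
  using assms linearD(1,2) by (auto simp: multiplier_hom_def)

context nondegenerate_tensor_algebra
begin

context
  fixes sW :: "'k \<Rightarrow> 'w::ab_group_add \<Rightarrow> 'w" and \<beta>
  assumes W: "vector_space sW" and \<beta>: "bilinear_map sA sB sW \<beta>"
begin

lemma bilinear_mtensor_comp:
  "bilinear_map sA sB sW (\<lambda>a b. \<beta> (m \<rhd> a) (n \<rhd> b))"
  "bilinear_map sA sB sW (\<lambda>a b. \<beta> (a \<lhd> m) (b \<lhd> n))"
  using \<beta> by (auto intro!: bilinearI W simp: bilinear_map_def Vector_Spaces.linear_iff
      act_add A.act_scale B.act_scale)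

lemma tsum_mtensor:
  "tsum T (mtensor T m n \<rhd> t) \<beta> = tsum T t (\<lambda>a b. \<beta> (m \<rhd> a) (n \<rhd> b))"
  "tsum T (t \<lhd> mtensor T m n) \<beta> = tsum T t (\<lambda>a b. \<beta> (a \<lhd> m) (b \<lhd> n))"
  by (rule additive_ext[of _ _ t]; simp add: act_add mtensor_pure tsum_linear[OF W \<beta>]
      tsum_linear[OF W bilinear_mtensor_comp(1)] tsum_linear[OF W bilinear_mtensor_comp(2)])+

end

lemma pure_eq_legs: "embed (pure T a b) = leg1 T a * leg2 T b" "embed (pure T a b) = leg2 T b * leg1 T a"
  by (simp_all add: mtensor_mult mtensor_embed)

lemma legs_commute: "leg1 T a * leg2 T b = leg2 T b * leg1 T a"
  using pure_eq_legs by metis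

lemma leg_mult: "leg1 T (a * a') = leg1 T a * leg1 T a'" "leg2 T (b * b') = leg2 T b * leg2 T b'"
  by (simp_all add: mtensor_mult embed_mult)

lemma leg_linear:
  "leg1 T (a + a') = leg1 T a + leg1 T a'" "leg2 T (b + b') = leg2 T b + leg2 T b'"
  "leg1 T (sA c a) = mscale (tscale T) c (leg1 T a)" "leg2 T (sB c b) = mscale (tscale T) c (leg2 T b)"
  using multiplier_homD(2)[OF A.multiplier_hom_embed] multiplier_homD(2)[OF B.multiplier_hom_embed]
  by (simp_all add: mtensor_linear embed_add)

lemma pure_mult: "pure T a b * t = leg1 T a \<rhd> leg2 T b \<rhd> t" "t * pure T a b = t \<lhd> leg1 T a \<lhd> leg2 T b"
  using embed_act(1)[of "pure T a b" t] embed_act(2)[of t "pure T a b"]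
  by (simp_all add: pure_eq_legs(1) act_simps)

lemma leg_pure:
  "leg1 T c \<rhd> pure T a b = pure T (c * a) b" "leg2 T c' \<rhd> pure T a b = pure T a (c' * b)"
  "pure T a b \<lhd> leg1 T c = pure T (a * c) b" "pure T a b \<lhd> leg2 T c' = pure T a (b * c')"
  by (simp_all add: mtensor_pure embed_act act_simps)

lemma cancel_leg2: "s = t" if "\<And>b. s \<lhd> leg2 T b = t \<lhd> leg2 T b"
proof (rule T.eq_if_right_mult_eq)
  show "s * c = t * c" for c
    by (rule additive_ext[of _ _ c])
      (simp_all add: distrib_left pure_mult act_simps(12)[symmetric] legs_commute,
        simp add: act_simps that)
qed

lemma slice1_act:
  assumes "functional sB \<omega>"
  shows "slice1 sA T \<omega> (mtensor T m 1 \<rhd> t) = m \<rhd> slice1 sA T \<omega> t"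
    "slice1 sA T \<omega> (t \<lhd> mtensor T m 1) = slice1 sA T \<omega> t \<lhd> m"
    "slice1 sA T \<omega> (leg2 T b \<rhd> t) = slice1 sA T (\<lambda>x. \<omega> (b * x)) t"
    "slice1 sA T \<omega> (t \<lhd> leg2 T b) = slice1 sA T (\<lambda>x. \<omega> (x * b)) t"
  by (rule additive_ext[of _ _ t]; simp add: act_add act_simps mtensor_pure embed_act A.act_scale
      slice1_linear[OF assms] slice1_linear[OF B.functional_times(1)[OF assms]]
      slice1_linear[OF B.functional_times(2)[OF assms]])+

lemma slice2_act:
  assumes "functional sA \<omega>"
  shows "slice2 sB T \<omega> (mtensor T 1 m \<rhd> t) = m \<rhd> slice2 sB T \<omega> t"
    "slice2 sB T \<omega> (t \<lhd> mtensor T 1 m) = slice2 sB T \<omega> t \<lhd> m"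
    "slice2 sB T \<omega> (leg1 T a \<rhd> t) = slice2 sB T (\<lambda>x. \<omega> (a * x)) t"
    "slice2 sB T \<omega> (t \<lhd> leg1 T a) = slice2 sB T (\<lambda>x. \<omega> (x * a)) t"
  by (rule additive_ext[of _ _ t]; simp add: act_add act_simps mtensor_pure embed_act B.act_scale
      slice2_linear[OF assms] slice2_linear[OF A.functional_times(1)[OF assms]]
      slice2_linear[OF A.functional_times(2)[OF assms]])+

end

locale tensor_of_homs = S: tensor_algebra sA sB T + nondegenerate_tensor_algebra sC sD T'
  for sA :: "'k::field \<Rightarrow> 'a::ring \<Rightarrow> 'a"
    and sB :: "'k \<Rightarrow> 'b::ring \<Rightarrow> 'b"
    and T :: "('k, 'a, 'b, 't::ring) tensor"
    and sC :: "'k \<Rightarrow> 'c::ring \<Rightarrow> 'c"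
    and sD :: "'k \<Rightarrow> 'd::ring \<Rightarrow> 'd"
    and T' :: "('k, 'c, 'd, 'u::ring) tensor" +
  fixes g :: "'a \<Rightarrow> 'c multiplier" and h :: "'b \<Rightarrow> 'd multiplier"
  assumes g: "multiplier_hom sA sC g" and h: "multiplier_hom sB sD h"
begin

abbreviation "gh \<equiv> tensor_hom T T' g h"

lemma bilinear_gh: "bilinear_map sA sB (mscale (tscale T')) (\<lambda>a b. mtensor T' (g a) (h b))"
  by (rule S.bilinearI[OF T.vector_space_mscale])
    (simp_all add: multiplier_homD[OF g] multiplier_homD[OF h] mtensor_linear)

lemma tensor_hom_linear:
  "gh (s + t) = gh s + gh t" "gh (tscale T c t) = mscale (tscale T') c (gh t)"
  "gh (pure T a b) = mtensor T' (g a) (h b)"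
  using linearD(1,2)[OF S.tensor_lift_linear[OF T.vector_space_mscale bilinear_gh]]
    S.tensor_lift_pure[OF T.vector_space_mscale bilinear_gh]
  by (simp_all add: tensor_hom_def)

lemma tensor_hom_tsum: "gh t = tsum T t (\<lambda>a b. mtensor T' (g a) (h b))"
  unfolding tensor_hom_def by (rule S.tensor_lift_tsum[OF T.vector_space_mscale bilinear_gh])

lemma tensor_hom_mult: "gh (s * t) = gh s * gh t"
proof -
  have *: "gh (pure T a b * t) = gh (pure T a b) * gh t" for a b
    by (rule S.additive_ext[of _ _ t]) (simp_all add: distrib_left tensor_hom_linear S.mult_pure
        mtensor_mult multiplier_homD[OF g] multiplier_homD[OF h])
  show ?thesis
    by (rule S.additive_ext[of _ _ s]) (simp_all add: distrib_right tensor_hom_linear(1) *)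
qed

lemma nondegenerate_tensor_hom:
  assumes g': "A.span {g a \<rhd> c | a c. True} = UNIV" "A.span {c \<lhd> g a | a c. True} = UNIV"
    and h': "B.span {h b \<rhd> d | b d. True} = UNIV" "B.span {d \<lhd> h b | b d. True} = UNIV"
  shows "nondegenerate_hom (tscale T') gh"
proof (unfold_locales, rule tensor_hom_mult)
  let ?L = "T.span {gh t \<rhd> w | t w. True}"
  have "pure T' (g a \<rhd> c) (h b \<rhd> d) \<in> ?L" for a b c d
    by (rule T.span_base) (metis (mono_tags, lifting) mem_Collect_eq tensor_hom_linear(3) mtensor_pure(1))
  then have "pure T' (g a \<rhd> c) d \<in> ?L" for a c d
    by - (rule B.in_all_if_spanning[OF h'(1), of "\<lambda>d. pure T' (g a \<rhd> c) d \<in> ?L"],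
        auto simp: pure_linear T.span_add T.span_scale T.span_zero pure_zero)
  then have "pure T' c d \<in> ?L" for c d
    by - (rule A.in_all_if_spanning[OF g'(1), of "\<lambda>c. pure T' c d \<in> ?L"],
        auto simp: pure_linear T.span_add T.span_scale T.span_zero pure_zero)
  then have "t \<in> ?L" for t
    by - (rule T.in_all_if_spanning[OF span_pure, of "\<lambda>t. t \<in> ?L"],
        auto simp: T.span_add T.span_scale T.span_zero)
  then show "?L = UNIV" by auto
next
  let ?L = "T.span {w \<lhd> gh t | t w. True}"
  have "pure T' (c \<lhd> g a) (d \<lhd> h b) \<in> ?L" for a b c d
    by (rule T.span_base) (metis (mono_tags, lifting) mem_Collect_eq tensor_hom_linear(3) mtensor_pure(2))
  then have "pure T' (c \<lhd> g a) d \<in> ?L" for a c d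
    by - (rule B.in_all_if_spanning[OF h'(2), of "\<lambda>d. pure T' (c \<lhd> g a) d \<in> ?L"],
        auto simp: pure_linear T.span_add T.span_scale T.span_zero pure_zero)
  then have "pure T' c d \<in> ?L" for c d
    by - (rule A.in_all_if_spanning[OF g'(2), of "\<lambda>c. pure T' c d \<in> ?L"],
        auto simp: pure_linear T.span_add T.span_scale T.span_zero pure_zero)
  then have "t \<in> ?L" for t
    by - (rule T.in_all_if_spanning[OF span_pure, of "\<lambda>t. t \<in> ?L"],
        auto simp: T.span_add T.span_scale T.span_zero)
  then show "?L = UNIV" by auto
qed

end

context nondegenerate_tensor_algebra
begin

lemma cancel_leg1: "s = t" if "\<And>a. leg1 T a \<rhd> s = leg1 T a \<rhd> t"
proof (rule T.eq_if_left_mult_eq)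
  show "c * s = c * t" for c
    by (rule additive_ext[of _ _ c])
      (simp_all add: distrib_right pure_mult act_simps(6)[symmetric] legs_commute,
        simp add: act_simps that)
qed

context
  fixes G h
  assumes G: "automorphism sA G" and h: "automorphism sB h"
begin

lemma bilinear_endo: "bilinear_map sA sB (tscale T) (\<lambda>a b. pure T (G a) (h b))"
  by (rule bilinearI[OF T.vector_space_axioms]) (simp_all add: automorphismD[OF G] automorphismD[OF h] pure_linear)

lemma tensor_endo_tsum: "tensor_endo T G h t = tsum T t (\<lambda>a b. pure T (G a) (h b))"
  unfolding tensor_endo_def by (rule tensor_lift_tsum[OF T.vector_space_axioms bilinear_endo])

lemma tensor_endo_linear:
  "tensor_endo T G h (s + t) = tensor_endo T G h s + tensor_endo T G h t"
  "tensor_endo T G h (tscale T c t) = tscale T c (tensor_endo T G h t)"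
  "tensor_endo T G h (pure T a b) = pure T (G a) (h b)"
  unfolding tensor_endo_tsum by (rule tsum_linear[OF T.vector_space_axioms bilinear_endo])+

lemma tensor_endo_mult: "tensor_endo T G h (s * t) = tensor_endo T G h s * tensor_endo T G h t"
proof -
  have *: "tensor_endo T G h (pure T a b * t) = tensor_endo T G h (pure T a b) * tensor_endo T G h t" for a b
    by (rule additive_ext[of _ _ t]) (simp_all add: distrib_left tensor_endo_linear mult_pure
        automorphismD[OF G] automorphismD[OF h])
  show ?thesis
    by (rule additive_ext[of _ _ s]) (simp_all add: distrib_right tensor_endo_linear(1) *)
qed

lemma tensor_endo_surj: "surj (tensor_endo T G h)"
proof (rule surjI)
  fix t
  show "tensor_endo T G h (tsum T t (\<lambda>a b. pure T (inv G a) (inv h b))) = t"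
    by (subst tsum_additive[of "tensor_endo T G h"])
      (simp_all add: tensor_endo_linear automorphismD[OF G] automorphismD[OF h] tsum_pure)
qed

lemma tensor_endo_leg:
  "tensor_endo T G h (leg1 T a \<rhd> t) = leg1 T (G a) \<rhd> tensor_endo T G h t"
  "tensor_endo T G h (t \<lhd> leg2 T b) = tensor_endo T G h t \<lhd> leg2 T (h b)"
  "tensor_endo T G h (leg2 T b \<rhd> t) = leg2 T (h b) \<rhd> tensor_endo T G h t"
  by (rule additive_ext[of _ _ t]; simp add: act_add tensor_endo_linear leg_pure
      automorphismD[OF G] automorphismD[OF h])+

end

end

section \<open>Homomorphisms into multipliers of a tensor product\<close>

text \<open>Shared frame for \<open>\<alpha> : X \<rightarrow> M(X \<otimes> A)\<close> and \<open>\<Delta> : A \<rightarrow> M(A \<otimes> A)\<close>. The elements \<open>P z x = (z \<otimes> 1)\<alpha>(x)\<close>,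
  \<open>R x a = \<alpha>(x)(1 \<otimes> a)\<close> and \<open>L a x = (1 \<otimes> a)\<alpha>(x)\<close> of \<open>X \<otimes> A\<close> are the forms in which \<open>\<alpha>\<close> is used below:
  one factor is covered, and what remains is a genuine tensor. The form \<open>P\<close> covers the leg in \<open>X\<close>, which leaves
  the leg in \<open>A\<close> free for further comultiplications.\<close>

locale covered_hom = nondegenerate_tensor_algebra sX sA XA
  for sX :: "'k::field \<Rightarrow> 'x::ring \<Rightarrow> 'x"
    and sA :: "'k \<Rightarrow> 'a::ring \<Rightarrow> 'a"
    and XA :: "('k, 'x, 'a, 'xa::ring) tensor" +
  fixes \<alpha> :: "'x \<Rightarrow> 'xa multiplier"
  assumes hom: "multiplier_hom sX (tscale XA) \<alpha>"
    and cover1: "leg1 XA z * \<alpha> x \<in> range embed"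
    and cover2: "\<alpha> x * leg2 XA a \<in> range embed"
    and cover2': "leg2 XA a * \<alpha> x \<in> range embed"
begin

definition P :: "'x \<Rightarrow> 'x \<Rightarrow> 'xa" where "P z x = unembed (leg1 XA z * \<alpha> x)"
definition R :: "'x \<Rightarrow> 'a \<Rightarrow> 'xa" where "R x a = unembed (\<alpha> x * leg2 XA a)"
definition L :: "'a \<Rightarrow> 'x \<Rightarrow> 'xa" where "L a x = unembed (leg2 XA a * \<alpha> x)"

lemmas hom_simps = multiplier_homD(1-3)[OF hom]

lemma embed_P: "embed (P z x) = leg1 XA z * \<alpha> x"
  and embed_R: "embed (R x a) = \<alpha> x * leg2 XA a"
  and embed_L: "embed (L a x) = leg2 XA a * \<alpha> x"
  by (simp_all add: P_def R_def L_def T.embed_unembed cover1 cover2 cover2')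

lemmas embed_covered = embed_P embed_R embed_L

lemma mscale_mult: "mscale (tscale XA) c m * n = mscale (tscale XA) c (m * n)"
  "m * mscale (tscale XA) c n = mscale (tscale XA) c (m * n)" for m n :: "'xa multiplier"
  by (rule T.multiplier_eqI_left; simp add: T.mscale_act act_simps T.act_scale)+

lemma covered_linear:
  "P (z + z') x = P z x + P z' x" "P z (x + x') = P z x + P z x'"
  "P (sX c z) x = tscale XA c (P z x)" "P z (sX c x) = tscale XA c (P z x)"
  "R (x + x') a = R x a + R x' a" "R x (a + a') = R x a + R x a'"
  "R (sX c x) a = tscale XA c (R x a)" "R x (sA c a) = tscale XA c (R x a)"
  "L (a + a') x = L a x + L a' x" "L a (x + x') = L a x + L a x'"
  "L (sA c a) x = tscale XA c (L a x)" "L a (sX c x) = tscale XA c (L a x)"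
  by (subst T.embed_eq_iff[symmetric], simp add: embed_add[where 'a = 'xa] embed_covered hom_simps leg_linear
      multiplier_homD(2)[OF T.multiplier_hom_embed] mscale_mult algebra_simps)+

lemma covered_mult:
  "P z (x * y) = P z x \<lhd> \<alpha> y" "P (z * w) x = leg1 XA z \<rhd> P w x"
  "R (x * y) a = \<alpha> x \<rhd> R y a" "R x (a * b) = R x a \<lhd> leg2 XA b"
  "L a (x * y) = L a x \<lhd> \<alpha> y" "L (a * b) x = leg2 XA a \<rhd> L b x"
  by (subst T.embed_eq_iff[symmetric], simp add: embed_mult_multiplier[symmetric] embed_covered
      hom_simps leg_mult mult.assoc)+

lemma covered_compat:
  "leg1 XA z \<rhd> L c x = leg2 XA c \<rhd> P z x" "P z x \<lhd> leg2 XA a = leg1 XA z \<rhd> R x a"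
  "L c x \<lhd> leg2 XA a = leg2 XA c \<rhd> R x a"
  by (subst T.embed_eq_iff[symmetric], simp add: embed_mult_multiplier[symmetric] embed_covered
      mult.assoc[symmetric] legs_commute)+

lemma covered_times:
  "P z x * t = leg1 XA z \<rhd> \<alpha> x \<rhd> t" "t * P z x = t \<lhd> leg1 XA z \<lhd> \<alpha> x"
  "R x a * t = \<alpha> x \<rhd> leg2 XA a \<rhd> t" "t * R x a = t \<lhd> \<alpha> x \<lhd> leg2 XA a"
  "L a x * t = leg2 XA a \<rhd> \<alpha> x \<rhd> t" "t * L a x = t \<lhd> leg2 XA a \<lhd> \<alpha> x"
  using embed_act(1)[of "P z x" t] embed_act(2)[of t "P z x"] embed_act(1)[of "R x a" t]
    embed_act(2)[of t "R x a"] embed_act(1)[of "L a x" t] embed_act(2)[of t "L a x"]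
  by (simp_all add: embed_covered act_simps)

lemma pure_act:
  "pure XA z c \<lhd> \<alpha> x = leg2 XA c \<rhd> P z x" "\<alpha> x \<rhd> pure XA z c = R x c \<lhd> leg1 XA z"
   apply (subst T.embed_eq_iff[symmetric], simp add: embed_mult_multiplier[symmetric] embed_covered
      mult.assoc pure_eq_legs(2))
  by (subst T.embed_eq_iff[symmetric], simp add: embed_mult_multiplier[symmetric] embed_covered
      mult.assoc pure_eq_legs(2))

end

text \<open>For these functionals \<open>(\<iota> \<otimes> \<omega>)\<alpha>(x) = (\<iota> \<otimes> \<eta>)(\<alpha>(x)(1 \<otimes> c))\<close> lies in \<open>X\<close> itself, and not only in \<open>M(X)\<close>.\<close>

definition coverable :: "('k::field \<Rightarrow> 'a::ring \<Rightarrow> 'a) \<Rightarrow> ('a \<Rightarrow> 'k) \<Rightarrow> bool" where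
  "coverable sA \<omega> \<longleftrightarrow> (\<exists>\<eta> c. functional sA \<eta> \<and> \<omega> = (\<lambda>b. \<eta> (b * c)))"

lemma (in k_algebra) coverable_functional: "coverable scale \<omega> \<Longrightarrow> functional scale \<omega>"
  by (auto simp: coverable_def functional_times)

context covered_hom
begin

lemma eq_if_P_eq: "\<alpha> x = \<alpha> y" if "\<And>z. P z x = P z y"
  by (rule mtensor_unique_right) (simp add: pure_act that)

text \<open>The action \<open>\<omega> \<cdot> x = (\<iota> \<otimes> \<omega>)\<alpha>(x)\<close>, described through its left multiples.\<close>

definition act :: "('a \<Rightarrow> 'k) \<Rightarrow> 'x \<Rightarrow> 'x" where
  "act \<omega> x = (THE w. \<forall>z. z * w = slice1 sX XA \<omega> (P z x))"

lemma act_eqI: "act \<omega> x = w" if "\<And>z. z * w = slice1 sX XA \<omega> (P z x)"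
  unfolding act_def by (rule the_equality) (auto simp: that intro: A.eq_if_left_mult_eq)

lemma mult_slice1_R:
  "functional sA \<eta> \<Longrightarrow> z * slice1 sX XA \<eta> (R x c) = slice1 sX XA (\<lambda>b. \<eta> (b * c)) (P z x)"
  by (simp add: slice1_act(4)[symmetric] covered_compat(2) slice1_act(1) embed_act)

lemma act_R: "functional sA \<eta> \<Longrightarrow> act (\<lambda>b. \<eta> (b * c)) x = slice1 sX XA \<eta> (R x c)"
  by (rule act_eqI) (simp add: mult_slice1_R)

lemma mult_act: "coverable sA \<omega> \<Longrightarrow> z * act \<omega> x = slice1 sX XA \<omega> (P z x)"
  by (auto simp: coverable_def act_R mult_slice1_R)

lemma act_linear:
  assumes "coverable sA \<omega>"
  shows "act \<omega> (x + y) = act \<omega> x + act \<omega> y" "act \<omega> (sX c x) = sX c (act \<omega> x)"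
  by (rule A.eq_if_left_mult_eq; simp add: mult_act[OF assms] covered_linear distrib_left
    slice1_linear[OF B.coverable_functional[OF assms]] A.scale_mult_right)+

end

context covered_hom
begin

context
  fixes F G h
  assumes G: "automorphism sX G" and h: "automorphism sA h"
    and eq: "\<And>z x. P (G z) (F x) = tensor_endo XA G h (P z x)"
begin

text \<open>The form \<open>P\<close> controls the right action of \<open>\<alpha>(F x)\<close> on pure tensors, and a multiplier is determined
  by its right action.\<close>

lemma hom_eq_mext_endo: "\<alpha> (F x) = mext_endo (tensor_endo XA G h) (\<alpha> x)"
proof (rule T.mext_endo_eqI[symmetric, OF tensor_endo_surj[OF G h] tensor_endo_mult[OF G h]])
  show "tensor_endo XA G h t \<lhd> \<alpha> (F x) = tensor_endo XA G h (t \<lhd> \<alpha> x)" for t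
    by (rule additive_ext[of _ _ t]) (simp_all add: act_add tensor_endo_linear[OF G h] pure_act eq
        tensor_endo_leg[OF G h])
qed

lemma R_endo: "R (F x) (h a) = tensor_endo XA G h (R x a)"
proof (rule cancel_leg1)
  fix z
  have "leg1 XA (G (inv G z)) \<rhd> R (F x) (h a) = leg1 XA (G (inv G z)) \<rhd> tensor_endo XA G h (R x a)"
    by (simp only: covered_compat(2)[symmetric] eq tensor_endo_leg[OF G h, symmetric])
  then show "leg1 XA z \<rhd> R (F x) (h a) = leg1 XA z \<rhd> tensor_endo XA G h (R x a)"
    by (simp add: automorphismD[OF G])
qed

end

lemma act_\<alpha>_tsum: "t \<lhd> \<alpha> y = tsum XA t (\<lambda>u v. leg2 XA v \<rhd> P u y)"
  using tsum_pure[of t] tsum_act(2)[of XA t "pure XA" "\<alpha> y"] by (simp add: pure_act)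

end

section \<open>The counit and the idempotence of the algebra\<close>

sublocale algebraic_quantum_group \<subseteq> AA: covered_hom sA sA AA \<Delta>
  using bij1 bij2 bij4
  by unfold_locales (auto simp: hom_\<Delta> bijective_onto_algebra_def)

sublocale algebraic_quantum_group \<subseteq> AA_A: nondegenerate_tensor_algebra "tscale AA" sA AA_A ..
sublocale algebraic_quantum_group \<subseteq> A_AA: nondegenerate_tensor_algebra sA "tscale AA" A_AA ..

context algebraic_quantum_group
begin

lemma counit_simps:
  "functional sA \<epsilon>" "\<epsilon> (a * b) = \<epsilon> a * \<epsilon> b" "\<epsilon> (a + b) = \<epsilon> a + \<epsilon> b" "\<epsilon> (sA c a) = c * \<epsilon> a"
  and counit_P: "slice1 sA AA \<epsilon> (AA.P a b) = a * b"
  and counit_R: "slice2 sA AA \<epsilon> (AA.R a b) = a * b"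
  using counit by (auto simp: is_counit_def AA.P_def AA.R_def functional_iff A.vector_space_axioms)

lemma antipode_simps:
  "bij S" "S (a * b) = S b * S a" "S (a + b) = S a + S b" "S (sA c a) = sA c (S a)"
  and antipode_R: "tensor_lift AA sA (\<lambda>p q. S p * q) (AA.R a b) = sA (\<epsilon> a) b"
  and antipode_P: "tensor_lift AA sA (\<lambda>p q. p * S q) (AA.P a b) = sA (\<epsilon> b) a"
  using antipode by (auto simp: is_antipode_def AA.P_def AA.R_def linearD)

lemma linear_S: "Vector_Spaces.linear sA sA S"
  using antipode by (simp add: is_antipode_def)

lemma S_inv: "S (inv S a) = a" "inv S (S a) = a"
  using antipode_simps(1) by (simp_all add: bij_is_surj surj_f_inv_f bij_is_inj)

lemma inv_S_simps: "inv S (a * b) = inv S b * inv S a" "inv S (a + b) = inv S a + inv S b"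
  "inv S (sA c a) = sA c (inv S a)"
proof -
  have *: "inv S a = b \<longleftrightarrow> a = S b" for a b
    using S_inv by metis
  show "inv S (a * b) = inv S b * inv S a" "inv S (a + b) = inv S a + inv S b"
    "inv S (sA c a) = sA c (inv S a)"
    by (simp_all add: * antipode_simps S_inv)
qed

lemma counit_one: "\<exists>e. \<epsilon> e = 1"
proof -
  obtain a :: 'a where "a \<noteq> 0"
    using A.nonzero by blast
  then obtain b where "a * b \<noteq> 0"
    using A.nondegenerate_left by blast
  then have "slice1 sA AA \<epsilon> (AA.P a b) \<noteq> 0"
    by (simp add: counit_P)
  moreover have "slice1 sA AA \<epsilon> (AA.P a b) = 0" if "\<forall>e. \<epsilon> e = 0"
    by (simp add: AA.slice1_tsum[OF counit_simps(1)] that tsum_zero)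
  ultimately obtain e where e: "\<epsilon> e \<noteq> 0"
    by blast
  then have "\<epsilon> (sA (1 / \<epsilon> e) e) = 1"
    by (simp add: counit_simps)
  then show ?thesis ..
qed

lemma bilinear_P: "bilinear_map sA sA (tscale AA) AA.P"
  by (rule AA.bilinearI[OF AA.T.vector_space_axioms]) (simp_all add: AA.covered_linear)

text \<open>The map \<open>a \<otimes> b \<mapsto> (a \<otimes> 1)\<Delta>(b)\<close> is onto: to verify a linear identity on \<open>A \<otimes> A\<close> it suffices to
  treat the tensors \<open>P a b\<close>.\<close>

lemma P_surj: "\<exists>s. tsum AA s AA.P = t"
proof -
  have "tsum AA s AA.P = tensor_lift AA (tscale AA) (\<lambda>a b. unembed (leg1 AA a * \<Delta> b)) s" for s
    using AA.tensor_lift_tsum[OF AA.T.vector_space_axioms bilinear_P, of s]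
    unfolding AA.P_def by simp
  moreover obtain s where "t = tensor_lift AA (tscale AA) (\<lambda>a b. unembed (leg1 AA a * \<Delta> b)) s"
    using bij2 unfolding bijective_onto_algebra_def bij_def surj_def by blast
  ultimately have "tsum AA s AA.P = t"
    by simp
  then show ?thesis ..
qed

text \<open>Apply \<open>\<iota> \<otimes> \<epsilon>\<close>, which sends \<open>(a \<otimes> 1)\<Delta>(b)\<close> to \<open>ab\<close>, to the onto map above.\<close>

lemma span_products: "A.span {a * b | a b. True} = UNIV"
proof -
  have "a \<in> A.span {a * b | a b. True}" for a
  proof -
    obtain e where e: "\<epsilon> e = 1"
      using counit_one by blast
    obtain s where s: "tsum AA s AA.P = pure AA a e"
      using P_surj by blast
    have "a = slice1 sA AA \<epsilon> (pure AA a e)"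
      using e by (simp add: AA.slice1_linear counit_simps)
    also have "\<dots> = tsum AA s (\<lambda>p q. slice1 sA AA \<epsilon> (AA.P p q))"
      unfolding s[symmetric] by (rule tsum_additive) (simp add: AA.slice1_linear counit_simps)
    also have "\<dots> = tsum AA s (\<lambda>p q. p * q)"
      by (simp only: counit_P)
    also have "\<dots> \<in> A.span {a * b | a b. True}"
      by (rule tsum_mem) (auto intro: A.span_base A.span_zero A.span_add)
    finally show ?thesis .
  qed
  then show ?thesis by blast
qed

lemma counit_R': "slice1 sA AA \<epsilon> (AA.R v a) = sA (\<epsilon> a) v"
proof (rule A.eq_if_left_mult_eq)
  fix c
  have "c * slice1 sA AA \<epsilon> (AA.R v a) = slice1 sA AA (\<lambda>b. \<epsilon> (b * a)) (AA.P c v)"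
    by (rule AA.mult_slice1_R) (rule counit_simps)
  also have "\<dots> = sA (\<epsilon> a) (slice1 sA AA \<epsilon> (AA.P c v))"
    using AA.slice1_scale[OF counit_simps(1), of "\<epsilon> a"] by (simp add: counit_simps mult.commute)
  finally show "c * slice1 sA AA \<epsilon> (AA.R v a) = c * sA (\<epsilon> a) v"
    by (simp add: counit_P A.scale_mult_right)
qed

end

section \<open>Coassociativity\<close>

context algebraic_quantum_group
begin

lemma inj_\<Delta>: "inj \<Delta>"
proof (rule injI)
  fix a b assume "\<Delta> a = \<Delta> b"
  then have "AA.P c a = AA.P c b" for c
    by (simp add: AA.P_def)
  then have "c * a = c * b" for c
    by (metis counit_P)
  then show "a = b"
    by (rule A.eq_if_left_mult_eq)
qed

lemma span_embed: "A.span {embed a \<rhd> c | a c. True} = UNIV" "A.span {c \<lhd> embed a | a c. True} = UNIV"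
proof -
  have "{embed a \<rhd> c | a c :: 'a. True} = {a * b | a b. True}"
    "{c \<lhd> embed a | a c :: 'a. True} = {a * b | a b. True}"
    by (auto simp: embed_act)
  then show "A.span {embed a \<rhd> c | a c. True} = UNIV" "A.span {c \<lhd> embed a | a c. True} = UNIV"
    using span_products by simp_all
qed

text \<open>\<open>A\<close> coacts on itself by \<open>\<Delta>\<close>, so all results on coactions apply to the quantum group. The two
  formulations of coassociativity differ by the factor \<open>1 \<otimes> 1 \<otimes> a\<close>, which \<open>\<Delta> \<otimes> \<iota>\<close> absorbs.\<close>

lemma reduced_right_coaction_self: "reduced_right_coaction sA AA AA_A A_AA \<Delta> sA AA AA_A A_AA \<Delta>"
proof -
  interpret D: tensor_of_homs sA sA AA "tscale AA" sA AA_A \<Delta> embed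
    by unfold_locales (rule hom_\<Delta> A.multiplier_hom_embed)+
  interpret D: nondegenerate_hom "tscale AA_A" D.gh
    by (rule D.nondegenerate_tensor_hom[OF nondegenerate_\<Delta>_left nondegenerate_\<Delta>_right span_embed])
  have leg2: "leg2 AA_A a * D.gh s = D.gh (leg2 AA a \<rhd> s)" for a s
    by (rule AA.additive_ext[of _ _ s]) (simp_all add: D.tensor_hom_linear act_add distrib_left
        AA.mtensor_pure act_simps AA_A.mtensor_mult embed_act embed_mult)
  have coassoc_right: "D.gh (unembed (\<Delta> x * leg2 AA a)) = mext (tensor_hom AA A_AA embed \<Delta>) (\<Delta> x) * leg2 AA_A a" for x a
  proof (rule D.cancel_multiplier_right)
    fix s
    have "D.gh (AA.R x a) * D.gh s = D.gh (\<Delta> x \<rhd> leg2 AA a \<rhd> s)"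
      by (simp add: D.tensor_hom_mult[symmetric] AA.covered_times)
    also have "\<dots> = mext D.gh (\<Delta> x) * (leg2 AA_A a * D.gh s)"
      by (simp add: leg2 D.mext_mult)
    finally show "D.gh (unembed (\<Delta> x * leg2 AA a)) * D.gh s =
        mext (tensor_hom AA A_AA embed \<Delta>) (\<Delta> x) * leg2 AA_A a * D.gh s"
      by (simp add: coassoc AA.R_def mult.assoc)
  qed
  show ?thesis
    by unfold_locales
      (simp_all add: tscale_assoc pure_assoc hom_\<Delta> inj_\<Delta> AA.cover1 AA.cover2 AA.cover2' coassoc_right)
qed

end

text \<open>Idempotence of \<open>X\<close> makes the homomorphism \<open>\<iota> \<otimes> \<Delta>\<close> on \<open>X \<otimes> A\<close> non-degenerate, so that it extends to
  multipliers and coassociativity can be evaluated. It holds for Galois objects.\<close>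

locale full_coaction =
    algebraic_quantum_group sA AA AA_A A_AA \<Delta> \<epsilon> S \<phi> +
    reduced_right_coaction sA AA AA_A A_AA \<Delta> sX XA XA_A X_AA \<alpha>
  for sA :: "'k::field \<Rightarrow> 'a::ring \<Rightarrow> 'a"
    and AA :: "('k, 'a, 'a, 'aa::ring) tensor"
    and AA_A :: "('k, 'aa, 'a, 'aaa::ring) tensor"
    and A_AA :: "('k, 'a, 'aa, 'aaa) tensor"
    and \<Delta> :: "'a \<Rightarrow> 'aa multiplier"
    and \<epsilon> :: "'a \<Rightarrow> 'k" and S :: "'a \<Rightarrow> 'a" and \<phi> :: "'a \<Rightarrow> 'k"
    and sX :: "'k \<Rightarrow> 'x::ring \<Rightarrow> 'x"
    and XA :: "('k, 'x, 'a, 'xa::ring) tensor"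
    and XA_A :: "('k, 'xa, 'a, 'xaa::ring) tensor"
    and X_AA :: "('k, 'x, 'aa, 'xaa) tensor"
    and \<alpha> :: "'x \<Rightarrow> 'xa multiplier" +
  assumes span_products_X: "X.span {x * y | x y. True} = UNIV"

sublocale reduced_right_coaction \<subseteq> XA: covered_hom sX sA XA \<alpha>
  by unfold_locales (rule hom_\<alpha> \<alpha>_leg2 leg2_\<alpha> leg1_\<alpha>)+

sublocale reduced_right_coaction \<subseteq> XA_A: nondegenerate_tensor_algebra "tscale XA" sA XA_A ..
sublocale full_coaction \<subseteq> X_AA: nondegenerate_tensor_algebra sX "tscale AA" X_AA ..

sublocale algebraic_quantum_group \<subseteq>
  self: full_coaction sA AA AA_A A_AA \<Delta> \<epsilon> S \<phi> sA AA AA_A A_AA \<Delta>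
  by (intro full_coaction.intro full_coaction_axioms.intro algebraic_quantum_group_axioms
      reduced_right_coaction_self span_products)

context full_coaction
begin

lemma span_embed_X: "X.span {embed x \<rhd> y | x y. True} = UNIV" "X.span {y \<lhd> embed x | x y. True} = UNIV"
proof -
  have "{embed a \<rhd> c | a c :: 'x. True} = {a * b | a b. True}"
    "{c \<lhd> embed a | a c :: 'x. True} = {a * b | a b. True}"
    by (auto simp: embed_act)
  then show "X.span {embed x \<rhd> y | x y. True} = UNIV" "X.span {y \<lhd> embed x | x y. True} = UNIV"
    using span_products_X by simp_all
qed

lemma leg2_assoc: "leg2 XA_A a = mtensor X_AA 1 (leg2 AA a)"
proof (rule XA_A.mtensor_unique)
  fix s c
  show "leg2 XA_A a \<rhd> pure XA_A s c = mtensor X_AA 1 (leg2 AA a) \<rhd> pure XA_A s c"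
    by (rule XA.additive_ext[of _ _ s])
      (simp_all add: XA_A.pure_linear act_add XA_A.leg_pure, simp add: pure_assoc_X
        X_AA.mtensor_pure act_simps AA.leg_pure)
qed

lemma pure_pure_times:
  "pure X_AA e (pure AA d f) * pure XA_A s c = pure XA_A (pure XA e d * s) (f * c)"
  "pure X_AA e w * pure X_AA u t = pure X_AA (e * u) (w * t)"
  by (simp_all add: pure_assoc_X[symmetric] XA_A.mult_pure X_AA.mult_pure)

text \<open>Both sides are \<open>z x\<^sub>0 \<otimes> x\<^sub>1 \<otimes> x\<^sub>2 a\<close>. This is coassociativity with the middle leg uncovered, the
  form from which all others follow.\<close>

lemma coassoc_R:
  "tsum XA (XA.R x a) (\<lambda>y c. pure XA_A (XA.P z y) c) =
   tsum XA (XA.P z x) (\<lambda>u v. pure X_AA u (AA.R v a))" (is "?lhs = ?rhs")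
proof -
  interpret D: tensor_of_homs sX sA XA sX "tscale AA" X_AA embed \<Delta>
    by unfold_locales (rule hom_\<Delta> X.multiplier_hom_embed)+
  interpret D: nondegenerate_hom "tscale X_AA" D.gh
    by (rule D.nondegenerate_tensor_hom[OF span_embed_X nondegenerate_\<Delta>_left nondegenerate_\<Delta>_right])
  interpret G: tensor_of_homs sX sA XA "tscale XA" sA XA_A \<alpha> embed
    by unfold_locales (rule hom_\<alpha> A.multiplier_hom_embed)+
  \<comment> \<open>Multiplied by \<open>e \<otimes> w\<close> from the left, the left hand side is a value of \<open>\<alpha> \<otimes> \<iota>\<close>.\<close>
  have 1: "pure X_AA (e * z) w \<lhd> G.gh (XA.R x a) = pure X_AA e w * ?lhs" for e w
  proof (rule AA.additive_ext[of _ _ w])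
    fix d f
    have "pure X_AA (e * z) (pure AA d f) \<lhd> mtensor XA_A (\<alpha> y) (embed c) =
        pure X_AA e (pure AA d f) * pure XA_A (XA.P z y) c" for y c
      by (simp add: pure_assoc_X[symmetric] XA_A.mtensor_pure XA_A.mult_pure XA.pure_act
          XA.covered_mult XA.pure_mult embed_act act_simps(6)[symmetric] XA.legs_commute)
    then show "pure X_AA (e * z) (pure AA d f) \<lhd> G.gh (XA.R x a) = pure X_AA e (pure AA d f) * ?lhs"
      by (simp add: G.tensor_hom_tsum tsum_act tsum_mult)
  qed (simp_all add: X_AA.pure_linear act_add distrib_right)
  \<comment> \<open>The factor \<open>\<Delta> b\<close> completes \<open>z\<close> to the value \<open>(\<iota> \<otimes> \<Delta>)(z \<otimes> b)\<close>, with which the extension of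
    \<open>\<iota> \<otimes> \<Delta>\<close> can be evaluated.\<close>
  have 2: "pure X_AA (e * z) (w \<lhd> \<Delta> b) \<lhd> G.gh (XA.R x a) = pure X_AA e (w \<lhd> \<Delta> b) * ?rhs" for e w b
  proof -
    have "pure X_AA (e * z) (w \<lhd> \<Delta> b) = pure X_AA e w \<lhd> D.gh (pure XA z b)"
      by (simp add: D.tensor_hom_linear X_AA.mtensor_pure embed_act)
    moreover have "G.gh (XA.R x a) = mext D.gh (\<alpha> x) * leg2 XA_A a"
      using coassoc_\<alpha>[of x a] by (simp add: XA.R_def)
    ultimately have "pure X_AA (e * z) (w \<lhd> \<Delta> b) \<lhd> G.gh (XA.R x a) =
        pure X_AA e w \<lhd> (D.gh (pure XA z b) * mext D.gh (\<alpha> x)) \<lhd> leg2 XA_A a"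
      by (simp add: act_simps)
    also have "\<dots> = pure X_AA e w \<lhd> D.gh (leg2 XA b \<rhd> XA.P z x) \<lhd> leg2 XA_A a"
      by (simp add: D.mext_mult XA.pure_act)
    also have "D.gh (leg2 XA b \<rhd> XA.P z x) = tsum XA (XA.P z x) (\<lambda>u v. mtensor X_AA (embed u) (\<Delta> (b * v)))"
      unfolding D.tensor_hom_tsum
      by (simp add: XA.tsum_mtensor[OF X_AA.T.vector_space_mscale D.bilinear_gh] act_simps embed_act)
    also have "pure X_AA e w \<lhd> \<dots> \<lhd> leg2 XA_A a =
        tsum XA (XA.P z x) (\<lambda>u v. pure X_AA (e * u) (w \<lhd> \<Delta> b \<lhd> \<Delta> v \<lhd> leg2 AA a))"
      by (simp add: tsum_act X_AA.mtensor_pure leg2_assoc act_simps embed_act AA.hom_simps)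
    also have "\<dots> = pure X_AA e (w \<lhd> \<Delta> b) * ?rhs"
      by (simp add: tsum_mult pure_pure_times AA.covered_times embed_act)
    finally show ?thesis .
  qed
  \<comment> \<open>The products \<open>w \<Delta> b\<close> span \<open>A \<otimes> A\<close>.\<close>
  have 3: "pure X_AA e w * ?lhs = pure X_AA e w * ?rhs" for e w
    by (rule AA.T.in_all_if_spanning[OF nondegenerate_\<Delta>_right, of "\<lambda>w. pure X_AA e w * ?lhs = pure X_AA e w * ?rhs"])
      (auto simp: X_AA.pure_linear X_AA.pure_zero distrib_right X_AA.T.scale_mult_left 1[symmetric] 2)
  show ?thesis
  proof (rule X_AA.T.eq_if_left_mult_eq)
    show "s * ?lhs = s * ?rhs" for s
      by (rule X_AA.additive_ext[of _ _ s]) (simp_all only: distrib_right 3)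
  qed
qed

lemma bilinear_pure_P: "bilinear_map sX sA (tscale XA_A) (\<lambda>y c. pure XA_A (XA.P z y) c)"
  by (rule XA.bilinearI[OF XA_A.T.vector_space_axioms]) (simp_all add: XA.covered_linear XA_A.pure_linear)

lemma coassoc_L:
  "tsum XA (XA.L a x) (\<lambda>y c. pure XA_A (XA.P z y) c) =
   tsum XA (XA.P z x) (\<lambda>u v. pure X_AA u (AA.L a v))" (is "?lhs = ?rhs")
proof (rule XA_A.cancel_leg2)
  fix d
  note bil = XA.tsum_mtensor[OF XA_A.T.vector_space_axioms bilinear_pure_P]
  have "?lhs \<lhd> leg2 XA_A d = tsum XA (XA.L a x \<lhd> leg2 XA d) (\<lambda>y c. pure XA_A (XA.P z y) c)"
    by (simp add: tsum_act XA_A.leg_pure bil act_simps embed_act)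
  also have "\<dots> = leg2 XA_A a \<rhd> tsum XA (XA.R x d) (\<lambda>y c. pure XA_A (XA.P z y) c)"
    by (simp add: XA.covered_compat tsum_act XA_A.leg_pure bil act_simps embed_act)
  also have "\<dots> = leg2 XA_A a \<rhd> tsum XA (XA.P z x) (\<lambda>u v. pure X_AA u (AA.R v d))"
    by (simp only: coassoc_R)
  also have "\<dots> = ?rhs \<lhd> leg2 XA_A d"
    by (simp add: leg2_assoc tsum_act X_AA.mtensor_pure act_simps AA.covered_compat)
  finally show "?lhs \<lhd> leg2 XA_A d = ?rhs \<lhd> leg2 XA_A d" .
qed

lemma slice1_assoc:
  assumes "functional sA \<omega>"
  shows "slice1 (tscale XA) XA_A \<omega> (pure X_AA u t) = pure XA u (slice1 sA AA \<omega> t)"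
  by (rule AA.additive_ext[of _ _ t]) (simp_all add: X_AA.pure_linear XA.pure_linear
    pure_assoc_X[symmetric] AA.slice1_linear[OF assms] XA_A.slice1_linear[OF assms])

lemma P_slice1_R:
  assumes "functional sA \<omega>"
  shows "XA.P z (slice1 sX XA \<omega> (XA.R x a)) = tsum XA (XA.P z x) (\<lambda>u v. pure XA u (slice1 sA AA \<omega> (AA.R v a)))"
proof -
  have add: "slice1 (tscale XA) XA_A \<omega> (s + t) = slice1 (tscale XA) XA_A \<omega> s + slice1 (tscale XA) XA_A \<omega> t" for s t
    by (rule XA_A.slice1_linear[OF assms])
  have "XA.P z (slice1 sX XA \<omega> (XA.R x a)) = tsum XA (XA.R x a) (\<lambda>y c. slice1 (tscale XA) XA_A \<omega> (pure XA_A (XA.P z y) c))"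
    unfolding XA.slice1_tsum[OF assms]
    by (subst tsum_additive[of "XA.P z"]) (simp_all add: XA.covered_linear XA_A.slice1_linear[OF assms])
  also have "\<dots> = tsum XA (XA.P z x) (\<lambda>u v. slice1 (tscale XA) XA_A \<omega> (pure X_AA u (AA.R v a)))"
    by (simp only: tsum_additive[of "slice1 (tscale XA) XA_A \<omega>", OF add, symmetric] coassoc_R)
  finally show ?thesis
    by (simp add: slice1_assoc[OF assms])
qed

text \<open>Coassociativity as \<open>\<alpha>(\<omega> \<cdot> x) = (\<iota> \<otimes> \<omega> \<cdot>)\<alpha>(x)\<close>.\<close>

lemma P_act: "coverable sA \<omega> \<Longrightarrow> XA.P z (XA.act \<omega> x) = tsum XA (XA.P z x) (\<lambda>u v. pure XA u (AA.act \<omega> v))"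
  by (auto simp: coverable_def XA.act_R AA.act_R P_slice1_R)

text \<open>By coassociativity \<open>\<epsilon> \<cdot> x\<close> and \<open>x\<close> have the same image under \<open>\<alpha>\<close>, and \<open>\<alpha>\<close> is injective.\<close>

lemma counit_X: "slice1 sX XA \<epsilon> (XA.P z x) = z * x"
proof -
  obtain e where e: "\<epsilon> e = 1"
    using counit_one by blast
  have "XA.P z (slice1 sX XA \<epsilon> (XA.R x e)) = XA.P z x" for z
    using e by (simp add: P_slice1_R counit_simps counit_R' XA.tsum_pure)
  then have "\<alpha> (slice1 sX XA \<epsilon> (XA.R x e)) = \<alpha> x"
    by (rule XA.eq_if_P_eq)
  then have "slice1 sX XA \<epsilon> (XA.R x e) = x"
    using inj_\<alpha> by (simp add: inj_eq)
  then show ?thesis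
    using XA.mult_slice1_R[OF counit_simps(1), of z x e] e by (simp add: counit_simps)
qed

end

section \<open>The antipode and invariant functionals\<close>

context algebraic_quantum_group
begin

lemma bilinear_mult_S: "bilinear_map sA sA sA (\<lambda>p q. p * S q)" "bilinear_map sA sA sA (\<lambda>p q. S p * q)"
  by (rule AA.bilinearI[OF A.vector_space_axioms];
      simp add: antipode_simps distrib_left distrib_right A.scale_mult_left A.scale_mult_right)+

lemma antipode_tsum:
  "tsum AA (AA.R a b) (\<lambda>p q. S p * q) = sA (\<epsilon> a) b"
  "tsum AA (AA.P a b) (\<lambda>p q. p * S q) = sA (\<epsilon> b) a"
  using antipode_R[of a b] antipode_P[of a b]
    AA.tensor_lift_tsum[OF A.vector_space_axioms bilinear_mult_S(1)]
    AA.tensor_lift_tsum[OF A.vector_space_axioms bilinear_mult_S(2)] by simp_all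

lemma antipode_L: "tsum AA (AA.L c v) (\<lambda>p q. d * (p * S q)) = sA (\<epsilon> v) (d * S c)"
proof -
  note bil = AA.tsum_mtensor[OF A.vector_space_axioms bilinear_mult_S(1)]
  have "tsum AA (AA.L c v) (\<lambda>p q. d * (p * S q)) = tsum AA (leg1 AA d \<rhd> AA.L c v) (\<lambda>p q. p * S q)"
    by (simp add: bil act_simps embed_act mult.assoc)
  also have "\<dots> = tsum AA (AA.P d v) (\<lambda>p q. p * S q) * S c"
    by (simp add: AA.covered_compat bil act_simps embed_act antipode_simps tsum_mult mult.assoc)
  finally show ?thesis
    by (simp add: antipode_tsum A.scale_mult_left)
qed

end

context full_coaction
begin

text \<open>The identity \<open>y \<otimes> S(c) = y\<^sub>0 \<otimes> y\<^sub>1 S(c y\<^sub>2)\<close>. After covering the first two legs by \<open>z \<otimes> d\<close> it is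
  coassociativity followed by the antipode axiom for \<open>y\<^sub>1 S(y\<^sub>2)\<close>.\<close>

lemma pure_eq_sum_R: "tsum XA (XA.L c y) (\<lambda>u v. XA.R u (S v)) = pure XA y (S c)"
proof (rule XA.T.eq_if_left_mult_eq)
  fix s
  show "s * tsum XA (XA.L c y) (\<lambda>u v. XA.R u (S v)) = s * pure XA y (S c)"
  proof (rule XA.additive_ext[of _ _ s])
    fix z d
    \<comment> \<open>\<open>?G\<close> is \<open>x \<otimes> p \<otimes> q \<mapsto> x \<otimes> d p S(q)\<close>, read off from \<open>(X \<otimes> A) \<otimes> A\<close>.\<close>
    let ?G = "\<lambda>t. tsum XA_A t (\<lambda>s q. (leg2 XA d \<rhd> s) \<lhd> leg2 XA (S q))"
    have "bilinear_map (tscale XA) sA (tscale XA) (\<lambda>s q. (leg2 XA d \<rhd> s) \<lhd> leg2 XA (S q))"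
      by (rule XA_A.bilinearI[OF XA.T.vector_space_axioms])
        (simp_all add: act_add antipode_simps XA.leg_linear XA.T.act_scale act_simps XA.T.mscale_act)
    note G = XA_A.tsum_linear[OF XA.T.vector_space_axioms this]
    have G_pure: "?G (pure X_AA u t) = pure XA u (tsum AA t (\<lambda>p q. d * (p * S q)))" for u t
    proof -
      have *: "bilinear_map sA sA sA (\<lambda>p q. d * (p * S q))"
        by (rule AA.bilinearI[OF A.vector_space_axioms])
          (simp_all add: antipode_simps distrib_left distrib_right A.scale_mult_left A.scale_mult_right)
      show ?thesis
        by (rule AA.additive_ext[of _ _ t])
          (simp_all add: X_AA.pure_linear G XA.pure_linear AA.tsum_linear[OF A.vector_space_axioms *]
            pure_assoc_X[symmetric] XA.leg_pure mult.assoc)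
    qed
    have "pure XA z d * tsum XA (XA.L c y) (\<lambda>u v. XA.R u (S v)) =
        tsum XA (XA.L c y) (\<lambda>u v. ?G (pure XA_A (XA.P z u) v))"
      by (simp add: tsum_mult XA.pure_mult G act_simps(6)[symmetric] XA.legs_commute)
        (simp add: act_simps XA.T.lmult_rmult XA.covered_compat(2))
    also have "\<dots> = ?G (tsum XA (XA.P z y) (\<lambda>u v. pure X_AA u (AA.L c v)))"
      by (simp only: tsum_additive[of ?G, OF G(1), symmetric] coassoc_L)
    also have "\<dots> = tsum XA (XA.P z y) (\<lambda>u v. pure XA u (sA (\<epsilon> v) (d * S c)))"
      by (simp only: tsum_additive[of ?G, OF G(1)] G_pure antipode_L)
    also have "\<dots> = tsum XA (XA.P z y) (\<lambda>u v. pure XA (sX (\<epsilon> v) u) (d * S c))"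
      by (simp add: XA.pure_linear)
    also have "\<dots> = pure XA (slice1 sX XA \<epsilon> (XA.P z y)) (d * S c)"
      unfolding XA.slice1_tsum[OF counit_simps(1)]
      by (rule tsum_additive[symmetric]) (rule XA.pure_linear)
    finally show "pure XA z d * tsum XA (XA.L c y) (\<lambda>u v. XA.R u (S v)) = pure XA z d * pure XA y (S c)"
      by (simp add: counit_X XA.mult_pure)
  qed (simp_all add: distrib_right)
qed

text \<open>\<open>\<alpha>(x)(y \<otimes> 1) = \<alpha>(x y\<^sub>0)(1 \<otimes> S(y\<^sub>1))\<close>, by the previous identity. In particular covering the first
  leg from the right also leads into \<open>X \<otimes> A\<close>.\<close>

lemma right_cover1: "embed (tsum XA (XA.P x y) (\<lambda>u v. XA.R u (S v))) = \<alpha> x * leg1 XA y"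
proof (rule XA.mtensor_unique)
  fix w e
  obtain c where e: "e = S c"
    using S_inv by metis
  have bil: "bilinear_map sX sA (tscale XA) (\<lambda>u v. XA.R u (S v))"
    by (rule XA.bilinearI[OF XA.T.vector_space_axioms]) (simp_all add: XA.covered_linear antipode_simps)
  note lin = XA.tsum_mtensor[OF XA.T.vector_space_axioms bil]
  have "\<alpha> x \<rhd> pure XA y e = tsum XA (leg1 XA x \<rhd> XA.L c y) (\<lambda>u v. XA.R u (S v))"
    by (simp add: e pure_eq_sum_R[symmetric] lin act_simps embed_act tsum_act XA.covered_mult)
  also have "\<dots> = tsum XA (XA.P x y) (\<lambda>u v. XA.R u (S v)) \<lhd> leg2 XA e"
    by (simp add: XA.covered_compat lin act_simps embed_act antipode_simps e XA.covered_mult tsum_act)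
  finally have Q: "tsum XA (XA.P x y) (\<lambda>u v. XA.R u (S v)) \<lhd> leg2 XA e = XA.R x e \<lhd> leg1 XA y"
    by (simp add: XA.pure_act)
  have "embed (tsum XA (XA.P x y) (\<lambda>u v. XA.R u (S v))) \<rhd> pure XA w e =
      tsum XA (XA.P x y) (\<lambda>u v. XA.R u (S v)) \<lhd> (leg2 XA e * leg1 XA w)"
    by (simp add: embed_act XA.pure_mult XA.legs_commute[symmetric] act_simps)
  also have "\<dots> = XA.R x e \<lhd> leg1 XA (y * w)"
    by (simp add: Q act_simps XA.leg_mult)
  finally show "embed (tsum XA (XA.P x y) (\<lambda>u v. XA.R u (S v))) \<rhd> pure XA w e = (\<alpha> x * leg1 XA y) \<rhd> pure XA w e"
    by (simp add: act_simps XA.leg_pure XA.pure_act)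
qed

lemma cover1_right: "\<alpha> x * leg1 XA y \<in> range embed"
  using right_cover1 by (metis rangeI)

text \<open>The slice \<open>(\<iota> \<otimes> \<omega>)\<alpha>(x)\<close> is a multiplier of \<open>X\<close>, as \<open>\<alpha>(x)\<close> can be covered in the first leg from both sides.\<close>

lemma rmult_mslice1:
  assumes \<omega>: "functional sA \<omega>"
  shows "z \<lhd> mslice1 sX XA \<omega> (\<alpha> x) = slice1 sX XA \<omega> (XA.P z x)"
proof -
  let ?Q = "\<lambda>z. unembed (\<alpha> x * leg1 XA z)"
  have "z * slice1 sX XA \<omega> (?Q w) = slice1 sX XA \<omega> (XA.P z x) * w" for z w
  proof -
    have "leg1 XA z \<rhd> ?Q w = XA.P z x \<lhd> leg1 XA w"
      by (subst XA.T.embed_eq_iff[symmetric])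
        (simp add: embed_mult_multiplier[symmetric] XA.embed_covered XA.T.embed_unembed cover1_right mult.assoc)
    then show ?thesis
      using XA.slice1_act(1,2)[OF \<omega>] by (metis embed_act)
  qed
  then obtain m where m: "\<And>w. m \<rhd> w = slice1 sX XA \<omega> (?Q w)" "\<And>z. z \<lhd> m = slice1 sX XA \<omega> (XA.P z x)"
    by (rule X.multiplier_exists[of "\<lambda>w. slice1 sX XA \<omega> (?Q w)" "\<lambda>z. slice1 sX XA \<omega> (XA.P z x)"]) blast
  have "mslice1 sX XA \<omega> (\<alpha> x) = m"
    unfolding mslice1_def
    by (rule the_equality) (auto simp: m XA.P_def intro: X.multiplier_eqI_left)
  then show ?thesis
    by (simp add: m)
qed

lemma functional_action_eq_act:
  assumes "coverable sA \<omega>"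
  shows "functional_action sX XA \<alpha> \<omega> x = XA.act \<omega> x"
proof -
  have "mslice1 sX XA \<omega> (\<alpha> x) = embed (XA.act \<omega> x)"
    by (rule X.multiplier_eqI_right)
      (simp add: rmult_mslice1[OF A.coverable_functional[OF assms]] embed_act XA.mult_act[OF assms])
  then show ?thesis
    by (simp add: functional_action_def X.unembed_embed)
qed

lemma lmult_mslice2:
  assumes \<omega>: "functional sX \<omega>"
  shows "mslice2 sA XA \<omega> (\<alpha> x) \<rhd> b = slice2 sA XA \<omega> (XA.R x b)"
proof -
  have "b * slice2 sA XA \<omega> (XA.R x c) = slice2 sA XA \<omega> (XA.L b x) * c" for b c
    using XA.slice2_act(1,2)[OF \<omega>] XA.covered_compat(3)[of b x c] by (metis embed_act)
  then obtain m where m: "\<And>w. m \<rhd> w = slice2 sA XA \<omega> (XA.R x w)" "\<And>z. z \<lhd> m = slice2 sA XA \<omega> (XA.L z x)"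
    by (rule A.multiplier_exists[of "\<lambda>w. slice2 sA XA \<omega> (XA.R x w)" "\<lambda>z. slice2 sA XA \<omega> (XA.L z x)"]) blast
  have "mslice2 sA XA \<omega> (\<alpha> x) = m"
    unfolding mslice2_def
    by (rule the_equality) (auto simp: m XA.R_def XA.L_def intro: A.multiplier_eqI_left)
  then show ?thesis
    by (simp add: m)
qed

text \<open>The relation \<open>\<psi>(x\<^sub>0 y) x\<^sub>1 = \<psi>(x y\<^sub>0) S(y\<^sub>1)\<close> for an invariant \<open>\<psi>\<close>: apply \<open>\<psi> \<otimes> \<iota>\<close> to the two sides of
  \<open>\<alpha>(x)(y \<otimes> 1) = \<alpha>(x y\<^sub>0)(1 \<otimes> S(y\<^sub>1))\<close>.\<close>

lemma invariant_shift:
  assumes \<psi>: "functional sX \<psi>" and inv: "\<And>x b. slice2 sA XA \<psi> (XA.R x b) = sA (\<psi> x) b"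
    and \<omega>: "coverable sA \<omega>" and \<omega>S: "coverable sA (\<lambda>b. \<omega> (S b))"
  shows "\<psi> (XA.act \<omega> x * y) = \<psi> (x * XA.act (\<lambda>b. \<omega> (S b)) y)"
proof -
  obtain \<eta> c where \<eta>: "functional sA \<eta>" and \<omega>_def: "\<omega> = (\<lambda>b. \<eta> (b * c))"
    using \<omega> by (auto simp: coverable_def)
  let ?Q = "tsum XA (XA.P x y) (\<lambda>u v. XA.R u (S v))"
  have lin: "\<psi> (x + y) = \<psi> x + \<psi> y" "\<psi> (sX k x) = k * \<psi> x" "\<eta> (a + b) = \<eta> a + \<eta> b" "\<eta> (sA k a) = k * \<eta> a" for x y k a b
    using \<psi> \<eta> by (simp_all add: functional_iff X.vector_space_axioms A.vector_space_axioms)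
  have Q: "?Q \<lhd> leg2 XA c = XA.R x c \<lhd> leg1 XA y"
    by (subst XA.T.embed_eq_iff[symmetric])
      (simp add: embed_mult_multiplier[symmetric] right_cover1 XA.embed_covered mult.assoc XA.legs_commute)
  have "\<psi> (x * XA.act (\<lambda>b. \<omega> (S b)) y) = tsum XA (XA.P x y) (\<lambda>u v. \<omega> (S v) * \<psi> u)"
    by (simp add: XA.mult_act[OF \<omega>S] XA.slice1_tsum[OF A.coverable_functional[OF \<omega>S]]
        tsum_additive[of \<psi>] lin)
  also have "\<dots> = tsum XA (XA.P x y) (\<lambda>u v. \<eta> (slice2 sA XA \<psi> (XA.R u (S v) \<lhd> leg2 XA c)))"
    by (simp add: XA.covered_mult(4)[symmetric] inv lin \<omega>_def mult.commute)
  also have "\<dots> = \<eta> (slice2 sA XA \<psi> (?Q \<lhd> leg2 XA c))"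
    by (subst tsum_additive[of "\<lambda>t. \<eta> (slice2 sA XA \<psi> (t \<lhd> leg2 XA c))"])
      (simp_all add: act_add XA.slice2_linear[OF \<psi>] lin)
  also have "\<dots> = \<eta> (slice2 sA XA (\<lambda>x. \<psi> (x * y)) (XA.R x c))"
    by (simp add: Q XA.slice2_act[OF \<psi>])
  also have "\<dots> = \<psi> (slice1 sX XA \<eta> (XA.R x c) * y)"
    using XA.functional_slice[OF X.functional_times(1)[OF \<psi>] \<eta>] by simp
  finally show ?thesis
    by (simp add: \<omega>_def XA.act_R[OF \<eta>])
qed

end

section \<open>Modular automorphisms and actions of functionals\<close>

text \<open>An algebraic quantum group with its modular data: \<open>\<sigma>\<close> belongs to \<open>\<phi>\<close>, \<open>\<sigma>'\<close> to \<open>\<psi> = \<phi> S\<close>, and \<open>\<tau>\<close> is the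
  scaling constant.\<close>

locale modular_quantum_group = algebraic_quantum_group sA AA AA_A A_AA \<Delta> \<epsilon> S \<phi>
  for sA :: "'k::field \<Rightarrow> 'a::ring \<Rightarrow> 'a"
    and AA :: "('k, 'a, 'a, 'aa::ring) tensor"
    and AA_A :: "('k, 'aa, 'a, 'aaa::ring) tensor"
    and A_AA :: "('k, 'a, 'aa, 'aaa) tensor"
    and \<Delta> :: "'a \<Rightarrow> 'aa multiplier"
    and \<epsilon> :: "'a \<Rightarrow> 'k" and S :: "'a \<Rightarrow> 'a" and \<phi> :: "'a \<Rightarrow> 'k" +
  fixes \<sigma> \<sigma>' :: "'a \<Rightarrow> 'a" and \<tau> :: 'k
  assumes modular: "modular_automorphism sA \<phi> \<sigma>"
    and modular': "modular_automorphism sA (\<phi> \<circ> S) \<sigma>'"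
    and scaling: "\<phi> (S (S a)) = \<tau> * \<phi> a"

locale modular_coaction =
    modular_quantum_group sA AA AA_A A_AA \<Delta> \<epsilon> S \<phi> \<sigma> \<sigma>' \<tau> +
    full_coaction sA AA AA_A A_AA \<Delta> \<epsilon> S \<phi> sX XA XA_A X_AA \<alpha>
  for sA :: "'k::field \<Rightarrow> 'a::ring \<Rightarrow> 'a"
    and AA :: "('k, 'a, 'a, 'aa::ring) tensor"
    and AA_A :: "('k, 'aa, 'a, 'aaa::ring) tensor"
    and A_AA :: "('k, 'a, 'aa, 'aaa) tensor"
    and \<Delta> :: "'a \<Rightarrow> 'aa multiplier"
    and \<epsilon> :: "'a \<Rightarrow> 'k" and S :: "'a \<Rightarrow> 'a" and \<phi> :: "'a \<Rightarrow> 'k" and \<sigma> \<sigma>' :: "'a \<Rightarrow> 'a" and \<tau> :: 'k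
    and sX :: "'k \<Rightarrow> 'x::ring \<Rightarrow> 'x"
    and XA :: "('k, 'x, 'a, 'xa::ring) tensor"
    and XA_A :: "('k, 'xa, 'a, 'xaa::ring) tensor"
    and X_AA :: "('k, 'x, 'aa, 'xaa) tensor"
    and \<alpha> :: "'x \<Rightarrow> 'xa multiplier"

sublocale modular_quantum_group \<subseteq>
  self: modular_coaction sA AA AA_A A_AA \<Delta> \<epsilon> S \<phi> \<sigma> \<sigma>' \<tau> sA AA AA_A A_AA \<Delta> ..

context modular_quantum_group
begin

lemmas \<sigma>_auto = modular_automorphismD(2)[OF modular]
lemmas \<sigma>_simps = automorphismD[OF \<sigma>_auto]
lemmas \<sigma>_inv_auto = automorphism_inv[OF \<sigma>_auto]

lemma KMS: "\<phi> (a * b) = \<phi> (b * \<sigma> a)"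
  using modular by (simp add: modular_automorphism_def)

lemma linear_inv_S: "Vector_Spaces.linear sA sA (inv S)"
  by (rule linearI) (simp_all add: A.vector_space_axioms inv_S_simps)

lemma coverable_right: "functional sA \<eta> \<Longrightarrow> coverable sA (\<lambda>b. \<eta> (b * c))"
  by (auto simp: coverable_def)

text \<open>By the modular property \<open>\<phi>(c \<cdot>) = \<phi>(\<cdot> \<sigma>(c))\<close>, so these functionals are covered on both sides.\<close>

lemma coverable_left: "coverable sA (\<lambda>b. \<phi> (c * b))"
  using coverable_right[OF functional_\<phi>, of "\<sigma> c"] by (simp add: KMS[of c])

lemma coverable_comp:
  assumes "coverable sA \<omega>" "automorphism sA h"
  shows "coverable sA (\<lambda>b. \<omega> (h b))"
proof -
  note h = automorphismD[OF assms(2)]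
  obtain \<eta> c where \<eta>: "functional sA \<eta>" "\<omega> = (\<lambda>b. \<eta> (b * c))"
    using assms(1) by (auto simp: coverable_def)
  have "functional sA (\<lambda>b. \<eta> (h b))"
    using functional_comp[OF \<eta>(1)] assms(2) by (simp add: automorphism_def)
  moreover have "\<omega> (h b) = \<eta> (h (b * inv h c))" for b
    by (simp add: \<eta>(2) h)
  ultimately show ?thesis
    unfolding coverable_def by (intro exI[of _ "\<lambda>b. \<eta> (h b)"] exI[of _ "inv h c"]) auto
qed

lemma coverable_character:
  assumes "functional sA \<chi>" "\<And>a b. \<chi> (a * b) = \<chi> a * \<chi> b" "\<exists>a. \<chi> a \<noteq> 0"
  shows "coverable sA \<chi>"
proof -
  obtain a where a: "\<chi> a \<noteq> 0"
    using assms(3) by blast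
  have "\<chi> (sA (1 / \<chi> a) a) = 1"
    using a assms(1) by (simp add: functional_iff A.vector_space_axioms)
  then show ?thesis
    using assms(1,2) unfolding coverable_def
    by (intro exI[of _ \<chi>] exI[of _ "sA (1 / \<chi> a) a"]) auto
qed

lemma coverable_antipode:
  "coverable sA (\<lambda>b. \<phi> (c * inv S b))" "coverable sA (\<lambda>b. \<phi> (c * inv S (inv S b)))"
proof -
  have "functional sA (\<lambda>b. \<phi> (inv S b))" "functional sA (\<lambda>b. \<phi> (inv S (inv S b)))"
    using functional_comp[OF functional_comp[OF functional_\<phi> linear_inv_S] linear_inv_S]
      functional_comp[OF functional_\<phi> linear_inv_S] by simp_all
  then have "coverable sA (\<lambda>b. \<phi> (inv S (b * S c)))" "coverable sA (\<lambda>b. \<phi> (inv S (inv S (b * S (S (\<sigma> c))))))"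
    unfolding coverable_def by blast+
  then show "coverable sA (\<lambda>b. \<phi> (c * inv S b))" "coverable sA (\<lambda>b. \<phi> (c * inv S (inv S b)))"
    by (simp_all add: inv_S_simps S_inv KMS[of c])
qed

end

context modular_coaction
begin

text \<open>An equation \<open>\<alpha> F = (G \<otimes> h)\<alpha>\<close> may be tested on the functionals \<open>\<omega> = \<phi>(c \<cdot>)\<close>, where it reads
  \<open>\<omega> \<cdot> F(x) = G(\<omega>h \<cdot> x)\<close>, because \<open>\<phi>\<close> is faithful.\<close>

lemma P_eq_if_act_eq:
  assumes G: "automorphism sX G" and h: "automorphism sA h"
    and eq: "\<And>c. XA.act (\<lambda>b. \<phi> (c * b)) (F x) = G (XA.act (\<lambda>b. \<phi> (c * h b)) x)"
  shows "XA.P (G z) (F x) = tsum XA (XA.P z x) (\<lambda>u v. pure XA (G u) (h v))"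
proof (rule XA.eq_if_faithful_slice1_eq[OF functional_\<phi> faithful_\<phi>])
  fix c
  let ?\<omega> = "\<lambda>b. \<phi> (inv \<sigma> c * b)"
  have \<omega>: "(\<lambda>b. \<phi> (b * c)) = ?\<omega>"
    by (simp add: KMS[of "inv \<sigma> c"] \<sigma>_simps)
  have cov: "coverable sA ?\<omega>" "coverable sA (\<lambda>b. ?\<omega> (h b))"
    using coverable_left coverable_comp[OF coverable_left h] by blast+
  note func = A.coverable_functional[OF cov(1)] A.coverable_functional[OF cov(2)]
  have "slice1 sX XA ?\<omega> (XA.P (G z) (F x)) = G (z * XA.act (\<lambda>b. ?\<omega> (h b)) x)"
    by (simp add: XA.mult_act[OF cov(1), symmetric] eq automorphismD[OF G])
  also have "\<dots> = tsum XA (XA.P z x) (\<lambda>u v. sX (?\<omega> (h v)) (G u))"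
    by (simp add: XA.mult_act[OF cov(2)] XA.slice1_tsum[OF func(2)] tsum_additive[of G] automorphismD[OF G])
  also have "\<dots> = slice1 sX XA ?\<omega> (tsum XA (XA.P z x) (\<lambda>u v. pure XA (G u) (h v)))"
    by (subst tsum_additive[of "slice1 sX XA ?\<omega>"]) (simp_all add: XA.slice1_linear[OF func(1)])
  finally show "slice1 sX XA (\<lambda>b. \<phi> (b * c)) (XA.P (G z) (F x)) =
      slice1 sX XA (\<lambda>b. \<phi> (b * c)) (tsum XA (XA.P z x) (\<lambda>u v. pure XA (G u) (h v)))"
    by (simp add: \<omega>)
qed

text \<open>Conversely such an equation may be evaluated on functionals that are not of the form \<open>\<phi>(c \<cdot>)\<close>, such
  as characters.\<close>

lemma act_eq_if_P_eq:
  assumes G: "automorphism sX G" and \<omega>: "coverable sA \<omega>" "coverable sA (\<lambda>b. \<omega> (h b))"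
    and eq: "\<And>z. XA.P (G z) (F x) = tsum XA (XA.P z x) (\<lambda>u v. pure XA (G u) (h v))"
  shows "XA.act \<omega> (F x) = G (XA.act (\<lambda>b. \<omega> (h b)) x)"
proof (rule X.eq_if_left_mult_eq)
  fix z
  note func = A.coverable_functional[OF \<omega>(1)] A.coverable_functional[OF \<omega>(2)]
  have "G (inv G z) * XA.act \<omega> (F x) = tsum XA (XA.P (inv G z) x) (\<lambda>u v. sX (\<omega> (h v)) (G u))"
    by (simp only: XA.mult_act[OF \<omega>(1)] eq)
      (subst tsum_additive[of "slice1 sX XA \<omega>"], simp_all add: XA.slice1_linear[OF func(1)])
  also have "\<dots> = G (inv G z * XA.act (\<lambda>b. \<omega> (h b)) x)"
    by (simp add: XA.mult_act[OF \<omega>(2)] XA.slice1_tsum[OF func(2)] tsum_additive[of G]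
        automorphismD(1,2)[OF G])
  finally show "z * XA.act \<omega> (F x) = z * G (XA.act (\<lambda>b. \<omega> (h b)) x)"
    by (simp add: automorphismD[OF G])
qed

text \<open>For \<open>\<omega> = \<phi>(c \<cdot>)\<close>, shift \<open>\<omega>\<close> from \<open>\<rho>(y)\<close> to \<open>x\<close> in \<open>\<psi>(x (\<omega> \<cdot> \<rho>(y)))\<close>, commute with the modular property,
  shift again, and commute back. Each shift composes \<open>\<omega>\<close> with \<open>S\<^sup>-\<^sup>1\<close>. The result says
  \<open>\<alpha> \<rho> = (\<rho> \<otimes> S\<^sup>-\<^sup>2)\<alpha>\<close>.\<close>

lemma act_modular_of_invariant:
  assumes \<psi>: "functional sX \<psi>" "faithful \<psi>" and inv: "\<And>x b. slice2 sA XA \<psi> (XA.R x b) = sA (\<psi> x) b"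
    and \<rho>: "modular_automorphism sX \<psi> \<rho>"
  shows "XA.act (\<lambda>b. \<phi> (c * b)) (\<rho> y) = \<rho> (XA.act (\<lambda>b. \<phi> (c * inv S (inv S b))) y)"
proof -
  note KMS' = modular_automorphismD(1)[OF \<rho>]
  note add = linearD(1)[OF \<psi>(1)[unfolded functional_def]]
  let ?a = "XA.act (\<lambda>b. \<phi> (c * b)) (\<rho> y)" and ?b = "\<rho> (XA.act (\<lambda>b. \<phi> (c * inv S (inv S b))) y)"
  have "\<psi> (x * ?a) = \<psi> (x * ?b)" for x
  proof -
    have "\<psi> (x * ?a) = \<psi> (XA.act (\<lambda>b. \<phi> (c * inv S b)) x * \<rho> y)"
      using invariant_shift[OF \<psi>(1) inv, of "\<lambda>b. \<phi> (c * inv S b)" x "\<rho> y"] coverable_left coverable_antipode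
      by (simp add: S_inv)
    also have "\<dots> = \<psi> (y * XA.act (\<lambda>b. \<phi> (c * inv S b)) x)"
      by (simp add: KMS'[of y])
    also have "\<dots> = \<psi> (XA.act (\<lambda>b. \<phi> (c * inv S (inv S b))) y * x)"
      using invariant_shift[OF \<psi>(1) inv, of "\<lambda>b. \<phi> (c * inv S (inv S b))" y x] coverable_antipode
      by (simp add: S_inv)
    also have "\<dots> = \<psi> (x * ?b)"
      by (rule KMS')
    finally show ?thesis .
  qed
  then have "\<psi> (x * (?a - ?b)) = 0" for x
    using add[of "x * (?a - ?b)" "x * ?b"] by (simp add: distrib_left[symmetric])
  then have "?a - ?b = 0"
    using \<psi>(2) unfolding faithful_def by blast
  then show ?thesis
    by simp
qed

end

section \<open>The antipode reverses the comultiplication\<close>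

context full_coaction
begin

lemma act_act:
  assumes "coverable sA \<omega>" "coverable sA \<omega>'"
  shows "XA.act \<omega> (XA.act \<omega>' x) = XA.act (\<lambda>a. \<omega> (AA.act \<omega>' a)) x"
proof (rule XA.act_eqI[symmetric])
  fix z
  note func = A.coverable_functional[OF assms(1)]
  have "functional sA (\<lambda>a. \<omega> (AA.act \<omega>' a))"
    using func by (simp add: functional_iff A.vector_space_axioms AA.act_linear[OF assms(2)])
  from XA.slice1_tsum[OF this] show "z * XA.act \<omega> (XA.act \<omega>' x) = slice1 sX XA (\<lambda>a. \<omega> (AA.act \<omega>' a)) (XA.P z x)"
    by (simp add: XA.mult_act[OF assms(1)] P_act[OF assms(2)]
        tsum_additive[of "slice1 sX XA \<omega>"] XA.slice1_linear[OF func] func)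
qed

lemma act_counit: "XA.act \<epsilon> x = x"
  by (rule XA.act_eqI) (simp add: counit_X)

end

context algebraic_quantum_group
begin

lemma counit_act: "coverable sA \<omega> \<Longrightarrow> \<epsilon> (AA.act \<omega> a) = \<omega> a"
  by (auto simp: coverable_def AA.act_R AA.functional_slice counit_simps(1) counit_R)

lemma counit_antipode: "\<epsilon> (S a) = \<epsilon> a"
proof -
  obtain e where e: "\<epsilon> e = 1"
    using counit_one by blast
  have "\<epsilon> a * \<epsilon> e = \<epsilon> (tsum AA (AA.R a e) (\<lambda>p q. S p * q))"
    by (simp add: antipode_tsum counit_simps)
  also have "\<dots> = \<epsilon> (S (tsum AA (AA.R a e) (\<lambda>p q. sA (\<epsilon> q) p)))"
    by (simp add: tsum_additive[of \<epsilon>] tsum_additive[of S] antipode_simps counit_simps mult.commute)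
  also have "\<dots> = \<epsilon> (S a)"
    using counit_R'[of a e] e by (simp add: AA.slice1_tsum[OF counit_simps(1)])
  finally show ?thesis
    by (simp add: e)
qed

text \<open>Left invariance is given for \<open>\<Delta>(a)(b \<otimes> 1)\<close>; multiply by \<open>c \<otimes> 1\<close> from the left and cancel \<open>b\<close>.\<close>

lemma left_invariant_P: "slice1 sA AA \<phi> (AA.P c a) = sA (\<phi> a) c"
proof (rule A.eq_if_right_mult_eq)
  fix b
  have "leg1 AA c \<rhd> unembed (\<Delta> a * leg1 AA b) = AA.P c a \<lhd> leg1 AA b"
    using bij3 by (subst AA.T.embed_eq_iff[symmetric])
      (simp add: embed_mult_multiplier[symmetric] AA.embed_covered AA.T.embed_unembed
        bijective_onto_algebra_def mult.assoc)
  then have "c * sA (\<phi> a) b = slice1 sA AA \<phi> (AA.P c a) * b"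
    using AA.slice1_act(1,2)[OF functional_\<phi>] left_invariant[of a b] by (metis embed_act)
  then show "slice1 sA AA \<phi> (AA.P c a) * b = sA (\<phi> a) c * b"
    by (simp add: A.scale_mult_left A.scale_mult_right)
qed

text \<open>\<open>\<Delta>(S(b)) = S(b\<^sub>2) \<otimes> S(b\<^sub>1)\<close>, multiplied by \<open>1 \<otimes> S(a)\<close>. Both sides are inverse to \<open>\<Delta>\<close> for
  convolution: \<open>\<Delta>(c b\<^sub>1) \<Delta>(S(b\<^sub>2)) = \<epsilon>(b)\<Delta>(c)\<close> is immediate, while
  \<open>\<Delta>(c b\<^sub>1) (S(b\<^sub>3) \<otimes> S(b\<^sub>2)) = \<epsilon>(b)\<Delta>(c)\<close> follows by cancelling the inner pair of legs first. Here
  \<open>F q\<close> is the right hand side for \<open>q\<close>, and \<open>G q\<close> the difference of the two sides, which vanishes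
  because \<open>\<Delta>\<close> is non-degenerate.\<close>

lemma antipode_comult: "AA.R (S b) (S a) = tsum AA (AA.P a b) (\<lambda>p q. pure AA (S q) (S p))"
proof -
  define F where "F q = tsum AA (AA.P a q) (\<lambda>s r. pure AA (S r) (S s))" for q
  define G where "G q = AA.R (S q) (S a) - F q" for q
  have bilF: "bilinear_map sA sA (tscale AA) (\<lambda>s r. pure AA (S r) (S s))"
    by (rule AA.bilinearI[OF AA.T.vector_space_axioms]) (simp_all add: AA.pure_linear antipode_simps)
  note linF = AA.tsum_linear[OF AA.T.vector_space_axioms bilF]
  have bilG: "bilinear_map sA sA (tscale AA) (\<lambda>p q. \<Delta> p \<rhd> G q)"
    by (rule AA.bilinearI[OF AA.T.vector_space_axioms])
      (simp_all add: G_def F_def act_add act_diff act_simps antipode_simps AA.covered_linear linF AA.hom_simps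
        AA.T.act_scale AA.T.mscale_act AA.T.scale_right_diff_distrib algebra_simps)
  note linG = AA.tsum_linear[OF AA.T.vector_space_axioms bilG]
  have "tsum AA (AA.P c b) (\<lambda>p q. \<Delta> p \<rhd> G q) = 0" for c b
  proof -
    have bilA: "bilinear_map sA sA (tscale AA_A) (\<lambda>s r. pure AA_A (AA.R p (S s)) r)" for p
      by (rule AA.bilinearI[OF AA_A.T.vector_space_axioms])
        (simp_all add: AA.covered_linear antipode_simps AA_A.pure_linear)
    note linA = AA.tsum_mtensor[OF AA_A.T.vector_space_axioms bilA]
    have bilB: "bilinear_map sA sA (tscale AA_A) (\<lambda>y k. pure AA_A (pure AA y h) k)" for h
      by (rule AA.bilinearI[OF AA_A.T.vector_space_axioms]) (simp_all add: AA.pure_linear AA_A.pure_linear)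
    note linB = AA.tsum_mtensor[OF AA_A.T.vector_space_axioms bilB]
    have bilC: "bilinear_map sA sA (tscale AA) (\<lambda>u s. AA.R u (S (a * s)))"
      by (rule AA.bilinearI[OF AA.T.vector_space_axioms])
        (simp_all add: AA.covered_linear antipode_simps distrib_left distrib_right A.scale_mult_left A.scale_mult_right)
    note linC = AA.tsum_linear[OF AA.T.vector_space_axioms bilC]
    have bilH: "bilinear_map (tscale AA) sA (tscale AA_A) (\<lambda>t r. pure AA_A (tsum AA t (\<lambda>u s. AA.R u (S (a * s)))) r)"
      by (rule AA_A.bilinearI[OF AA_A.T.vector_space_axioms]) (simp_all add: AA_A.pure_linear linC)
    note linH = AA_A.tsum_linear[OF AA_A.T.vector_space_axioms bilH]
    have bilM: "bilinear_map (tscale AA) sA (tscale AA) (\<lambda>t r. t \<lhd> leg1 AA (S r))"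
      by (rule AA_A.bilinearI[OF AA.T.vector_space_axioms])
        (simp_all add: act_add act_simps AA.leg_linear antipode_simps AA.T.act_scale AA.T.mscale_act)
    note linM = AA_A.tsum_linear[OF AA.T.vector_space_axioms bilM]
    let ?H = "\<lambda>t. tsum AA_A t (\<lambda>t r. pure AA_A (tsum AA t (\<lambda>u s. AA.R u (S (a * s)))) r)"
    let ?M = "\<lambda>t. tsum AA_A t (\<lambda>t r. t \<lhd> leg1 AA (S r))"
    let ?Y = "tsum AA (AA.P c b) (\<lambda>p q. tsum AA (AA.P a q) (\<lambda>s r. pure AA_A (AA.R p (S s)) r))"
    let ?Z = "tsum AA (AA.R c (S a)) (\<lambda>g h. tsum AA (AA.P g b) (\<lambda>y k. pure AA_A (pure AA y h) k))"
    \<comment> \<open>Cancelling the inner pair before the outer one is applied: \<open>?Y\<close> is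
      \<open>\<Delta>(c b\<^sub>1)(1 \<otimes> S(a b\<^sub>2)) \<otimes> b\<^sub>3\<close> and \<open>?Z\<close> is \<open>\<Delta>(c)(b\<^sub>1 \<otimes> S(a)) \<otimes> b\<^sub>2\<close>.\<close>
    have "?Y = ?Z"
    proof (rule AA_A.cancel_leg2)
      fix f
      have H_pure: "?H (pure A_AA u t) = tsum AA t (\<lambda>s r. pure AA_A (AA.R u (S (a * s))) r)" for u t
      proof -
        have *: "bilinear_map sA sA (tscale AA_A) (\<lambda>s r. pure AA_A (AA.R u (S (a * s))) r)"
          by (rule AA.bilinearI[OF AA_A.T.vector_space_axioms])
            (simp_all add: AA.covered_linear antipode_simps AA_A.pure_linear distrib_left distrib_right
              A.scale_mult_left A.scale_mult_right)
        show ?thesis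
          by (rule AA.additive_ext[of _ _ t])
            (simp_all add: A_AA.pure_linear linH linC AA.tsum_linear[OF AA_A.T.vector_space_axioms *]
              pure_assoc[symmetric])
      qed
      have Q: "tsum AA (AA.P c y) (\<lambda>u s. AA.R u (S (a * s))) = AA.R c (S a) \<lhd> leg1 AA y" for y
      proof -
        have "tsum AA (AA.P c y) (\<lambda>u s. AA.R u (S (a * s))) = tsum AA (AA.P c y) (\<lambda>u s. AA.R u (S s)) \<lhd> leg2 AA (S a)"
          by (simp add: antipode_simps AA.covered_mult tsum_act)
        also have "\<dots> = AA.R c (S a) \<lhd> leg1 AA y"
          by (subst AA.T.embed_eq_iff[symmetric])
            (simp add: embed_mult_multiplier[symmetric] self.right_cover1 AA.embed_covered mult.assoc AA.legs_commute)
        finally show ?thesis .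
      qed
      have "?Y \<lhd> leg2 AA_A f = tsum AA (AA.P c b) (\<lambda>p q. tsum AA (leg1 AA a \<rhd> AA.R q f) (\<lambda>s r. pure AA_A (AA.R p (S s)) r))"
        by (simp add: tsum_act AA_A.leg_pure AA.covered_compat(2)[symmetric] linA act_simps embed_act)
      also have "\<dots> = tsum AA (AA.P c b) (\<lambda>p q. ?H (pure A_AA p (AA.R q f)))"
        by (simp add: linA H_pure act_simps embed_act)
      also have "\<dots> = ?H (tsum AA (AA.R b f) (\<lambda>y k. pure AA_A (AA.P c y) k))"
        by (simp only: tsum_additive[of ?H, OF linH(1), symmetric] self.coassoc_R)
      also have "\<dots> = tsum AA (AA.R b f) (\<lambda>y k. pure AA_A (AA.R c (S a) \<lhd> leg1 AA y) k)"
        by (simp only: tsum_additive[of ?H, OF linH(1)] linH(3) Q)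
      also have "\<dots> = tsum AA (AA.R b f) (\<lambda>y k. pure AA_A (tsum AA (AA.R c (S a)) (\<lambda>g h. pure AA g h) \<lhd> leg1 AA y) k)"
        by (simp only: AA.tsum_pure)
      also have "\<dots> = tsum AA (AA.R b f) (\<lambda>y k. tsum AA (AA.R c (S a)) (\<lambda>g h. pure AA_A (pure AA (g * y) h) k))"
        by (simp only: tsum_act AA.leg_pure tsum_additive[of "\<lambda>t. pure AA_A t k" for k, OF AA_A.pure_linear(3)])
      also have "\<dots> = tsum AA (AA.R c (S a)) (\<lambda>g h. tsum AA (leg1 AA g \<rhd> AA.R b f) (\<lambda>y k. pure AA_A (pure AA y h) k))"
        by (subst tsum_swap) (simp add: linB act_simps embed_act)
      also have "\<dots> = ?Z \<lhd> leg2 AA_A f"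
        by (simp add: tsum_act AA_A.leg_pure AA.covered_compat(2)[symmetric] linB act_simps embed_act)
      finally show "?Y \<lhd> leg2 AA_A f = ?Z \<lhd> leg2 AA_A f" .
    qed
    \<comment> \<open>\<open>?M\<close> multiplies the first leg by the antipode of the third one, from the right.\<close>
    have "tsum AA (AA.P c b) (\<lambda>p q. \<Delta> p \<rhd> F q) = ?M ?Y"
      by (simp add: F_def tsum_act AA.pure_act tsum_additive[of ?M, OF linM(1)] linM(3))
    also have "\<dots> = ?M ?Z"
      by (simp only: \<open>?Y = ?Z\<close>)
    also have "\<dots> = tsum AA (AA.R c (S a)) (\<lambda>g h. pure AA (tsum AA (AA.P g b) (\<lambda>y k. y * S k)) h)"
      by (simp add: tsum_additive[of ?M, OF linM(1)] linM(3) AA.leg_pure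
          tsum_additive[of "\<lambda>t. pure AA t k" for k, OF AA.pure_linear(3)])
    also have "\<dots> = tscale AA (\<epsilon> b) (tsum AA (AA.R c (S a)) (\<lambda>g h. pure AA g h))"
      by (simp only: antipode_tsum AA.pure_linear
          tsum_additive[of "tscale AA (\<epsilon> b)", OF AA.T.scale_right_distrib])
    also have "\<dots> = AA.R (tsum AA (AA.P c b) (\<lambda>p q. p * S q)) (S a)"
      by (simp add: AA.tsum_pure antipode_tsum AA.covered_linear)
    also have "\<dots> = tsum AA (AA.P c b) (\<lambda>p q. \<Delta> p \<rhd> AA.R (S q) (S a))"
      by (subst tsum_additive[of "\<lambda>x. AA.R x (S a)"]) (simp_all add: AA.covered_linear AA.covered_mult)
    finally show ?thesis
      using tsum_add[of AA "AA.P c b" "\<lambda>p q. \<Delta> p \<rhd> G q" "\<lambda>p q. \<Delta> p \<rhd> F q"]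
      by (simp add: G_def act_diff)
  qed
  then have "tsum AA t (\<lambda>p q. \<Delta> p \<rhd> G q) = 0" for t
    using P_surj[of t] by (auto simp: tsum_additive[OF linG(1)] tsum_zero)
  then have *: "\<Delta> p \<rhd> G q = 0" for p q
    using linG(3)[of p q] by simp
  have "w * G b = w * 0" for w
    by (rule AA.T.in_all_if_spanning[OF nondegenerate_\<Delta>_right, of "\<lambda>w. w * G b = w * 0"])
      (auto simp: distrib_right AA.T.scale_mult_left * act_assoc(3)[symmetric])
  then have "G b = 0"
    by (rule AA.T.eq_if_left_mult_eq)
  then show ?thesis
    by (simp add: G_def F_def)
qed

text \<open>As \<open>S\<close> reverses \<open>\<Delta>\<close>, it turns the left invariance of \<open>\<phi>\<close> into right invariance of \<open>\<phi> S\<^sup>-\<^sup>1\<close>.\<close>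

lemma right_invariant: "slice2 sA AA (\<lambda>a. \<phi> (inv S a)) (AA.R x b) = sA (\<phi> (inv S x)) b"
proof -
  have func: "functional sA (\<lambda>a. \<phi> (inv S a))"
    using functional_\<phi> by (simp add: functional_iff A.vector_space_axioms inv_S_simps)
  have "slice2 sA AA (\<lambda>a. \<phi> (inv S a)) (AA.R (S y) (S a)) = sA (\<phi> y) (S a)" for y a
  proof -
    have "slice2 sA AA (\<lambda>a. \<phi> (inv S a)) (AA.R (S y) (S a)) = tsum AA (AA.P a y) (\<lambda>p q. sA (\<phi> q) (S p))"
      unfolding antipode_comult
      by (subst tsum_additive[of "slice2 sA AA (\<lambda>a. \<phi> (inv S a))"])
        (simp_all add: AA.slice2_linear[OF func] S_inv)
    also have "\<dots> = S (slice1 sA AA \<phi> (AA.P a y))"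
      by (simp add: AA.slice1_tsum[OF functional_\<phi>] tsum_additive[of S] antipode_simps)
    finally show ?thesis
      by (simp add: left_invariant_P antipode_simps)
  qed
  from this[of "inv S x" "inv S b"] show ?thesis
    by (simp add: S_inv)
qed

end

section \<open>Modular automorphisms of the quantum group\<close>

context modular_quantum_group
begin

abbreviation \<psi> :: "'a \<Rightarrow> 'k" where "\<psi> a \<equiv> \<phi> (S a)"

lemmas \<phi>_simps = functional_\<phi>[unfolded functional_iff[OF A.vector_space_axioms], THEN conjunct1, rule_format]
  functional_\<phi>[unfolded functional_iff[OF A.vector_space_axioms], THEN conjunct2, rule_format]

lemma \<phi>_cancel: "a = b" if "\<And>c. \<phi> (c * a) = \<phi> (c * b)"
proof -
  have "\<phi> (c * (a - b)) = 0" for c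
    using that[of c] \<phi>_simps(1)[of "c * (a - b)" "c * b"] by (simp add: distrib_left[symmetric])
  then have "a - b = 0"
    using faithful_\<phi> unfolding faithful_def by blast
  then show ?thesis by simp
qed

lemma functional_\<psi>: "functional sA \<psi>"
  using functional_comp[OF functional_\<phi> linear_S] .

lemma faithful_\<psi>: "faithful \<psi>"
  unfolding faithful_def
proof (intro conjI allI impI)
  fix a assume *: "\<forall>b. \<psi> (a * b) = 0"
  have "\<phi> (b * S a) = 0" for b
    using *[rule_format, of "inv S b"] by (simp add: antipode_simps S_inv)
  then have "S a = 0"
    using faithful_\<phi> unfolding faithful_def by blast
  then show "a = 0"
    using S_inv(2)[of a] S_inv(2)[of 0] linearD(3)[OF linear_S] by simp
next
  fix a assume *: "\<forall>b. \<psi> (b * a) = 0"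
  have "\<phi> (S a * b) = 0" for b
    using *[rule_format, of "inv S b"] by (simp add: antipode_simps S_inv)
  then have "S a = 0"
    using faithful_\<phi> unfolding faithful_def by blast
  then show "a = 0"
    using S_inv(2)[of a] S_inv(2)[of 0] linearD(3)[OF linear_S] by simp
qed

lemma \<psi>_eq: "\<psi> a = \<tau> * \<phi> (inv S a)"
  using scaling[of "inv S a"] by (simp add: S_inv)

lemma scaling_inv: "\<tau> * \<phi> (inv S (inv S a)) = \<phi> a" and \<tau>_nonzero: "\<tau> \<noteq> 0"
proof -
  show *: "\<tau> * \<phi> (inv S (inv S a)) = \<phi> a" for a
    using scaling[of "inv S (inv S a)"] by (simp add: S_inv)
  then show "\<tau> \<noteq> 0"
    using nonzero_\<phi> by (metis mult_zero_left)
qed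

text \<open>\<open>\<psi>\<close> is the multiple \<open>\<tau> \<phi> S\<^sup>-\<^sup>1\<close> of a right invariant functional.\<close>

lemma \<psi>_right_invariant: "slice2 sA AA \<psi> (AA.R x b) = sA (\<psi> x) b"
proof -
  have func: "functional sA (\<lambda>a. \<phi> (inv S a))"
    by (rule functional_comp[OF functional_\<phi> linear_inv_S])
  have "slice2 sA AA \<psi> t = sA \<tau> (slice2 sA AA (\<lambda>a. \<phi> (inv S a)) t)" for t
    by (rule AA.additive_ext[of _ _ t])
      (simp_all only: AA.slice2_linear[OF functional_\<psi>] AA.slice2_linear[OF func] A.scale_right_distrib,
        simp add: \<psi>_eq)
  then show ?thesis
    by (simp add: right_invariant \<psi>_eq)
qed

lemma modular_\<psi>: "modular_automorphism sA \<psi> \<sigma>'"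
  using modular' by (simp add: comp_def)

lemmas \<sigma>'_auto = modular_automorphismD(2)[OF modular_\<psi>]
lemmas \<sigma>'_simps = automorphismD[OF \<sigma>'_auto]
lemmas \<sigma>'_inv_auto = automorphism_inv[OF \<sigma>'_auto]

text \<open>\<open>\<sigma>' = S\<^sup>-\<^sup>1 \<sigma>\<^sup>-\<^sup>1 S\<close>, as \<open>S\<close> reverses products and carries \<open>\<phi>\<close> to \<open>\<psi>\<close>.\<close>

lemma S_\<sigma>': "S (\<sigma>' a) = inv \<sigma> (S a)"
proof -
  have "\<phi> (c * S a) = \<phi> (c * \<sigma> (S (\<sigma>' a)))" for c
  proof -
    have "\<phi> (c * S a) = \<psi> (a * inv S c)"
      by (simp add: antipode_simps S_inv)
    also have "\<dots> = \<psi> (inv S c * \<sigma>' a)"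
      by (rule modular_automorphismD(1)[OF modular_\<psi>])
    also have "\<dots> = \<phi> (S (\<sigma>' a) * c)"
      by (simp add: antipode_simps S_inv)
    finally show ?thesis
      by (simp add: KMS[of "S (\<sigma>' a)"])
  qed
  then have "S a = \<sigma> (S (\<sigma>' a))"
    by (rule \<phi>_cancel)
  then show ?thesis
    by (simp add: \<sigma>_simps)
qed

lemma automorphism_S2: "automorphism sA (\<lambda>a. S (S a))" "automorphism sA (\<lambda>a. inv S (inv S a))"
proof -
  have "bij (\<lambda>a. S (S a))" "bij (\<lambda>a. inv S (inv S a))"
    using bij_comp[OF antipode_simps(1) antipode_simps(1)]
      bij_comp[OF bij_imp_bij_inv[OF antipode_simps(1)] bij_imp_bij_inv[OF antipode_simps(1)]]
    by (simp_all add: comp_def)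
  then show "automorphism sA (\<lambda>a. S (S a))" "automorphism sA (\<lambda>a. inv S (inv S a))"
    by (auto simp: automorphism_def antipode_simps inv_S_simps A.vector_space_axioms intro!: linearI)
qed

text \<open>\<open>\<Delta> \<sigma>' = (\<sigma>' \<otimes> S\<^sup>-\<^sup>2)\<Delta>\<close>, as \<open>\<psi>\<close> is invariant for the coaction of \<open>A\<close> on itself.\<close>

lemma comult_\<sigma>': "AA.P (\<sigma>' z) (\<sigma>' x) = tsum AA (AA.P z x) (\<lambda>u v. pure AA (\<sigma>' u) (inv S (inv S v)))"
  by (rule self.P_eq_if_act_eq[OF \<sigma>'_auto automorphism_S2(2)])
    (rule self.act_modular_of_invariant[OF functional_\<psi> faithful_\<psi> \<psi>_right_invariant modular_\<psi>])

text \<open>\<open>\<Delta> \<sigma>\<^sup>-\<^sup>1 = (S\<^sup>-\<^sup>2 \<otimes> \<sigma>\<^sup>-\<^sup>1)\<Delta>\<close>: conjugate the previous formula by \<open>S\<close>, which reverses \<open>\<Delta>\<close> and carries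
  \<open>\<sigma>'\<close> to \<open>\<sigma>\<^sup>-\<^sup>1\<close>.\<close>

lemma comult_inv_\<sigma>: "AA.R (inv \<sigma> x) (inv \<sigma> z) = tsum AA (AA.R x z) (\<lambda>u v. pure AA (inv S (inv S u)) (inv \<sigma> v))"
proof -
  note inv\<sigma> = automorphismD[OF \<sigma>_inv_auto]
  define y w where "y = inv S x" and "w = inv S z"
  have x: "x = S y" and z: "z = S w"
    by (simp_all add: y_def w_def S_inv)
  have bil: "bilinear_map sA sA (tscale AA) (\<lambda>u v. pure AA (S v) (S u))"
    "bilinear_map sA sA (tscale AA) (\<lambda>u v. pure AA (inv S (inv S u)) (inv \<sigma> v))"
    by (rule AA.bilinearI[OF AA.T.vector_space_axioms];
        simp add: AA.pure_linear antipode_simps inv_S_simps inv\<sigma>)+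
  note lin = AA.tsum_linear[OF AA.T.vector_space_axioms bil(1)] AA.tsum_linear[OF AA.T.vector_space_axioms bil(2)]
  have "AA.R (inv \<sigma> x) (inv \<sigma> z) = AA.R (S (\<sigma>' y)) (S (\<sigma>' w))"
    by (simp add: x z S_\<sigma>')
  also have "\<dots> = tsum AA (AA.P w y) (\<lambda>u v. pure AA (inv S v) (inv \<sigma> (S u)))"
    unfolding antipode_comult comult_\<sigma>'
    by (subst tsum_additive[of "\<lambda>t. tsum AA t (\<lambda>u v. pure AA (S v) (S u))"]) (simp_all add: lin S_inv S_\<sigma>')
  also have "\<dots> = tsum AA (AA.R x z) (\<lambda>u v. pure AA (inv S (inv S u)) (inv \<sigma> v))"
    unfolding x z antipode_comult
    by (subst tsum_additive[of "\<lambda>t. tsum AA t (\<lambda>u v. pure AA (inv S (inv S u)) (inv \<sigma> v))"])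
      (simp_all add: lin S_inv)
  finally show ?thesis .
qed

lemma act_inv_\<sigma>:
  assumes "coverable sA \<omega>"
  shows "AA.act \<omega> (inv \<sigma> a) = inv S (inv S (AA.act (\<lambda>b. \<omega> (inv \<sigma> b)) a))"
proof -
  note inv\<sigma> = automorphismD[OF \<sigma>_inv_auto]
  obtain \<eta> c where \<eta>: "functional sA \<eta>" "\<omega> = (\<lambda>b. \<eta> (b * c))"
    using assms by (auto simp: coverable_def)
  have func: "functional sA (\<lambda>b. \<eta> (inv \<sigma> b))"
    using functional_comp[OF \<eta>(1)] \<sigma>_inv_auto by (simp add: automorphism_def)
  have "AA.act \<omega> (inv \<sigma> a) = slice1 sA AA \<eta> (AA.R (inv \<sigma> a) (inv \<sigma> (\<sigma> c)))"
    by (simp add: \<eta>(2) AA.act_R[OF \<eta>(1)] \<sigma>_simps)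
  also have "\<dots> = inv S (inv S (slice1 sA AA (\<lambda>b. \<eta> (inv \<sigma> b)) (AA.R a (\<sigma> c))))"
    unfolding comult_inv_\<sigma> AA.slice1_tsum[OF func]
    by (simp add: tsum_additive[of "slice1 sA AA \<eta>"] AA.slice1_linear[OF \<eta>(1)]
        tsum_additive[of "inv S"] inv_S_simps)
  also have "slice1 sA AA (\<lambda>b. \<eta> (inv \<sigma> b)) (AA.R a (\<sigma> c)) = AA.act (\<lambda>b. \<omega> (inv \<sigma> b)) a"
    using AA.act_R[OF func, of "\<sigma> c" a] by (simp add: \<eta>(2) inv\<sigma> \<sigma>_simps)
  finally show ?thesis .
qed

lemma act_\<sigma>: "coverable sA \<omega> \<Longrightarrow> AA.act \<omega> (\<sigma> a) = S (S (AA.act (\<lambda>b. \<omega> (\<sigma> b)) a))"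
  using act_inv_\<sigma>[OF coverable_comp[OF _ \<sigma>_auto], of \<omega> "\<sigma> a"] by (simp add: \<sigma>_simps S_inv)

text \<open>\<open>S\<^sup>2\<close> is an automorphism that preserves \<open>\<phi>\<close> up to a scalar.\<close>

lemma S2_\<sigma>: "S (S (\<sigma> a)) = \<sigma> (S (S a))"
proof (rule \<phi>_cancel)
  fix c
  have "\<phi> (c * S (S (\<sigma> a))) = \<phi> (S (S (inv S (inv S c) * \<sigma> a)))"
    by (simp add: antipode_simps S_inv)
  also have "\<dots> = \<phi> (S (S (a * inv S (inv S c))))"
    by (simp add: scaling KMS[of a])
  also have "\<dots> = \<phi> (S (S a) * c)"
    by (simp add: antipode_simps S_inv)
  finally show "\<phi> (c * S (S (\<sigma> a))) = \<phi> (c * \<sigma> (S (S a)))"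
    by (simp add: KMS[of "S (S a)"])
qed

text \<open>The modular element of the dual, which is a character of \<open>A\<close>.\<close>

definition \<chi> :: "'a \<Rightarrow> 'k" where "\<chi> a = \<epsilon> (inv \<sigma> a)"

lemma \<chi>_simps: "functional sA \<chi>" "\<chi> (a * b) = \<chi> a * \<chi> b" "coverable sA \<chi>"
proof -
  note inv\<sigma> = automorphismD[OF \<sigma>_inv_auto]
  have *: "functional sA \<chi>" "\<And>a b. \<chi> (a * b) = \<chi> a * \<chi> b"
    by (simp_all add: functional_iff A.vector_space_axioms \<chi>_def inv\<sigma> counit_simps)
  obtain e where "\<epsilon> e = 1"
    using counit_one by blast
  then have "\<chi> (\<sigma> e) \<noteq> 0"
    by (simp add: \<chi>_def \<sigma>_simps)
  with * show "functional sA \<chi>" "\<chi> (a * b) = \<chi> a * \<chi> b" "coverable sA \<chi>"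
    by (blast intro: coverable_character)+
qed

lemma coverable_counit: "coverable sA \<epsilon>" "coverable sA (\<lambda>a. \<epsilon> (\<sigma> a))"
proof -
  show "coverable sA \<epsilon>"
    using counit_simps counit_one by (intro coverable_character) (blast, blast, metis zero_neq_one)
  then show "coverable sA (\<lambda>a. \<epsilon> (\<sigma> a))"
    by (rule coverable_comp[OF _ \<sigma>_auto])
qed

text \<open>Apply \<open>\<iota> \<otimes> \<epsilon>\<close> to \<open>\<Delta> \<sigma>\<^sup>-\<^sup>1 = (S\<^sup>-\<^sup>2 \<otimes> \<sigma>\<^sup>-\<^sup>1)\<Delta>\<close>. Hence \<open>\<theta>\<close> is \<open>S\<^sup>2\<close> for \<open>A\<close> as a coaction over itself.\<close>

lemma act_\<chi>: "\<sigma> (AA.act \<chi> a) = S (S a)"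
proof -
  have "inv \<sigma> a = inv S (inv S (AA.act \<chi> a))"
    using act_inv_\<sigma>[OF coverable_counit(1), of a] by (simp add: self.act_counit \<chi>_def[abs_def])
  then have "AA.act \<chi> a = S (S (inv \<sigma> a))"
    by (simp add: S_inv)
  then show ?thesis
    by (simp add: S2_\<sigma>[symmetric] \<sigma>_simps)
qed

text \<open>The characters \<open>\<chi>\<close> and \<open>\<epsilon> \<sigma>\<close> are inverse for convolution. One of the two products is the
  counit by the formula for \<open>\<sigma>(\<chi> \<cdot> a)\<close>. As the antipode provides a left inverse \<open>\<epsilon> \<sigma> S\<close> of \<open>\<epsilon> \<sigma>\<close>, that left
  inverse equals \<open>\<chi>\<close>, and the other product is the counit as well.\<close>

lemma \<chi>_inverse: "\<chi> (AA.act (\<lambda>a. \<epsilon> (\<sigma> a)) a) = \<epsilon> a" "\<epsilon> (\<sigma> (AA.act \<chi> a)) = \<epsilon> a"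
  and \<chi>_eq: "\<chi> a = \<epsilon> (\<sigma> (S a))"
proof -
  let ?f = "\<lambda>a. \<epsilon> (\<sigma> a)"
  have f: "?f (a * b) = ?f a * ?f b" "?f (a + b) = ?f a + ?f b" "?f (sA c a) = c * ?f a" for a b c
    by (simp_all add: \<sigma>_simps counit_simps)
  then have func: "functional sA ?f"
    by (simp add: functional_iff A.vector_space_axioms)
  obtain e where e: "?f e = 1"
    using counit_one \<sigma>_simps(5) by metis
  have fS: "?f (S (AA.act ?f a)) = \<epsilon> a" for a
  proof -
    have "AA.act ?f a = tsum AA (AA.R a e) (\<lambda>p q. sA (?f q) p)"
      using AA.act_R[OF func, of e a] e by (simp add: f AA.slice1_tsum[OF func])
    then have "?f (S (AA.act ?f a)) = tsum AA (AA.R a e) (\<lambda>p q. ?f (S p * q))"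
      by (simp add: tsum_additive[of S] tsum_additive[of ?f] f antipode_simps mult.commute)
    also have "\<dots> = ?f (tsum AA (AA.R a e) (\<lambda>p q. S p * q))"
      by (rule tsum_additive[symmetric]) (rule f)
    finally show ?thesis
      using e by (simp add: antipode_tsum f)
  qed
  show *: "?f (AA.act \<chi> a) = \<epsilon> a" for a
    by (simp add: act_\<chi> counit_antipode)
  then have "AA.act ?f (AA.act \<chi> a) = a" for a
    by (simp add: self.act_act[OF coverable_counit(2) \<chi>_simps(3)] self.act_counit)
  then show eq: "\<chi> a = ?f (S a)" for a
    using fS[of "AA.act \<chi> a"] by (simp add: counit_act \<chi>_simps)
  show "\<chi> (AA.act ?f a) = \<epsilon> a"
    by (simp add: eq fS)
qed

text \<open>Thus \<open>\<epsilon> \<sigma>\<^sup>-\<^sup>1 = \<epsilon> \<sigma>'\<^sup>-\<^sup>1\<close>.\<close>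

lemma \<chi>_eq': "\<chi> a = \<epsilon> (inv \<sigma>' a)"
proof -
  have "S a = inv \<sigma> (S (inv \<sigma>' a))"
    using S_\<sigma>'[of "inv \<sigma>' a"] by (simp add: \<sigma>'_simps)
  then have "\<sigma> (S a) = S (inv \<sigma>' a)"
    by (simp add: \<sigma>_simps)
  then show ?thesis
    by (simp add: \<chi>_eq counit_antipode)
qed

text \<open>In Sweedler notation \<open>\<sigma>'\<^sup>-\<^sup>1(a) = \<chi>(a\<^sub>1) S\<^sup>2(a\<^sub>2)\<close>: apply \<open>\<epsilon> \<sigma>'\<^sup>-\<^sup>1 \<otimes> \<iota>\<close> to
  \<open>\<Delta> = (\<sigma>' \<otimes> S\<^sup>-\<^sup>2)\<Delta> \<sigma>'\<^sup>-\<^sup>1\<close>.\<close>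

lemma \<chi>_act_S2:
  assumes "coverable sA \<omega>"
  shows "\<chi> (AA.act (\<lambda>b. \<omega> (S (S b))) a) = \<omega> (inv \<sigma>' a)"
proof -
  have "AA.act (\<lambda>b. \<omega> (S (S b))) (\<sigma>' y) = \<sigma>' (AA.act \<omega> y)" for y
    using self.act_eq_if_P_eq[OF \<sigma>'_auto, of "\<lambda>b. \<omega> (S (S b))" "\<lambda>b. inv S (inv S b)" \<sigma>' y]
      coverable_comp[OF assms automorphism_S2(1)] assms comult_\<sigma>'
    by (simp add: S_inv)
  from this[of "inv \<sigma>' a"] show ?thesis
    by (simp add: \<chi>_eq' \<sigma>'_simps counit_act assms)
qed

text \<open>The adjoint of the operator \<open>\<phi>(c \<cdot>)\<close> with respect to \<open>\<phi>\<close> is the operator \<open>\<phi>(\<cdot> S(c))\<close>. The equation is linear in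
  \<open>a \<otimes> c\<close>, so it can be checked for \<open>(p \<otimes> 1)\<Delta>(q)\<close> in place of \<open>a \<otimes> c\<close>. There both sides are \<open>\<phi>(p)\<phi>(q b)\<close> by left
  invariance; on the right this uses \<open>\<Delta>(p q\<^sub>1)(1 \<otimes> S(q\<^sub>2)) = \<Delta>(p)(q \<otimes> 1)\<close>.\<close>

lemma act_adjoint:
  "\<phi> (a * AA.act (\<lambda>d. \<phi> (c * d)) b) = \<phi> (AA.act (\<lambda>d. \<phi> (d * S c)) a * b)"
proof -
  let ?F = "\<lambda>t. \<phi> (slice1 sA AA \<phi> (t \<lhd> \<Delta> b))"
  have "bilinear_map sA sA (*) (\<lambda>u v. \<phi> (slice1 sA AA \<phi> (AA.R u (S v)) * b))"
    by (rule AA.bilinearI[OF vector_space_self])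
      (simp_all add: AA.covered_linear antipode_simps AA.slice1_linear[OF functional_\<phi>] distrib_right
        \<phi>_simps A.scale_mult_left)
  note lin = AA.tsum_linear[OF vector_space_self this]
  let ?G = "\<lambda>t. tsum AA t (\<lambda>u v. \<phi> (slice1 sA AA \<phi> (AA.R u (S v)) * b))"
  have F_add: "?F (s + t) = ?F s + ?F t" for s t
    by (simp add: act_add AA.slice1_linear[OF functional_\<phi>] \<phi>_simps)
  have "?F (AA.P p q) = ?G (AA.P p q)" for p q
  proof -
    let ?Q = "tsum AA (AA.P p q) (\<lambda>u v. AA.R u (S v))"
    have "?Q = unembed (\<Delta> p * leg1 AA q)"
      by (simp add: self.right_cover1[symmetric] AA.T.unembed_embed)
    then have "slice1 sA AA \<phi> ?Q = sA (\<phi> p) q"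
      by (simp add: left_invariant)
    then have "?G (AA.P p q) = \<phi> (sA (\<phi> p) q * b)"
      by (subst tsum_additive[of "\<lambda>t. \<phi> (slice1 sA AA \<phi> t * b)", symmetric])
        (simp_all add: AA.slice1_linear[OF functional_\<phi>] \<phi>_simps distrib_right)
    also have "\<dots> = ?F (AA.P p q)"
      by (simp add: AA.covered_mult(1)[symmetric] left_invariant_P \<phi>_simps A.scale_mult_left)
    finally show ?thesis ..
  qed
  then have "?F t = ?G t" for t
    using P_surj[of t] by (auto simp: tsum_additive[of ?F, OF F_add] tsum_additive[of ?G, OF lin(1)])
  from this[of "pure AA a c"] show ?thesis
    by (simp add: lin AA.act_R[OF functional_\<phi>] AA.pure_act AA.slice1_act[OF functional_\<phi>]
        AA.mult_act[OF coverable_left])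
qed

end

section \<open>The automorphism \<open>\<theta>\<close>\<close>

locale integral_coaction =
    modular_coaction sA AA AA_A A_AA \<Delta> \<epsilon> S \<phi> \<sigma> \<sigma>' \<tau> sX XA XA_A X_AA \<alpha>
  for sA :: "'k::field \<Rightarrow> 'a::ring \<Rightarrow> 'a"
    and AA :: "('k, 'a, 'a, 'aa::ring) tensor"
    and AA_A :: "('k, 'aa, 'a, 'aaa::ring) tensor"
    and A_AA :: "('k, 'a, 'aa, 'aaa) tensor"
    and \<Delta> :: "'a \<Rightarrow> 'aa multiplier"
    and \<epsilon> :: "'a \<Rightarrow> 'k" and S :: "'a \<Rightarrow> 'a" and \<phi> :: "'a \<Rightarrow> 'k" and \<sigma> \<sigma>' :: "'a \<Rightarrow> 'a" and \<tau> :: 'k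
    and sX :: "'k \<Rightarrow> 'x::ring \<Rightarrow> 'x"
    and XA :: "('k, 'x, 'a, 'xa::ring) tensor"
    and XA_A :: "('k, 'xa, 'a, 'xaa::ring) tensor"
    and X_AA :: "('k, 'x, 'aa, 'xaa) tensor"
    and \<alpha> :: "'x \<Rightarrow> 'xa multiplier" +
  fixes \<phi>\<^sub>X :: "'x \<Rightarrow> 'k" and \<sigma>\<^sub>X :: "'x \<Rightarrow> 'x"
  assumes functional_\<phi>\<^sub>X: "functional sX \<phi>\<^sub>X" and faithful_\<phi>\<^sub>X: "faithful \<phi>\<^sub>X"
    and \<phi>\<^sub>X_integral: "slice1 sX XA \<phi> (XA.P z x) = sX (\<phi>\<^sub>X x) z"
    and modular_\<phi>\<^sub>X: "modular_automorphism sX \<phi>\<^sub>X \<sigma>\<^sub>X"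
begin

lemmas \<sigma>\<^sub>X_auto = modular_automorphismD(2)[OF modular_\<phi>\<^sub>X]
lemmas \<sigma>\<^sub>X_simps = automorphismD[OF \<sigma>\<^sub>X_auto]
lemmas KMS_X = modular_automorphismD(1)[OF modular_\<phi>\<^sub>X]
lemmas \<phi>\<^sub>X_simps = functional_\<phi>\<^sub>X[unfolded functional_iff[OF X.vector_space_axioms], THEN conjunct1, rule_format]
  functional_\<phi>\<^sub>X[unfolded functional_iff[OF X.vector_space_axioms], THEN conjunct2, rule_format]

lemma \<phi>\<^sub>X_cancel: "a = b" if "\<And>c. \<phi>\<^sub>X (c * a) = \<phi>\<^sub>X (c * b)"
proof -
  have "\<phi>\<^sub>X (c * (a - b)) = 0" for c
    using that[of c] \<phi>\<^sub>X_simps(1)[of "c * (a - b)" "c * b"] by (simp add: distrib_left[symmetric])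
  then have "a - b = 0"
    using faithful_\<phi>\<^sub>X unfolding faithful_def by blast
  then show ?thesis by simp
qed

lemma \<phi>\<^sub>X_eqI: "\<phi>\<^sub>X x = \<phi>\<^sub>X y" if "\<And>z. slice1 sX XA \<phi> (XA.P z x) = slice1 sX XA \<phi> (XA.P z y)"
proof -
  obtain z :: 'x where "z \<noteq> 0"
    using X.nonzero by blast
  then show ?thesis
    using that[of z] by (simp add: \<phi>\<^sub>X_integral X.scale_cancel_right)
qed

text \<open>The adjoint passes from \<open>A\<close> to \<open>X\<close>, because \<open>\<phi>\<^sub>X(x (\<omega> \<cdot> y)) 1 = x\<^sub>0 y\<^sub>0 \<phi>(x\<^sub>1 (\<omega> \<cdot> y\<^sub>1))\<close>: the
  functionals only act on the legs in \<open>A\<close>.\<close>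

lemma act_adjoint_X: "\<phi>\<^sub>X (x * XA.act (\<lambda>d. \<phi> (c * d)) y) = \<phi>\<^sub>X (XA.act (\<lambda>d. \<phi> (d * S c)) x * y)"
proof (rule \<phi>\<^sub>X_eqI)
  fix z
  let ?\<omega> = "\<lambda>d. \<phi> (c * d)" and ?\<omega>' = "\<lambda>d. \<phi> (d * S c)"
  note slice = XA.slice1_linear[OF functional_\<phi>]
  have P1: "XA.P z (x * XA.act ?\<omega> y) =
      tsum XA (XA.P z x) (\<lambda>u v. tsum XA (XA.P u y) (\<lambda>p q. pure XA p (v * AA.act ?\<omega> q)))"
    by (simp add: XA.covered_mult XA.act_\<alpha>_tsum[of "XA.P z x"] P_act[OF coverable_left] tsum_act XA.leg_pure)
  have P2: "XA.P z (XA.act ?\<omega>' x * y) =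
      tsum XA (XA.P z x) (\<lambda>u v. tsum XA (XA.P u y) (\<lambda>p q. pure XA p (AA.act ?\<omega>' v * q)))"
  proof -
    have "XA.P z (XA.act ?\<omega>' x * y) = tsum XA (XA.P z x) (\<lambda>u v. leg2 XA (AA.act ?\<omega>' v) \<rhd> XA.P u y)"
      by (simp add: XA.covered_mult P_act[OF coverable_right[OF functional_\<phi>]] tsum_act XA.pure_act)
    also have "\<dots> = tsum XA (XA.P z x) (\<lambda>u v. leg2 XA (AA.act ?\<omega>' v) \<rhd> tsum XA (XA.P u y) (pure XA))"
      by (simp add: XA.tsum_pure)
    finally show ?thesis
      by (simp add: tsum_act XA.leg_pure)
  qed
  show "slice1 sX XA \<phi> (XA.P z (x * XA.act ?\<omega> y)) = slice1 sX XA \<phi> (XA.P z (XA.act ?\<omega>' x * y))"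
    unfolding P1 P2 by (simp add: tsum_additive[of "slice1 sX XA \<phi>", OF slice(1)] slice(3) act_adjoint)
qed

text \<open>Moving \<open>\<sigma>\<^sub>X\<close> past a functional replaces the functional by its second adjoint: take the adjoint,
  commute with the modular property, take the adjoint again, and commute back.\<close>

lemma act_\<sigma>\<^sub>X_adjoint: "XA.act (\<lambda>b. \<phi> (c * b)) (\<sigma>\<^sub>X x) = \<sigma>\<^sub>X (XA.act (\<lambda>b. \<phi> (b * S (inv \<sigma> (S c)))) x)"
proof (rule \<phi>\<^sub>X_cancel)
  fix y
  let ?c = "inv \<sigma> (S c)"
  have adjoint: "(\<lambda>b. \<phi> (b * S c)) = (\<lambda>b. \<phi> (?c * b))"
    by (simp add: KMS[of ?c] \<sigma>_simps)
  have "\<phi>\<^sub>X (y * XA.act (\<lambda>b. \<phi> (c * b)) (\<sigma>\<^sub>X x)) = \<phi>\<^sub>X (XA.act (\<lambda>b. \<phi> (b * S c)) y * \<sigma>\<^sub>X x)"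
    by (rule act_adjoint_X)
  also have "\<dots> = \<phi>\<^sub>X (x * XA.act (\<lambda>b. \<phi> (?c * b)) y)"
    by (simp only: KMS_X[of x] adjoint)
  also have "\<dots> = \<phi>\<^sub>X (XA.act (\<lambda>b. \<phi> (b * S ?c)) x * y)"
    by (rule act_adjoint_X)
  also have "\<dots> = \<phi>\<^sub>X (y * \<sigma>\<^sub>X (XA.act (\<lambda>b. \<phi> (b * S ?c)) x))"
    by (rule KMS_X)
  finally show "\<phi>\<^sub>X (y * XA.act (\<lambda>b. \<phi> (c * b)) (\<sigma>\<^sub>X x)) = \<phi>\<^sub>X (y * \<sigma>\<^sub>X (XA.act (\<lambda>b. \<phi> (b * S ?c)) x))" .
qed

end

context modular_quantum_group
begin

lemma integral_self:
  "integral_coaction sA AA AA_A A_AA \<Delta> \<epsilon> S \<phi> \<sigma> \<sigma>' \<tau> sA AA AA_A A_AA \<Delta> \<phi> \<sigma>"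
  by unfold_locales (rule functional_\<phi> faithful_\<phi> left_invariant_P modular)+

text \<open>The second adjoint of \<open>\<omega> = \<phi>(c \<cdot>)\<close> is the convolution product \<open>\<chi> * \<omega>\<sigma>\<close>. It depends on \<open>A\<close> only, and in \<open>A\<close>
  there are two expressions for \<open>\<omega> \<cdot> \<sigma>(a)\<close>: the one through the second adjoint, and
  \<open>S\<^sup>2(\<omega>\<sigma> \<cdot> a) = \<sigma>(\<chi> \<cdot> (\<omega>\<sigma> \<cdot> a))\<close>.\<close>

lemma double_adjoint: "\<phi> (a * S (inv \<sigma> (S c))) = \<chi> (AA.act (\<lambda>b. \<phi> (c * \<sigma> b)) a)"
proof -
  interpret A: integral_coaction sA AA AA_A A_AA \<Delta> \<epsilon> S \<phi> \<sigma> \<sigma>' \<tau> sA AA AA_A A_AA \<Delta> \<phi> \<sigma>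
    by (rule integral_self)
  let ?\<omega> = "\<lambda>b. \<phi> (c * \<sigma> b)"
  have "\<sigma> (AA.act (\<lambda>b. \<phi> (b * S (inv \<sigma> (S c)))) a) = \<sigma> (AA.act \<chi> (AA.act ?\<omega> a))"
    by (simp add: A.act_\<sigma>\<^sub>X_adjoint[symmetric] act_\<sigma>[OF coverable_left] act_\<chi>)
  then have "AA.act (\<lambda>b. \<phi> (b * S (inv \<sigma> (S c)))) a = AA.act \<chi> (AA.act ?\<omega> a)"
    using \<sigma>_simps(6) by metis
  then have "\<epsilon> (AA.act (\<lambda>b. \<phi> (b * S (inv \<sigma> (S c)))) a) = \<epsilon> (AA.act \<chi> (AA.act ?\<omega> a))"
    by simp
  then show ?thesis
    by (simp add: counit_act coverable_right functional_\<phi> \<chi>_simps)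
qed

end

context integral_coaction
begin

definition \<theta> :: "'x \<Rightarrow> 'x" where "\<theta> x = \<sigma>\<^sub>X (XA.act \<chi> x)"

text \<open>With the second adjoint written as \<open>\<chi> * \<omega>\<sigma>\<close>, this is \<open>\<omega> \<cdot> \<sigma>\<^sub>X(x) = \<sigma>\<^sub>X(\<chi> \<cdot> (\<omega>\<sigma> \<cdot> x))\<close>.\<close>

lemma act_\<sigma>\<^sub>X: "XA.act (\<lambda>b. \<phi> (c * b)) (\<sigma>\<^sub>X x) = \<theta> (XA.act (\<lambda>b. \<phi> (c * \<sigma> b)) x)"
  using act_act[OF \<chi>_simps(3) coverable_comp[OF coverable_left[of c] \<sigma>_auto], where x = x]
  by (simp add: act_\<sigma>\<^sub>X_adjoint \<theta>_def double_adjoint)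

text \<open>Replace \<open>x\<close> by \<open>\<chi> \<cdot> x\<close> in the formula for \<open>\<sigma>\<^sub>X\<close> and use \<open>\<sigma>(\<chi> \<cdot> a) = S\<^sup>2(a)\<close>.\<close>

lemma act_\<theta>: "XA.act (\<lambda>b. \<phi> (c * b)) (\<theta> x) = \<theta> (XA.act (\<lambda>b. \<phi> (c * S (S b))) x)"
  using act_act[OF coverable_comp[OF coverable_left[of c] \<sigma>_auto] \<chi>_simps(3), where x = x]
  by (simp add: \<theta>_def[of x] act_\<sigma>\<^sub>X act_\<chi>)

text \<open>Here \<open>\<theta>(\<omega>S\<^sup>2 \<cdot> x) = \<sigma>\<^sub>X((\<chi> * \<omega>S\<^sup>2) \<cdot> x)\<close>, and \<open>\<chi> * \<omega>S\<^sup>2 = \<omega>\<sigma>'\<^sup>-\<^sup>1\<close>.\<close>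

lemma act_\<theta>': "XA.act (\<lambda>b. \<phi> (c * b)) (\<theta> x) = \<sigma>\<^sub>X (XA.act (\<lambda>b. \<phi> (c * inv \<sigma>' b)) x)"
  using act_act[OF \<chi>_simps(3) coverable_comp[OF coverable_left[of c] automorphism_S2(1)], where x = x]
    \<chi>_act_S2[OF coverable_left, of c]
  by (simp add: act_\<theta>, simp add: \<theta>_def)

text \<open>Characters act by homomorphisms, since \<open>\<alpha>\<close> is multiplicative.\<close>

lemma act_\<chi>_mult: "XA.act \<chi> (x * y) = XA.act \<chi> x * XA.act \<chi> y"
proof (rule X.eq_if_left_mult_eq)
  fix z
  note slice = XA.slice1_linear[OF \<chi>_simps(1)]
  have "slice1 sX XA \<chi> (leg2 XA v \<rhd> XA.P u y) = sX (\<chi> v) u * XA.act \<chi> y" for u v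
    using XA.slice1_scale[OF \<chi>_simps(1), of "\<chi> v"]
    by (simp only: XA.slice1_act(3)[OF \<chi>_simps(1)] \<chi>_simps(2) XA.mult_act[OF \<chi>_simps(3)]
        XA.covered_linear(3) slice(2))
  note leg = this
  have "z * XA.act \<chi> (x * y) = slice1 sX XA \<chi> (tsum XA (XA.P z x) (\<lambda>u v. leg2 XA v \<rhd> XA.P u y))"
    by (simp only: XA.mult_act[OF \<chi>_simps(3)] XA.covered_mult XA.act_\<alpha>_tsum)
  also have "\<dots> = tsum XA (XA.P z x) (\<lambda>u v. sX (\<chi> v) u) * XA.act \<chi> y"
    by (simp only: tsum_additive[of "slice1 sX XA \<chi>", OF slice(1)] leg tsum_mult)
  also have "\<dots> = z * XA.act \<chi> x * XA.act \<chi> y"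
    by (simp only: XA.slice1_tsum[OF \<chi>_simps(1), symmetric] XA.mult_act[OF \<chi>_simps(3)])
  finally show "z * XA.act \<chi> (x * y) = z * (XA.act \<chi> x * XA.act \<chi> y)"
    by (simp only: mult.assoc)
qed

lemma bij_act_\<chi>: "bij (XA.act \<chi>)"
proof (rule o_bij)
  show "XA.act (\<lambda>a. \<epsilon> (\<sigma> a)) \<circ> XA.act \<chi> = id" "XA.act \<chi> \<circ> XA.act (\<lambda>a. \<epsilon> (\<sigma> a)) = id"
    by (auto simp: act_act coverable_counit \<chi>_simps \<chi>_inverse act_counit)
qed

lemma \<theta>_auto: "automorphism sX \<theta>"
  unfolding automorphism_def
proof (intro conjI allI)
  show "Vector_Spaces.linear sX sX \<theta>"
    by (rule linearI) (simp_all add: X.vector_space_axioms \<theta>_def XA.act_linear[OF \<chi>_simps(3)] \<sigma>\<^sub>X_simps)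
  show "bij \<theta>"
    using bij_comp[OF bij_act_\<chi> \<sigma>\<^sub>X_simps(4)] by (simp add: \<theta>_def[abs_def] comp_def)
qed (simp add: \<theta>_def act_\<chi>_mult \<sigma>\<^sub>X_simps)

lemmas \<theta>_simps = automorphismD[OF \<theta>_auto]

lemma P_\<sigma>\<^sub>X: "XA.P (\<theta> z) (\<sigma>\<^sub>X x) = tensor_endo XA \<theta> \<sigma> (XA.P z x)"
  unfolding XA.tensor_endo_tsum[OF \<theta>_auto \<sigma>_auto]
  by (rule P_eq_if_act_eq[OF \<theta>_auto \<sigma>_auto act_\<sigma>\<^sub>X])

lemma P_\<theta>: "XA.P (\<theta> z) (\<theta> x) = tensor_endo XA \<theta> (\<lambda>a. S (S a)) (XA.P z x)"
  unfolding XA.tensor_endo_tsum[OF \<theta>_auto automorphism_S2(1)]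
  by (rule P_eq_if_act_eq[OF \<theta>_auto automorphism_S2(1) act_\<theta>])

lemma P_\<theta>': "XA.P (\<sigma>\<^sub>X z) (\<theta> x) = tensor_endo XA \<sigma>\<^sub>X (inv \<sigma>') (XA.P z x)"
  unfolding XA.tensor_endo_tsum[OF \<sigma>\<^sub>X_auto \<sigma>'_inv_auto]
  by (rule P_eq_if_act_eq[OF \<sigma>\<^sub>X_auto \<sigma>'_inv_auto act_\<theta>'])

text \<open>Evaluating \<open>\<alpha> \<sigma>\<^sub>X = (\<theta> \<otimes> \<sigma>)\<alpha>\<close> on \<open>\<chi> = \<epsilon> \<sigma>\<^sup>-\<^sup>1\<close> gives \<open>\<chi> \<cdot> \<sigma>\<^sub>X(x) = \<theta>(x)\<close>; apply \<open>\<sigma>\<^sub>X\<close>.\<close>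

lemma \<theta>_\<sigma>\<^sub>X: "\<theta> (\<sigma>\<^sub>X x) = \<sigma>\<^sub>X (\<theta> x)"
proof -
  have "(\<lambda>b. \<chi> (\<sigma> b)) = \<epsilon>"
    by (simp add: \<chi>_def \<sigma>_simps)
  then have "XA.act \<chi> (\<sigma>\<^sub>X x) = \<theta> x"
    using act_eq_if_P_eq[OF \<theta>_auto \<chi>_simps(3), of \<sigma> \<sigma>\<^sub>X x] P_\<sigma>\<^sub>X coverable_counit(1)
    by (simp add: XA.tensor_endo_tsum[OF \<theta>_auto \<sigma>_auto] act_counit)
  then show ?thesis
    by (simp add: \<theta>_def)
qed

text \<open>Apply \<open>\<iota> \<otimes> \<phi>\<close> to \<open>\<alpha> F = (G \<otimes> h)\<alpha>\<close>.\<close>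

lemma \<phi>\<^sub>X_endo:
  assumes G: "automorphism sX G" and h: "automorphism sA h"
    and eq: "\<And>z x. XA.P (G z) (F x) = tensor_endo XA G h (XA.P z x)"
    and scale: "\<And>a. \<phi> (h a) = c * \<phi> a"
  shows "\<phi>\<^sub>X (F x) = c * \<phi>\<^sub>X x"
proof -
  obtain z :: 'x where "z \<noteq> 0"
    using X.nonzero by blast
  have "sX (\<phi>\<^sub>X (F x)) z = slice1 sX XA \<phi> (XA.P (G (inv G z)) (F x))"
    by (simp add: \<phi>\<^sub>X_integral automorphismD[OF G])
  also have "\<dots> = tsum XA (XA.P (inv G z) x) (\<lambda>u v. sX c (G (sX (\<phi> v) u)))"
    unfolding eq XA.tensor_endo_tsum[OF G h]
    by (subst tsum_additive[of "slice1 sX XA \<phi>"])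
      (simp_all add: XA.slice1_linear[OF functional_\<phi>] scale automorphismD[OF G])
  also have "\<dots> = sX c (G (slice1 sX XA \<phi> (XA.P (inv G z) x)))"
    unfolding XA.slice1_tsum[OF functional_\<phi>]
    by (subst tsum_additive[of "\<lambda>t. sX c (G t)"]) (simp_all add: automorphismD[OF G] X.scale_right_distrib)
  also have "\<dots> = sX (c * \<phi>\<^sub>X x) z"
    by (simp add: \<phi>\<^sub>X_integral automorphismD[OF G])
  finally show ?thesis
    using \<open>z \<noteq> 0\<close> by (simp add: X.scale_cancel_right)
qed

lemma \<phi>\<^sub>X_\<theta>: "\<phi>\<^sub>X (\<theta> x) = \<tau> * \<phi>\<^sub>X x"
  by (rule \<phi>\<^sub>X_endo[OF \<theta>_auto automorphism_S2(1) P_\<theta>]) (rule scaling)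

end

section \<open>The modular element of a Galois object\<close>

locale galois_integrals =
    integral_coaction sA AA AA_A A_AA \<Delta> \<epsilon> S \<phi> \<sigma> \<sigma>' \<tau> sX XA XA_A X_AA \<alpha> \<phi>\<^sub>X \<sigma>\<^sub>X
  for sA :: "'k::field \<Rightarrow> 'a::ring \<Rightarrow> 'a"
    and AA :: "('k, 'a, 'a, 'aa::ring) tensor"
    and AA_A :: "('k, 'aa, 'a, 'aaa::ring) tensor"
    and A_AA :: "('k, 'a, 'aa, 'aaa) tensor"
    and \<Delta> :: "'a \<Rightarrow> 'aa multiplier"
    and \<epsilon> :: "'a \<Rightarrow> 'k" and S :: "'a \<Rightarrow> 'a" and \<phi> :: "'a \<Rightarrow> 'k" and \<sigma> \<sigma>' :: "'a \<Rightarrow> 'a" and \<tau> :: 'k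
    and sX :: "'k \<Rightarrow> 'x::ring \<Rightarrow> 'x"
    and XA :: "('k, 'x, 'a, 'xa::ring) tensor"
    and XA_A :: "('k, 'xa, 'a, 'xaa::ring) tensor"
    and X_AA :: "('k, 'x, 'aa, 'xaa) tensor"
    and \<alpha> :: "'x \<Rightarrow> 'xa multiplier" and \<phi>\<^sub>X :: "'x \<Rightarrow> 'k" and \<sigma>\<^sub>X :: "'x \<Rightarrow> 'x" +
  fixes \<psi>\<^sub>X :: "'x \<Rightarrow> 'k" and \<delta> \<delta>' :: "'x multiplier"
  assumes functional_\<psi>\<^sub>X: "functional sX \<psi>\<^sub>X"
    and \<psi>\<^sub>X_invariant: "slice2 sA XA \<psi>\<^sub>X (XA.R x b) = sA (\<psi>\<^sub>X x) b"
    and \<delta>_inverse: "\<delta> * \<delta>' = 1" "\<delta>' * \<delta> = 1"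
    and \<psi>\<^sub>X_eq: "\<psi>\<^sub>X x = \<phi>\<^sub>X (x \<lhd> \<delta>)"
begin

lemma \<delta>_cancel: "\<delta> \<rhd> \<delta>' \<rhd> x = x" "\<delta>' \<rhd> \<delta> \<rhd> x = x" "x \<lhd> \<delta> \<lhd> \<delta>' = x" "x \<lhd> \<delta>' \<lhd> \<delta> = x"
  using \<delta>_inverse by (simp_all add: act_simps(6,12)[symmetric] act_simps(2,8))

lemma faithful_\<psi>\<^sub>X: "faithful \<psi>\<^sub>X"
  unfolding faithful_def
proof (intro conjI allI impI)
  fix a assume *: "\<forall>b. \<psi>\<^sub>X (a * b) = 0"
  have "\<phi>\<^sub>X (a * b) = 0" for b
    using *[rule_format, of "b \<lhd> \<delta>'"] by (simp add: \<psi>\<^sub>X_eq act_assoc(2)[symmetric] \<delta>_cancel)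
  then show "a = 0"
    using faithful_\<phi>\<^sub>X unfolding faithful_def by blast
next
  fix a assume "\<forall>b. \<psi>\<^sub>X (b * a) = 0"
  then have "\<phi>\<^sub>X (b * (a \<lhd> \<delta>)) = 0" for b
    by (simp add: \<psi>\<^sub>X_eq act_assoc)
  then have "a \<lhd> \<delta> = 0"
    using faithful_\<phi>\<^sub>X unfolding faithful_def by blast
  then show "a = 0"
    using \<delta>_cancel(3)[of a] by (simp add: act_zero)
qed

text \<open>The modular automorphism of \<open>\<psi>\<^sub>X = \<phi>\<^sub>X(\<cdot> \<delta>)\<close>.\<close>

definition \<rho> :: "'x \<Rightarrow> 'x" where "\<rho> x = \<delta> \<rhd> (\<sigma>\<^sub>X x \<lhd> \<delta>')"

lemma \<rho>_auto: "automorphism sX \<rho>"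
  unfolding automorphism_def
proof (intro conjI allI)
  show "Vector_Spaces.linear sX sX \<rho>"
    by (rule linearI) (simp_all add: X.vector_space_axioms \<rho>_def \<sigma>\<^sub>X_simps act_add X.act_scale)
  show "\<rho> (a * b) = \<rho> a * \<rho> b" for a b
    by (simp add: \<rho>_def \<sigma>\<^sub>X_simps act_assoc(1,2) act_assoc(3)[symmetric] \<delta>_cancel)
  show "bij \<rho>"
  proof (rule o_bij)
    show "(\<lambda>y. inv \<sigma>\<^sub>X (\<delta>' \<rhd> (y \<lhd> \<delta>))) \<circ> \<rho> = id" "\<rho> \<circ> (\<lambda>y. inv \<sigma>\<^sub>X (\<delta>' \<rhd> (y \<lhd> \<delta>))) = id"
      by (auto simp: \<rho>_def \<sigma>\<^sub>X_simps X.lmult_rmult[symmetric] \<delta>_cancel)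
  qed
qed

lemma modular_\<psi>\<^sub>X: "modular_automorphism sX \<psi>\<^sub>X \<rho>"
  unfolding modular_automorphism_def
proof (intro conjI allI \<rho>_auto)
  fix x y
  have "\<psi>\<^sub>X (x * y) = \<phi>\<^sub>X ((y \<lhd> \<delta>) * \<sigma>\<^sub>X x)"
    by (simp add: \<psi>\<^sub>X_eq act_assoc(2)[symmetric] KMS_X[of x])
  also have "\<dots> = \<phi>\<^sub>X (y * (\<rho> x \<lhd> \<delta>))"
    by (simp add: \<rho>_def X.lmult_rmult \<delta>_cancel act_assoc(3))
  finally show "\<psi>\<^sub>X (x * y) = \<psi>\<^sub>X (y * \<rho> x)"
    by (simp add: \<psi>\<^sub>X_eq act_assoc(2))
qed

text \<open>\<open>\<alpha> \<rho> = (\<rho> \<otimes> S\<^sup>-\<^sup>2)\<alpha>\<close>, by invariance of \<open>\<psi>\<^sub>X\<close>.\<close>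

lemma P_\<rho>: "XA.P (\<rho> z) (\<rho> x) = tensor_endo XA \<rho> (\<lambda>a. inv S (inv S a)) (XA.P z x)"
  unfolding XA.tensor_endo_tsum[OF \<rho>_auto automorphism_S2(2)]
  by (rule P_eq_if_act_eq[OF \<rho>_auto automorphism_S2(2)])
    (rule act_modular_of_invariant[OF functional_\<psi>\<^sub>X faithful_\<psi>\<^sub>X \<psi>\<^sub>X_invariant modular_\<psi>\<^sub>X])

lemma \<phi>\<^sub>X_\<rho>: "\<tau> * \<phi>\<^sub>X (\<rho> x) = \<phi>\<^sub>X x"
proof -
  have "\<phi> (inv S (inv S a)) = inverse \<tau> * \<phi> a" for a
    using scaling_inv[of a, symmetric] \<tau>_nonzero by simp
  from \<phi>\<^sub>X_endo[OF \<rho>_auto automorphism_S2(2) P_\<rho> this] show ?thesis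
    using \<tau>_nonzero by simp
qed

lemma \<phi>\<^sub>X_\<sigma>\<^sub>X: "\<phi>\<^sub>X (\<sigma>\<^sub>X x) = \<phi>\<^sub>X x"
  by (rule X.in_all_if_spanning[OF span_products_X, of "\<lambda>x. \<phi>\<^sub>X (\<sigma>\<^sub>X x) = \<phi>\<^sub>X x"])
    (auto simp: \<sigma>\<^sub>X_simps \<phi>\<^sub>X_simps KMS_X[symmetric] linearD(3)[OF \<sigma>\<^sub>X_auto[unfolded automorphism_def, THEN conjunct1]])

text \<open>The modular property for a product with the multiplier \<open>\<delta>\<close>. For \<open>x = ab\<close> the elements \<open>a\<close> and \<open>b\<close> are moved past
  \<open>\<delta>\<close> one after the other, and such products span \<open>X\<close>.\<close>

lemma \<phi>\<^sub>X_mult_\<delta>: "\<phi>\<^sub>X (\<delta> \<rhd> \<sigma>\<^sub>X x) = \<phi>\<^sub>X (x \<lhd> \<delta>)"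
proof (rule X.in_all_if_spanning[OF span_products_X, of "\<lambda>x. \<phi>\<^sub>X (\<delta> \<rhd> \<sigma>\<^sub>X x) = \<phi>\<^sub>X (x \<lhd> \<delta>)"])
  fix x :: 'x assume "x \<in> {a * b | a b. True}"
  then obtain a b where x: "x = a * b" by blast
  have "\<phi>\<^sub>X (x \<lhd> \<delta>) = \<phi>\<^sub>X (b * (\<delta> \<rhd> \<sigma>\<^sub>X a))"
    using KMS_X[of a "b \<lhd> \<delta>"] by (simp add: x act_assoc)
  also have "\<dots> = \<phi>\<^sub>X (\<delta> \<rhd> \<sigma>\<^sub>X x)"
    using KMS_X[of b "\<delta> \<rhd> \<sigma>\<^sub>X a"] by (simp add: x \<sigma>\<^sub>X_simps act_assoc(1))
  finally show "\<phi>\<^sub>X (\<delta> \<rhd> \<sigma>\<^sub>X x) = \<phi>\<^sub>X (x \<lhd> \<delta>)" ..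
qed (auto simp: \<sigma>\<^sub>X_simps \<phi>\<^sub>X_simps act_add X.act_scale act_zero
    linearD(3)[OF \<sigma>\<^sub>X_auto[unfolded automorphism_def, THEN conjunct1]])

text \<open>\<open>\<rho>\<close> is \<open>\<sigma>\<^sub>X\<close> followed by conjugation with \<open>\<delta>\<close>. The first leaves \<open>\<phi>\<^sub>X\<close> invariant and \<open>\<rho>\<close> scales it by
  \<open>\<tau>\<^sup>-\<^sup>1\<close>, so conjugation accounts for the scalar.\<close>

lemma \<phi>\<^sub>X_conj_\<delta>: "\<phi>\<^sub>X (\<delta>' \<rhd> (x \<lhd> \<delta>)) = \<tau> * \<phi>\<^sub>X x"
proof -
  define w where "w = inv \<sigma>\<^sub>X (\<delta>' \<rhd> (x \<lhd> \<delta>))"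
  have "\<sigma>\<^sub>X w = \<delta>' \<rhd> (x \<lhd> \<delta>)"
    by (simp add: w_def \<sigma>\<^sub>X_simps)
  then have "\<rho> w = x"
    by (simp add: \<rho>_def X.lmult_rmult \<delta>_cancel)
  with \<open>\<sigma>\<^sub>X w = _\<close> show ?thesis
    using \<phi>\<^sub>X_\<rho>[of w] \<phi>\<^sub>X_\<sigma>\<^sub>X[of w] by simp
qed

lemma \<psi>\<^sub>X_\<sigma>\<^sub>X: "\<psi>\<^sub>X (\<sigma>\<^sub>X x) = \<tau> * \<psi>\<^sub>X x"
  using \<phi>\<^sub>X_conj_\<delta>[of "\<delta> \<rhd> \<sigma>\<^sub>X x"] by (simp add: \<psi>\<^sub>X_eq X.lmult_rmult \<delta>_cancel \<phi>\<^sub>X_mult_\<delta>)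

text \<open>Apply \<open>\<psi>\<^sub>X \<otimes> \<iota>\<close> to \<open>\<alpha> \<theta> = (\<sigma>\<^sub>X \<otimes> \<sigma>'\<^sup>-\<^sup>1)\<alpha>\<close>; the scaling of \<open>\<psi>\<^sub>X\<close> under \<open>\<sigma>\<^sub>X\<close> is known.\<close>

lemma \<psi>\<^sub>X_\<theta>: "\<psi>\<^sub>X (\<theta> x) = \<tau> * \<psi>\<^sub>X x"
proof -
  obtain a :: 'a where "a \<noteq> 0"
    using A.nonzero by blast
  note inv\<sigma>' = automorphismD[OF \<sigma>'_inv_auto]
  define b where "b = \<sigma>' a"
  have "sA (\<psi>\<^sub>X (\<theta> x)) a = slice2 sA XA \<psi>\<^sub>X (XA.R (\<theta> x) (inv \<sigma>' b))"
    by (simp add: \<psi>\<^sub>X_invariant b_def \<sigma>'_simps)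
  also have "\<dots> = tsum XA (XA.R x b) (\<lambda>u v. sA \<tau> (inv \<sigma>' (sA (\<psi>\<^sub>X u) v)))"
    unfolding XA.R_endo[OF \<sigma>\<^sub>X_auto \<sigma>'_inv_auto P_\<theta>'] XA.tensor_endo_tsum[OF \<sigma>\<^sub>X_auto \<sigma>'_inv_auto]
    by (subst tsum_additive[of "slice2 sA XA \<psi>\<^sub>X"])
      (simp_all add: XA.slice2_linear[OF functional_\<psi>\<^sub>X] \<psi>\<^sub>X_\<sigma>\<^sub>X inv\<sigma>')
  also have "\<dots> = sA \<tau> (inv \<sigma>' (slice2 sA XA \<psi>\<^sub>X (XA.R x b)))"
    unfolding XA.slice2_tsum[OF functional_\<psi>\<^sub>X]
    by (subst tsum_additive[of "\<lambda>t. sA \<tau> (inv \<sigma>' t)"]) (simp_all add: inv\<sigma>' A.scale_right_distrib)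
  also have "\<dots> = sA (\<tau> * \<psi>\<^sub>X x) a"
    by (simp add: \<psi>\<^sub>X_invariant inv\<sigma>' b_def \<sigma>'_simps)
  finally show ?thesis
    using \<open>a \<noteq> 0\<close> by (simp add: A.scale_cancel_right)
qed

text \<open>Since \<open>\<theta>\<close> scales \<open>\<phi>\<^sub>X\<close> and \<open>\<psi>\<^sub>X = \<phi>\<^sub>X(\<cdot> \<delta>)\<close> by the same constant, it fixes \<open>\<delta>\<close>.\<close>

lemma \<theta>_\<delta>: "mext_endo \<theta> \<delta> = \<delta>"
proof (rule X.mext_endo_eqI)
  show "surj \<theta>"
    using \<theta>_simps(4) by (rule bij_is_surj)
  show "\<theta> (a * b) = \<theta> a * \<theta> b" for a b
    by (rule \<theta>_simps)
  show "\<theta> x \<lhd> \<delta> = \<theta> (x \<lhd> \<delta>)" for x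
  proof (rule \<phi>\<^sub>X_cancel)
    fix c
    obtain y where y: "c = \<theta> y"
      using \<theta>_simps(5) by metis
    have "\<phi>\<^sub>X (c * (\<theta> x \<lhd> \<delta>)) = \<psi>\<^sub>X (\<theta> (y * x))"
      by (simp add: y \<psi>\<^sub>X_eq \<theta>_simps act_assoc)
    also have "\<dots> = \<tau> * \<phi>\<^sub>X (y * (x \<lhd> \<delta>))"
      using \<psi>\<^sub>X_\<theta>[of "y * x"] by (simp add: \<psi>\<^sub>X_eq act_assoc)
    also have "\<dots> = \<phi>\<^sub>X (c * \<theta> (x \<lhd> \<delta>))"
      by (simp add: \<phi>\<^sub>X_\<theta>[symmetric] y \<theta>_simps)
    finally show "\<phi>\<^sub>X (c * (\<theta> x \<lhd> \<delta>)) = \<phi>\<^sub>X (c * \<theta> (x \<lhd> \<delta>))" .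
  qed
qed

end

section \<open>Galois objects\<close>

text \<open>By surjectivity of the Galois map, \<open>x \<otimes> a\<close> is a sum of elements \<open>(y \<otimes> 1)\<alpha>(z)\<close>. Applying \<open>\<iota> \<otimes> \<omega>\<close> writes
  \<open>\<omega>(a) x\<close> as a sum of products \<open>y (\<omega> \<cdot> z)\<close>.\<close>

lemma span_products_galois:
  fixes sX :: "'k::field \<Rightarrow> 'x::ring \<Rightarrow> 'x"
  assumes "algebraic_quantum_group sA AA AA_A A_AA \<Delta> \<epsilon> S \<phi>"
    and "galois_object sA AA AA_A A_AA \<Delta> sX XA XA_A X_AA \<alpha> XX"
  shows "module.span sX {x * y | x y. True} = UNIV"
proof -
  interpret algebraic_quantum_group sA AA AA_A A_AA \<Delta> \<epsilon> S \<phi> by fact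
  interpret galois_object sA AA AA_A A_AA \<Delta> sX XA XA_A X_AA \<alpha> XX by fact
  have "bilinear_map sX sX (tscale XA) XA.P"
    by (rule XX.bilinearI[OF XA.T.vector_space_axioms]) (simp_all add: XA.covered_linear)
  then have lift: "tensor_lift XX (tscale XA) (\<lambda>x y. unembed (leg1 XA x * \<alpha> y)) s = tsum XX s XA.P" for s
    using XX.tensor_lift_tsum[OF XA.T.vector_space_axioms] unfolding XA.P_def by blast
  obtain a0 where "\<phi> a0 \<noteq> 0"
    using nonzero_\<phi> by blast
  moreover have "\<phi> 0 = 0"
    using functional_\<phi> linearD(3) by (auto simp: functional_def)
  ultimately have "a0 \<noteq> 0"
    by auto
  then obtain c where c: "\<phi> (a0 * c) \<noteq> 0"
    using faithful_\<phi> unfolding faithful_def by blast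
  define \<omega> where "\<omega> = (\<lambda>b. \<phi> (b * c))"
  have cov: "coverable sA \<omega>"
    using functional_\<phi> by (auto simp: coverable_def \<omega>_def)
  note slice = XA.slice1_linear[OF A.coverable_functional[OF cov]]
  have "x \<in> X.span {x * y | x y. True}" for x
  proof -
    obtain s where s: "tsum XX s XA.P = pure XA x a0"
      using galois lift unfolding bijective_onto_algebra_def bij_def surj_def by metis
    have "sX (\<omega> a0) x = slice1 sX XA \<omega> (pure XA x a0)"
      by (simp add: slice)
    also have "\<dots> = tsum XX s (\<lambda>y z. y * XA.act \<omega> z)"
      by (simp only: s[symmetric] tsum_additive[of "slice1 sX XA \<omega>", OF slice(1)] XA.mult_act[OF cov])
    also have "\<dots> \<in> X.span {x * y | x y. True}"
      by (rule tsum_mem) (auto intro: X.span_base X.span_zero X.span_add)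
    finally have "sX (inverse (\<omega> a0)) (sX (\<omega> a0) x) \<in> X.span {x * y | x y. True}"
      by (rule X.span_scale)
    then show ?thesis
      using c by (simp add: \<omega>_def)
  qed
  then show ?thesis
    by blast
qed

theorem proposition2p17:
  fixes sA :: "'k::field \<Rightarrow> 'a::ring \<Rightarrow> 'a"
    and AA :: "('k, 'a, 'a, 'aa::ring) tensor"
    and AA_A :: "('k, 'aa, 'a, 'aaa::ring) tensor"
    and A_AA :: "('k, 'a, 'aa, 'aaa) tensor"
    and \<Delta> :: "'a \<Rightarrow> 'aa multiplier"
    and \<epsilon> \<phi> \<psi> :: "'a \<Rightarrow> 'k" and S \<sigma> \<sigma>' :: "'a \<Rightarrow> 'a" and \<tau> :: 'k
    and sX :: "'k \<Rightarrow> 'x::ring \<Rightarrow> 'x"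
    and XA :: "('k, 'x, 'a, 'xa::ring) tensor"
    and XA_A :: "('k, 'xa, 'a, 'xaa::ring) tensor"
    and X_AA :: "('k, 'x, 'aa, 'xaa) tensor"
    and XX :: "('k, 'x, 'x, 'xx::ab_group_add) tensor"
    and \<alpha> :: "'x \<Rightarrow> 'xa multiplier"
    and \<phi>\<^sub>X \<psi>\<^sub>X :: "'x \<Rightarrow> 'k" and \<delta>\<^sub>X :: "'x multiplier" and \<sigma>\<^sub>X \<theta>\<^sub>X :: "'x \<Rightarrow> 'x"
  assumes "algebraic_quantum_group sA AA AA_A A_AA \<Delta> \<epsilon> S \<phi>"
    and "\<psi> = \<phi> \<circ> S"
    and "modular_automorphism sA \<phi> \<sigma>"
    and "modular_automorphism sA \<psi> \<sigma>'"
    and "\<And>a. \<phi> (S (S a)) = \<tau> * \<phi> a"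
    and "galois_object sA AA AA_A A_AA \<Delta> sX XA XA_A X_AA \<alpha> XX"
    and "functional sX \<phi>\<^sub>X" and "faithful \<phi>\<^sub>X"
    and "\<And>x. mslice1 sX XA \<phi> (\<alpha> x) = mscalar sX (\<phi>\<^sub>X x)"
    and "functional sX \<psi>\<^sub>X" and "\<exists>x. \<psi>\<^sub>X x \<noteq> 0"
    and "\<And>x. mslice2 sA XA \<psi>\<^sub>X (\<alpha> x) = mscalar sA (\<psi>\<^sub>X x)"
    and "invertible_multiplier \<delta>\<^sub>X"
    and "\<And>x. \<phi>\<^sub>X (x \<lhd> \<delta>\<^sub>X) = \<psi>\<^sub>X x"
    and "modular_automorphism sX \<phi>\<^sub>X \<sigma>\<^sub>X"
    and "\<And>x. \<theta>\<^sub>X x = \<sigma>\<^sub>X (functional_action sX XA \<alpha> (dual_modular_element \<epsilon> \<sigma>) x)"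
  shows "\<alpha> \<circ> \<sigma>\<^sub>X = mext_endo (tensor_endo XA \<theta>\<^sub>X \<sigma>) \<circ> \<alpha> \<and>
    \<alpha> \<circ> \<theta>\<^sub>X = mext_endo (tensor_endo XA \<theta>\<^sub>X (S \<circ> S)) \<circ> \<alpha> \<and>
    \<alpha> \<circ> \<theta>\<^sub>X = mext_endo (tensor_endo XA \<sigma>\<^sub>X (inv \<sigma>')) \<circ> \<alpha> \<and>
    \<sigma>\<^sub>X \<circ> \<theta>\<^sub>X = \<theta>\<^sub>X \<circ> \<sigma>\<^sub>X \<and>
    mext_endo \<theta>\<^sub>X \<delta>\<^sub>X = \<delta>\<^sub>X \<and>
    (\<forall>x. \<phi>\<^sub>X (\<theta>\<^sub>X x) = \<phi>\<^sub>X (minverse \<delta>\<^sub>X \<rhd> (x \<lhd> \<delta>\<^sub>X)) \<and>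
         \<phi>\<^sub>X (minverse \<delta>\<^sub>X \<rhd> (x \<lhd> \<delta>\<^sub>X)) = \<tau> * \<phi>\<^sub>X x)"
proof -
  interpret AQG: algebraic_quantum_group sA AA AA_A A_AA \<Delta> \<epsilon> S \<phi> by fact
  interpret GO: galois_object sA AA AA_A A_AA \<Delta> sX XA XA_A X_AA \<alpha> XX by fact
  interpret FC: full_coaction sA AA AA_A A_AA \<Delta> \<epsilon> S \<phi> sX XA XA_A X_AA \<alpha>
    by unfold_locales (rule span_products_galois assms)+
  obtain \<delta>' where \<delta>': "\<delta>\<^sub>X * \<delta>' = 1" "\<delta>' * \<delta>\<^sub>X = 1"
    using assms(13) by (auto simp: invertible_multiplier_def)
  have "minverse \<delta>\<^sub>X = \<delta>'"
    unfolding minverse_def using \<delta>' by (intro the_equality) (auto, metis mult.assoc mult.right_neutral mult.left_neutral)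
  interpret galois_integrals sA AA AA_A A_AA \<Delta> \<epsilon> S \<phi> \<sigma> \<sigma>' \<tau> sX XA XA_A X_AA \<alpha> \<phi>\<^sub>X \<sigma>\<^sub>X
      \<psi>\<^sub>X \<delta>\<^sub>X \<delta>'
  proof unfold_locales
    show "slice1 sX XA \<phi> (GO.XA.P z x) = sX (\<phi>\<^sub>X x) z" for z x
      using FC.rmult_mslice1[OF AQG.functional_\<phi>, of z x] by (simp add: assms(9) GO.X.mscalar_act)
    show "slice2 sA XA \<psi>\<^sub>X (GO.XA.R x b) = sA (\<psi>\<^sub>X x) b" for x b
      using FC.lmult_mslice2[OF assms(10), of x b] by (simp add: assms(12) AQG.A.mscalar_act)
  qed (use assms \<delta>' in simp_all)
  have "dual_modular_element \<epsilon> \<sigma> = \<chi>"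
    by (auto simp: dual_modular_element_def \<chi>_def)
  then have \<theta>: "\<theta>\<^sub>X = \<theta>"
    using assms(16) FC.functional_action_eq_act[OF \<chi>_simps(3)] by (auto simp: \<theta>_def)
  have SS: "S \<circ> S = (\<lambda>a. S (S a))"
    by auto
  have "\<alpha> \<circ> \<sigma>\<^sub>X = mext_endo (tensor_endo XA \<theta> \<sigma>) \<circ> \<alpha>"
    by (rule ext) (simp add: GO.XA.hom_eq_mext_endo[OF \<theta>_auto \<sigma>_auto P_\<sigma>\<^sub>X])
  moreover have "\<alpha> \<circ> \<theta> = mext_endo (tensor_endo XA \<theta> (\<lambda>a. S (S a))) \<circ> \<alpha>"
    by (rule ext) (simp add: GO.XA.hom_eq_mext_endo[OF \<theta>_auto automorphism_S2(1) P_\<theta>])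
  moreover have "\<alpha> \<circ> \<theta> = mext_endo (tensor_endo XA \<sigma>\<^sub>X (inv \<sigma>')) \<circ> \<alpha>"
    by (rule ext) (simp add: GO.XA.hom_eq_mext_endo[OF \<sigma>\<^sub>X_auto \<sigma>'_inv_auto P_\<theta>'])
  moreover have "\<sigma>\<^sub>X \<circ> \<theta> = \<theta> \<circ> \<sigma>\<^sub>X"
    by (rule ext) (simp add: \<theta>_\<sigma>\<^sub>X)
  ultimately show ?thesis
    unfolding \<theta> SS \<open>minverse \<delta>\<^sub>X = \<delta>'\<close>
    by (simp add: \<theta>_\<delta> \<phi>\<^sub>X_\<theta> \<phi>\<^sub>X_conj_\<delta>)
qed

end
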